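(* Let $\mathbf{W}=\{\mathbf{W}(t):t\ge 0\}$ be standard planar Brownian motion started at the origin, let $\mathrm{H}=\operatorname{conv}\{\mathbf{W}(s):s\in[0,1]\}$, and let $\mathsf{R}$ be the circumradius of $\mathrm{H}$. Then $$0.928\le \mathbb{E}[\mathsf{R}]\le \sqrt{2\log 2}\approx 1.1775.$$
   Context: Standard planar Brownian motion is $\mathbf{W}(t)=(W_1(t),W_2(t))$ with $W_1,W_2$ independent one-dimensional standard Brownian motions started at $0$. $\operatorname{conv}A$ is the convex hull of $A\subset\mathbb{R}^2$. The circumradius of a bounded set is the radius of the smallest disk containing it. $\log$ is the natural logarithm; the symbol $\approx$ only indicates a numerical approximation of the exact expression. *)

theory Defs
  imports "HOL-Probability.Probability"
begin

locale standard_brownian_motion = prob_space M for M :: "'a measure" +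
  fixes B :: "real \<Rightarrow> 'a \<Rightarrow> real"  \<comment> \<open>only times \<open>t \<ge> 0\<close> are relevant\<close>
  assumes measurable_at: "\<And>t. 0 \<le> t \<Longrightarrow> random_variable borel (B t)"
    and start: "\<And>\<omega>. \<omega> \<in> space M \<Longrightarrow> B 0 \<omega> = 0"
    and continuous_paths: "\<And>\<omega>. \<omega> \<in> space M \<Longrightarrow> continuous_on {0..} (\<lambda>t. B t \<omega>)"
    and normal_increments: "\<And>s t. 0 \<le> s \<Longrightarrow> s < t \<Longrightarrow>
      distributed M lborel (\<lambda>\<omega>. B t \<omega> - B s \<omega>) (normal_density 0 (sqrt (t - s)))"
    and independent_increments: "\<And>(n::nat) \<tau>. 0 \<le> \<tau> 0 \<Longrightarrow> mono_on {..n} \<tau> \<Longrightarrow>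
      indep_vars (\<lambda>_. borel) (\<lambda>i \<omega>. B (\<tau> (Suc i)) \<omega> - B (\<tau> i) \<omega>) {..<n}"

text \<open>
  Independence of the two coordinates is independence of the whole processes, i.e. of the two
  path-valued random variables in the product space of \<open>borel\<close> over the times \<open>{0..}\<close>.
\<close>

locale planar_brownian_motion = prob_space M for M :: "'a measure" +
  fixes W :: "real \<Rightarrow> 'a \<Rightarrow> real ^ 2"
  assumes coordinates: "\<And>i. standard_brownian_motion M (\<lambda>t \<omega>. W t \<omega> $ i)"
    and independent_coordinates:
      "indep_var (PiM {0..} (\<lambda>_. borel)) (\<lambda>\<omega>. \<lambda>t\<in>{0..}. W t \<omega> $ 1)
                 (PiM {0..} (\<lambda>_. borel)) (\<lambda>\<omega>. \<lambda>t\<in>{0..}. W t \<omega> $ 2)"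

text \<open>\<open>LEAST\<close> on the reals is unspecified if there is no least element; for bounded sets there is
  one, by the lemma \<open>ex_smallest_cball\<close>.\<close>

definition circumradius :: "'a::metric_space set \<Rightarrow> real" where
  "circumradius S = (LEAST r. 0 \<le> r \<and> (\<exists>c. S \<subseteq> cball c r))"

lemma ex_smallest_cball:
  fixes S :: "'a::heine_borel set"
  assumes "bounded S"
  shows "\<exists>r. (0 \<le> r \<and> (\<exists>c. S \<subseteq> cball c r)) \<and>
             (\<forall>r'. 0 \<le> r' \<and> (\<exists>c. S \<subseteq> cball c r') \<longrightarrow> r \<le> r')"
proof (cases "S = {}")
  case True
  then show ?thesis by (intro exI[of _ 0]) auto
next
  case False
  then obtain x0 where x0: "x0 \<in> S" by auto
  define A where "A = {r. 0 \<le> r \<and> (\<exists>c. S \<subseteq> cball c r)}"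
  obtain c0 r0 where "S \<subseteq> cball c0 r0"
    using assms bounded_subset_cball by blast
  moreover from this x0 have "0 \<le> r0"
    by (metis mem_cball order_trans subsetD zero_le_dist)
  ultimately have ne: "A \<noteq> {}" unfolding A_def by auto
  have bdd: "bdd_below A" unfolding A_def by (rule bdd_belowI[of _ 0]) auto
  define r where "r = Inf A"
  have r0: "0 \<le> r" unfolding r_def by (rule cInf_greatest[OF ne]) (auto simp: A_def)
  have "\<exists>c. S \<subseteq> cball c (r + inverse (real (Suc n)))" for n
  proof -
    have "Inf A < r + inverse (real (Suc n))" unfolding r_def by simp
    then obtain a where "a \<in> A" "a < r + inverse (real (Suc n))"
      using cInf_lessD[OF ne] by blast
    moreover from this obtain c where "S \<subseteq> cball c a" unfolding A_def by blast
    ultimately show ?thesis by (meson less_imp_le order_trans subset_cball)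
  qed
  then obtain c where c: "\<And>n. S \<subseteq> cball (c n) (r + inverse (real (Suc n)))" by metis
  have "bounded (range c)"
  proof (rule bounded_subset[OF bounded_cball])
    show "range c \<subseteq> cball x0 (r + 1)"
    proof clarify
      fix n
      have "dist (c n) x0 \<le> r + inverse (real (Suc n))" using c[of n] x0 by auto
      also have "\<dots> \<le> r + 1" by (simp add: inverse_le_1_iff)
      finally show "c n \<in> cball x0 (r + 1)" by (simp add: dist_commute)
    qed
  qed
  then obtain l \<phi> where \<phi>: "strict_mono \<phi>" and l: "(c \<circ> \<phi>) \<longlonglongrightarrow> l"
    using bounded_imp_convergent_subsequence by blast
  have "S \<subseteq> cball l r"
  proof
    fix x assume x: "x \<in> S"
    have 1: "(\<lambda>n. dist ((c \<circ> \<phi>) n) x) \<longlonglongrightarrow> dist l x"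
      by (intro tendsto_intros l)
    have "(\<lambda>n. r + inverse (real (Suc n))) \<longlonglongrightarrow> r + 0"
      by (intro tendsto_intros LIMSEQ_inverse_real_of_nat)
    from LIMSEQ_subseq_LIMSEQ[OF this \<phi>]
    have 2: "(\<lambda>n. r + inverse (real (Suc (\<phi> n)))) \<longlonglongrightarrow> r" by (simp add: o_def)
    have "dist l x \<le> r"
    proof (rule LIMSEQ_le[OF 1 2])
      have "dist ((c \<circ> \<phi>) n) x \<le> r + inverse (real (Suc (\<phi> n)))" for n
        using subsetD[OF c x] by (simp del: of_nat_Suc)
      then show "\<exists>N. \<forall>n\<ge>N. dist ((c \<circ> \<phi>) n) x \<le> r + inverse (real (Suc (\<phi> n)))"
        by blast
    qed
    then show "x \<in> cball l r" by simp
  qed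
  moreover have "r \<le> r'" if "0 \<le> r'" "\<exists>c. S \<subseteq> cball c r'" for r'
    unfolding r_def by (rule cInf_lower[OF _ bdd]) (use that in \<open>auto simp: A_def\<close>)
  ultimately show ?thesis using r0 by blast
qed

lemma
  fixes S :: "'a::heine_borel set"
  assumes "bounded S"
  shows circumradius_nonneg: "0 \<le> circumradius S"
    and circumradius_cball: "\<exists>c. S \<subseteq> cball c (circumradius S)"
    and circumradius_le: "\<And>c r. 0 \<le> r \<Longrightarrow> S \<subseteq> cball c r \<Longrightarrow> circumradius S \<le> r"
proof -
  obtain r where r: "0 \<le> r \<and> (\<exists>c. S \<subseteq> cball c r)"
      "\<And>r'. 0 \<le> r' \<and> (\<exists>c. S \<subseteq> cball c r') \<Longrightarrow> r \<le> r'"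
    using ex_smallest_cball[OF assms] by blast
  have "circumradius S = r"
    unfolding circumradius_def by (rule Least_equality) (use r in auto)
  then show "0 \<le> circumradius S" "\<exists>c. S \<subseteq> cball c (circumradius S)"
    "\<And>c r. 0 \<le> r \<Longrightarrow> S \<subseteq> cball c r \<Longrightarrow> circumradius S \<le> r"
    using r by auto
qed

end

theory Submission
  imports Defs
begin

text \<open>
  Upper bound: the hull lies in its bounding box, so \<open>R \<le> \<surd>(r\<^sub>1\<^sup>2 + r\<^sub>2\<^sup>2) / 2\<close> with \<open>r\<^sub>i\<close> the range of the
  \<open>i\<close>-th coordinate, and it suffices that \<open>E r\<^sub>i\<^sup>2 \<le> 4 ln 2\<close>. Here \<open>E[max \<cdot> (-min)]\<close> is the integral over
  \<open>a, b > 0\<close> of the probability that both \<open>a\<close> and \<open>-b\<close> are hit. By inclusion-exclusion this is an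
  alternating series in the probabilities of hitting \<open>n\<close> times alternately \<open>a\<close> and \<open>-b\<close>, and unfolding
  the path by successive reflections turns this event into hitting \<open>n a + (n-1) b\<close>. Integrating gives
  \<open>\<Sum>\<^sub>n\<^sub>\<ge>\<^sub>2 (-1)\<^sup>n / (n (n-1)) = 2 ln 2 - 1\<close>.

  Lower bound: \<open>2 R\<close> is at least the range in any direction. Among the four axes at angles that are
  multiples of \<open>45\<close> degrees choose the one closest to \<open>W(1)\<close>; by rotation invariance each of them
  contributes the same expectation, which the reflection principle expresses through the Gaussian
  vector \<open>W(1)\<close> alone.

  All reflections are carried out on the random walk of the increments over a grid of mesh \<open>1/N\<close>;
  the overshoots are controlled by the largest step, whose mean tends to \<open>0\<close>.
\<close>

section \<open>Gaussian integrals\<close>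

text \<open>Why 4 ln 2: the squares of max and of -min have mean at most 1 and the cross term at
  most 2 ln 2 - 1, so the squared range has mean at most 1 + 1 + 2 (2 ln 2 - 1). Hence E R^2 <= 2 ln
  2, and E R <= sqrt (E R^2). Origin of 0.928: let u be the component of W(1) along an axis and v
  the one across it. The axis is the closest of the four iff |v| < t |u| with t = tan (pi/8). On
  this event, reflection at all levels bounds the range from below, in mean for fixed v, by 2 |u| -
  |v| / t. Integrated and summed over the four axes this gives E R >= 0.92809... Form of the
  estimates: overshoot turns each reflection into two one-sided inequalities with an error that
  grows with the number of reflections. The alternating series is therefore cut at K, the mesh is
  refined for fixed K, and K grows last. As \<open>ennreal\<close> has no useful subtraction,
  negative terms stand on the left-hand side until all integrals are known to be finite. The grid
  serves the lower bound directly, since grid points lie on the path; the upper bound needs path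
  continuity and Fatou's lemma.\<close>

lemma nn_integral_std_normal_abs_tail:
  assumes "0 \<le> s"
  shows "(\<integral>\<^sup>+u. ennreal (\<bar>u\<bar> * of_bool (s < \<bar>u\<bar>)) \<partial>density lborel std_normal_density) = ennreal (2 * std_normal_density s)"
proof -
  have pos: "(\<integral>\<^sup>+u. ennreal (u * std_normal_density u) * indicator {s..} u \<partial>lborel) = ennreal (0 - (- std_normal_density s))"
  proof (rule nn_integral_FTC_atLeast)
    show "((\<lambda>u. - std_normal_density u) has_real_derivative u * std_normal_density u) (at u)" for u
      unfolding std_normal_density_def
      by (auto intro!: derivative_eq_intros simp: field_simps)
    show "0 \<le> u * std_normal_density u" if "s \<le> u" for u
      using that assms by (simp add: std_normal_density_def)
    show "((\<lambda>u. - std_normal_density u) \<longlongrightarrow> 0) at_top"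
    proof -
      have "filterlim (\<lambda>u::real. 1 / 2 * u\<^sup>2) at_top at_top"
        by (rule filterlim_tendsto_pos_mult_at_top[OF tendsto_const _ filterlim_pow_at_top[OF _ filterlim_ident]]) auto
      then have "filterlim (\<lambda>u::real. - (u\<^sup>2 / 2)) at_bot at_top"
        unfolding filterlim_uminus_at_top by simp
      then have "((\<lambda>u::real. exp (- (u\<^sup>2 / 2))) \<longlongrightarrow> 0) at_top"
        by (rule filterlim_compose[OF exp_at_bot])
      then have "((\<lambda>u::real. - (1 / sqrt (2 * pi) * exp (- (u\<^sup>2 / 2)))) \<longlongrightarrow> - (1 / sqrt (2 * pi) * 0)) at_top"
        by (intro tendsto_intros)
      then show ?thesis by (simp add: std_normal_density_def)
    qed
  qed measurable
  have neg: "(\<integral>\<^sup>+u. ennreal (- u * std_normal_density u) * indicator {..-s} u \<partial>lborel)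
     = (\<integral>\<^sup>+u. ennreal (u * std_normal_density u) * indicator {s..} u \<partial>lborel)"
    by (subst nn_integral_real_affine[where c = "-1" and t = 0])
      (auto intro!: nn_integral_cong simp: std_normal_density_def indicator_def)
  have "(\<integral>\<^sup>+u. ennreal (\<bar>u\<bar> * of_bool (s < \<bar>u\<bar>)) \<partial>density lborel std_normal_density)
     = (\<integral>\<^sup>+u. ennreal (std_normal_density u) * ennreal (\<bar>u\<bar> * of_bool (s < \<bar>u\<bar>)) \<partial>lborel)"
    by (subst nn_integral_density) auto
  also have "\<dots> = (\<integral>\<^sup>+u. ennreal (u * std_normal_density u) * indicator {s..} u
      + ennreal (- u * std_normal_density u) * indicator {..-s} u \<partial>lborel)"
  proof (rule nn_integral_cong_AE)
    have "AE u in lborel. u \<noteq> s" "AE u in lborel. u \<noteq> -s" by (rule AE_lborel_singleton)+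
    then show "AE u in lborel. ennreal (std_normal_density u) * ennreal (\<bar>u\<bar> * of_bool (s < \<bar>u\<bar>))
      = ennreal (u * std_normal_density u) * indicator {s..} u + ennreal (- u * std_normal_density u) * indicator {..-s} u"
    proof eventually_elim
      case (elim u)
      then consider "s < u" | "u < - s" | "\<bar>u\<bar> < s" by linarith
      then show ?case using assms
        by cases (auto simp: indicator_def mult.commute simp flip: ennreal_mult)
    qed
  qed
  also have "\<dots> = ennreal (std_normal_density s) + ennreal (std_normal_density s)"
    by (subst nn_integral_add) (use neg pos in auto)
  finally show ?thesis by (simp flip: ennreal_plus)
qed

text \<open>With t = tan theta the value is sqrt (2 / pi) sin theta. Integrating over u first leaves
  a product of two Gaussians in v, which is a constant times the normal density of deviation sin
  theta.\<close>

lemma nn_integral_std_normal_sector: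
  assumes "0 < t"
  shows "(\<integral>\<^sup>+v. \<integral>\<^sup>+u. ennreal (\<bar>u\<bar> * of_bool (\<bar>v\<bar> / t < \<bar>u\<bar>)) \<partial>density lborel std_normal_density \<partial>density lborel std_normal_density)
    = ennreal (sqrt (2 / pi) * (t / sqrt (1 + t\<^sup>2)))"
proof -
  define \<sigma> where "\<sigma> = t / sqrt (1 + t\<^sup>2)"
  have t1: "0 < 1 + t\<^sup>2" by (simp add: add_pos_nonneg)
  have \<sigma>: "0 < \<sigma>" using assms t1 by (simp add: \<sigma>_def)
  have \<sigma>2: "1 / \<sigma>\<^sup>2 = 1 + 1 / t\<^sup>2" using assms t1 by (simp add: \<sigma>_def power_divide field_simps)
  have eq: "std_normal_density v * (2 * std_normal_density (\<bar>v\<bar> / t)) = sqrt (2 / pi) * \<sigma> * normal_density 0 \<sigma> v" for v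
  proof -
    have "- v\<^sup>2 / 2 + - (\<bar>v\<bar> / t)\<^sup>2 / 2 = - (v\<^sup>2 * (1 / \<sigma>\<^sup>2)) / 2"
      unfolding \<sigma>2 by (simp add: power_divide field_simps)
    then have "exp (- v\<^sup>2 / 2) * exp (- (\<bar>v\<bar> / t)\<^sup>2 / 2) = exp (- (v - 0)\<^sup>2 / (2 * \<sigma>\<^sup>2))"
      by (simp flip: exp_add add: field_simps)
    moreover have "1 / sqrt (2 * pi) * (2 * (1 / sqrt (2 * pi))) = sqrt (2 / pi) * \<sigma> * (1 / sqrt (2 * pi * \<sigma>\<^sup>2))"
      using \<sigma> by (simp add: real_sqrt_mult real_sqrt_divide field_simps)
    ultimately have "(1 / sqrt (2 * pi) * (2 * (1 / sqrt (2 * pi)))) * (exp (- v\<^sup>2 / 2) * exp (- (\<bar>v\<bar> / t)\<^sup>2 / 2))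
        = (sqrt (2 / pi) * \<sigma> * (1 / sqrt (2 * pi * \<sigma>\<^sup>2))) * exp (- (v - 0)\<^sup>2 / (2 * \<sigma>\<^sup>2))"
      by (simp only:)
    moreover have "std_normal_density v * (2 * std_normal_density (\<bar>v\<bar> / t)) =
       (1 / sqrt (2 * pi) * (2 * (1 / sqrt (2 * pi)))) * (exp (- v\<^sup>2 / 2) * exp (- (\<bar>v\<bar> / t)\<^sup>2 / 2))"
      by (simp only: std_normal_density_def ac_simps)
    moreover have "sqrt (2 / pi) * \<sigma> * normal_density 0 \<sigma> v =
       (sqrt (2 / pi) * \<sigma> * (1 / sqrt (2 * pi * \<sigma>\<^sup>2))) * exp (- (v - 0)\<^sup>2 / (2 * \<sigma>\<^sup>2))"
      by (simp only: normal_density_def ac_simps)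
    ultimately show ?thesis by (simp only:)
  qed
  have "(\<integral>\<^sup>+v. \<integral>\<^sup>+u. ennreal (\<bar>u\<bar> * of_bool (\<bar>v\<bar> / t < \<bar>u\<bar>)) \<partial>density lborel std_normal_density \<partial>density lborel std_normal_density)
     = (\<integral>\<^sup>+v. ennreal (2 * std_normal_density (\<bar>v\<bar> / t)) \<partial>density lborel std_normal_density)"
    using assms by (intro nn_integral_cong nn_integral_std_normal_abs_tail) auto
  also have "\<dots> = (\<integral>\<^sup>+v. ennreal (std_normal_density v) * ennreal (2 * std_normal_density (\<bar>v\<bar> / t)) \<partial>lborel)"
    by (subst nn_integral_density) auto
  also have "\<dots> = (\<integral>\<^sup>+v. ennreal (sqrt (2 / pi) * \<sigma>) * ennreal (normal_density 0 \<sigma> v) \<partial>lborel)"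
    using \<sigma> by (intro nn_integral_cong) (simp flip: ennreal_mult add: eq)
  also have "\<dots> = ennreal (sqrt (2 / pi) * \<sigma>) * (\<integral>\<^sup>+v. ennreal (normal_density 0 \<sigma> v) \<partial>lborel)"
    by (intro nn_integral_cmult) measurable
  also have "(\<integral>\<^sup>+v. ennreal (normal_density 0 \<sigma> v) \<partial>lborel) = 1"
    using prob_space.emeasure_space_1[OF prob_space_normal_density[OF \<sigma>, of 0]]
    by (simp add: emeasure_density)
  finally show ?thesis by (simp add: \<sigma>_def)
qed

lemma sigma_finite_normal: "0 < \<sigma> \<Longrightarrow> sigma_finite_measure (density lborel (\<lambda>x. ennreal (normal_density 0 \<sigma> x)))"
  using prob_space_normal_density prob_space_imp_sigma_finite by blast

text \<open>The map is the reflection in the line at angle pi/8; it takes the coordinate axes to the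
  diagonals and keeps the norm, hence the density. Two one-dimensional substitutions, for x with y
  fixed and then for y with u fixed, replace a planar change of variables; their factors sqrt 2 and
  1 / sqrt 2 cancel.\<close>

lemma nn_integral_normal_rotate45:
  fixes f :: "real \<times> real \<Rightarrow> ennreal" and \<sigma> :: real
  defines "G \<equiv> density lborel (\<lambda>x. ennreal (normal_density 0 \<sigma> x))"
  assumes "0 < \<sigma>" and [measurable]: "f \<in> borel_measurable (borel \<Otimes>\<^sub>M borel)"
  shows "(\<integral>\<^sup>+z. f ((fst z + snd z) / sqrt 2, (fst z - snd z) / sqrt 2) \<partial>(G \<Otimes>\<^sub>M G)) = (\<integral>\<^sup>+z. f z \<partial>(G \<Otimes>\<^sub>M G))"
proof -
  interpret G: sigma_finite_measure G
    unfolding G_def by (rule sigma_finite_normal) fact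
  interpret GG: pair_sigma_finite G G ..
  define p where "p = (\<lambda>x. ennreal (normal_density 0 \<sigma> x))"
  have [measurable]: "p \<in> borel_measurable borel" unfolding p_def by measurable
  have sets_G[measurable_cong]: "sets G = sets borel" by (simp add: G_def)
  have GG: "(\<integral>\<^sup>+z. h z \<partial>(G \<Otimes>\<^sub>M G)) = (\<integral>\<^sup>+y. \<integral>\<^sup>+x. p x * p y * h (x, y) \<partial>lborel \<partial>lborel)"
    if [measurable]: "h \<in> borel_measurable (borel \<Otimes>\<^sub>M borel)" for h
  proof -
    have "(\<integral>\<^sup>+z. h z \<partial>(G \<Otimes>\<^sub>M G)) = (\<integral>\<^sup>+y. \<integral>\<^sup>+x. h (x, y) \<partial>G \<partial>G)"
      by (intro GG.nn_integral_snd[symmetric]) measurable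
    also have "\<dots> = (\<integral>\<^sup>+y. p y * \<integral>\<^sup>+x. p x * h (x, y) \<partial>lborel \<partial>lborel)"
      unfolding G_def p_def[symmetric] by (simp add: nn_integral_density)
    also have "\<dots> = (\<integral>\<^sup>+y. \<integral>\<^sup>+x. p x * p y * h (x, y) \<partial>lborel \<partial>lborel)"
      by (subst nn_integral_cmult[symmetric]) (auto simp: ac_simps)
    finally show ?thesis .
  qed
  have pp: "p ((u + v) / sqrt 2) * p ((u - v) / sqrt 2) = p u * p v" for u v
  proof -
    have "((u + v) / sqrt 2)\<^sup>2 + ((u - v) / sqrt 2)\<^sup>2 = u\<^sup>2 + v\<^sup>2"
      by (simp add: power_divide power2_sum power2_diff field_simps)
    then have "- ((u + v) / sqrt 2)\<^sup>2 / (2 * \<sigma>\<^sup>2) + - ((u - v) / sqrt 2)\<^sup>2 / (2 * \<sigma>\<^sup>2) = - u\<^sup>2 / (2 * \<sigma>\<^sup>2) + - v\<^sup>2 / (2 * \<sigma>\<^sup>2)"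
      unfolding add_divide_distrib[symmetric] by (simp only: minus_add_distrib[symmetric])
    then have "exp (- ((u + v) / sqrt 2)\<^sup>2 / (2 * \<sigma>\<^sup>2)) * exp (- ((u - v) / sqrt 2)\<^sup>2 / (2 * \<sigma>\<^sup>2)) = exp (- u\<^sup>2 / (2 * \<sigma>\<^sup>2)) * exp (- v\<^sup>2 / (2 * \<sigma>\<^sup>2))"
      by (simp only: exp_add[symmetric])
    then have "normal_density 0 \<sigma> ((u + v) / sqrt 2) * normal_density 0 \<sigma> ((u - v) / sqrt 2) = normal_density 0 \<sigma> u * normal_density 0 \<sigma> v"
      unfolding normal_density_def diff_zero by (simp only: mult.assoc mult.left_commute)
    then show ?thesis unfolding p_def by (simp flip: ennreal_mult)
  qed
  have s2: "sqrt 2 * sqrt 2 = (2::real)" by simp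
  have "(\<integral>\<^sup>+z. f ((fst z + snd z) / sqrt 2, (fst z - snd z) / sqrt 2) \<partial>(G \<Otimes>\<^sub>M G))
    = (\<integral>\<^sup>+y. \<integral>\<^sup>+x. p x * p y * f ((x + y) / sqrt 2, (x - y) / sqrt 2) \<partial>lborel \<partial>lborel)"
    by (subst GG) auto
  also have "\<dots> = (\<integral>\<^sup>+y. ennreal (sqrt 2) * (\<integral>\<^sup>+u. p (- y + sqrt 2 * u) * p y * f (u, u - sqrt 2 * y) \<partial>lborel) \<partial>lborel)"
  proof (rule nn_integral_cong)
    fix y :: real
    have "(- y + sqrt 2 * u + y) / sqrt 2 = u" "(- y + sqrt 2 * u - y) / sqrt 2 = u - sqrt 2 * y" for u
      using s2 by (auto simp: field_simps)
    then show "(\<integral>\<^sup>+x. p x * p y * f ((x + y) / sqrt 2, (x - y) / sqrt 2) \<partial>lborel)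
      = ennreal (sqrt 2) * (\<integral>\<^sup>+u. p (- y + sqrt 2 * u) * p y * f (u, u - sqrt 2 * y) \<partial>lborel)"
      by (subst nn_integral_real_affine[where c = "sqrt 2" and t = "- y"]) auto
  qed
  also have "\<dots> = ennreal (sqrt 2) * (\<integral>\<^sup>+y. \<integral>\<^sup>+u. p (- y + sqrt 2 * u) * p y * f (u, u - sqrt 2 * y) \<partial>lborel \<partial>lborel)"
    by (intro nn_integral_cmult) measurable
  also have "\<dots> = ennreal (sqrt 2) * (\<integral>\<^sup>+u. \<integral>\<^sup>+y. p (- y + sqrt 2 * u) * p y * f (u, u - sqrt 2 * y) \<partial>lborel \<partial>lborel)"
    by (intro arg_cong2[where f = "(*)"] refl lborel_pair.Fubini') measurable
  also have "\<dots> = ennreal (sqrt 2) * (\<integral>\<^sup>+u. ennreal (1 / sqrt 2) * (\<integral>\<^sup>+v. p u * p v * f (u, v) \<partial>lborel) \<partial>lborel)"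
  proof (intro arg_cong2[where f = "(*)"] refl nn_integral_cong)
    fix u :: real
    have a: "u / sqrt 2 + (- 1 / sqrt 2) * v = (u - v) / sqrt 2"
      "- ((u - v) / sqrt 2) + sqrt 2 * u = (u + v) / sqrt 2"
      "u - sqrt 2 * ((u - v) / sqrt 2) = v" for v
      using s2 by (auto simp: field_simps)
    show "(\<integral>\<^sup>+y. p (- y + sqrt 2 * u) * p y * f (u, u - sqrt 2 * y) \<partial>lborel) = ennreal (1 / sqrt 2) * (\<integral>\<^sup>+v. p u * p v * f (u, v) \<partial>lborel)"
      by (subst nn_integral_real_affine[where c = "- 1 / sqrt 2" and t = "u / sqrt 2"])
        (auto simp only: a pp, auto)
  qed
  also have "\<dots> = ennreal (sqrt 2) * (ennreal (1 / sqrt 2) * (\<integral>\<^sup>+u. (\<integral>\<^sup>+v. p u * p v * f (u, v) \<partial>lborel) \<partial>lborel))"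
    by (subst nn_integral_cmult) auto
  also have "\<dots> = (\<integral>\<^sup>+u. \<integral>\<^sup>+v. p u * p v * f (u, v) \<partial>lborel \<partial>lborel)"
    by (simp add: mult.assoc[symmetric] flip: ennreal_mult)
  also have "\<dots> = (\<integral>\<^sup>+v. \<integral>\<^sup>+u. p u * p v * f (u, v) \<partial>lborel \<partial>lborel)"
    by (intro lborel_pair.Fubini') measurable
  also have "\<dots> = (\<integral>\<^sup>+z. f z \<partial>(G \<Otimes>\<^sub>M G))"
    by (subst GG) auto
  finally show ?thesis .
qed

text \<open>\<open>zip \<rho>\<close> turns a pair of step sequences into a sequence of pairs. On
  boxes its law is the same product measure for every invariant \<open>\<rho>\<close>, so the given
  map can be compared with the identity. This carries symmetries of a single planar step over to the
  whole walk.\<close>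

lemma nn_integral_PiM_pair_map:
  fixes A :: "real measure" and \<rho> :: "real \<times> real \<Rightarrow> real \<times> real" and N :: nat
    and F :: "(nat \<Rightarrow> real) \<Rightarrow> (nat \<Rightarrow> real) \<Rightarrow> ennreal"
  defines "P \<equiv> PiM {..<N} (\<lambda>_. A)"
  assumes "prob_space A"
    and \<rho>: "\<rho> \<in> A \<Otimes>\<^sub>M A \<rightarrow>\<^sub>M A \<Otimes>\<^sub>M A"
      "\<And>f. f \<in> borel_measurable (A \<Otimes>\<^sub>M A) \<Longrightarrow> (\<integral>\<^sup>+z. f (\<rho> z) \<partial>(A \<Otimes>\<^sub>M A)) = (\<integral>\<^sup>+z. f z \<partial>(A \<Otimes>\<^sub>M A))"
    and F: "(\<lambda>z. F (fst z) (snd z)) \<in> borel_measurable (P \<Otimes>\<^sub>M P)"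
  shows "(\<integral>\<^sup>+z. F (\<lambda>j\<in>{..<N}. fst (\<rho> (fst z j, snd z j))) (\<lambda>j\<in>{..<N}. snd (\<rho> (fst z j, snd z j))) \<partial>(P \<Otimes>\<^sub>M P))
    = (\<integral>\<^sup>+z. F (fst z) (snd z) \<partial>(P \<Otimes>\<^sub>M P))"
proof -
  interpret A: prob_space A by fact
  interpret AA: pair_prob_space A A ..
  interpret PA: product_prob_space "\<lambda>_::nat. A" ..
  interpret PAA: product_prob_space "\<lambda>_::nat. A \<Otimes>\<^sub>M A" ..
  interpret P: prob_space P unfolding P_def by (intro prob_space_PiM A.prob_space_axioms)
  interpret PP: pair_prob_space P P ..
  define Q where "Q = PiM {..<N} (\<lambda>_. A \<Otimes>\<^sub>M A)"
  define zip where "zip = (\<lambda>(\<rho> :: real \<times> real \<Rightarrow> real \<times> real) (z :: (nat \<Rightarrow> real) \<times> (nat \<Rightarrow> real)). \<lambda>j\<in>{..<N}. \<rho> (fst z j, snd z j))"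
  have comp[measurable]: "(\<lambda>x. x j) \<in> P \<rightarrow>\<^sub>M A" if "j \<in> {..<N}" for j
    unfolding P_def using that by (rule measurable_component_singleton)
  have zip_meas: "zip \<rho> \<in> P \<Otimes>\<^sub>M P \<rightarrow>\<^sub>M Q" if [measurable]: "\<rho> \<in> A \<Otimes>\<^sub>M A \<rightarrow>\<^sub>M A \<Otimes>\<^sub>M A" for \<rho>
    unfolding zip_def Q_def by measurable
  have zip_distr: "distr (P \<Otimes>\<^sub>M P) Q (zip \<rho>) = Q"
    if \<rho>[measurable]: "\<rho> \<in> A \<Otimes>\<^sub>M A \<rightarrow>\<^sub>M A \<Otimes>\<^sub>M A"
      and inv: "\<And>f. f \<in> borel_measurable (A \<Otimes>\<^sub>M A) \<Longrightarrow> (\<integral>\<^sup>+z. f (\<rho> z) \<partial>(A \<Otimes>\<^sub>M A)) = (\<integral>\<^sup>+z. f z \<partial>(A \<Otimes>\<^sub>M A))"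
    for \<rho>
    unfolding Q_def
  proof (rule PAA.PiM_eqI)
    fix E :: "nat \<Rightarrow> (real \<times> real) set" assume E[measurable]: "\<And>j. j \<in> {..<N} \<Longrightarrow> E j \<in> sets (A \<Otimes>\<^sub>M A)"
    have PiE: "Pi\<^sub>E {..<N} E \<in> sets Q" unfolding Q_def using E by (intro sets_PiM_I_finite) auto
    have "emeasure (distr (P \<Otimes>\<^sub>M P) Q (zip \<rho>)) (Pi\<^sub>E {..<N} E) = (\<integral>\<^sup>+w. indicator (Pi\<^sub>E {..<N} E) w \<partial>distr (P \<Otimes>\<^sub>M P) Q (zip \<rho>))"
      using PiE by simp
    also have "\<dots> = (\<integral>\<^sup>+z. indicator (Pi\<^sub>E {..<N} E) (zip \<rho> z) \<partial>(P \<Otimes>\<^sub>M P))"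
      using PiE by (intro nn_integral_distr zip_meas \<rho>) auto
    also have "\<dots> = (\<integral>\<^sup>+z. (\<Prod>j<N. indicator (E j) (\<rho> (fst z j, snd z j))) \<partial>(P \<Otimes>\<^sub>M P))"
    proof (rule nn_integral_cong)
      fix z
      have "zip \<rho> z \<in> Pi\<^sub>E {..<N} E \<longleftrightarrow> (\<forall>j<N. \<rho> (fst z j, snd z j) \<in> E j)"
        by (auto simp: zip_def PiE_def Pi_def)
      then show "indicator (Pi\<^sub>E {..<N} E) (zip \<rho> z) = (\<Prod>j<N. indicator (E j) (\<rho> (fst z j, snd z j)) :: ennreal)"
        by (cases "zip \<rho> z \<in> Pi\<^sub>E {..<N} E") (auto simp: indicator_def intro!: prod_zero[symmetric])
    qed
    also have "\<dots> = (\<integral>\<^sup>+x. \<integral>\<^sup>+y. (\<Prod>j<N. indicator (E j) (\<rho> (x j, y j))) \<partial>P \<partial>P)"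
      using P.nn_integral_fst[of "\<lambda>z. \<Prod>j<N. indicator (E j) (\<rho> (fst z j, snd z j))" P, symmetric]
      by simp
    also have "\<dots> = (\<integral>\<^sup>+x. (\<Prod>j<N. \<integral>\<^sup>+y. indicator (E j) (\<rho> (x j, y)) \<partial>A) \<partial>P)"
    proof (rule nn_integral_cong)
      fix x assume "x \<in> space P"
      then have x: "x j \<in> space A" if "j < N" for j using that by (auto simp: P_def space_PiM)
      show "(\<integral>\<^sup>+y. (\<Prod>j<N. indicator (E j) (\<rho> (x j, y j))) \<partial>P) = (\<Prod>j<N. \<integral>\<^sup>+y. indicator (E j) (\<rho> (x j, y)) \<partial>A)"
        unfolding P_def
      proof (rule PA.product_nn_integral_prod[where f = "\<lambda>j y. indicator (E j) (\<rho> (x j, y))"])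
        fix j assume j: "j \<in> {..<N}"
        have "(\<lambda>y. \<rho> (x j, y)) \<in> A \<rightarrow>\<^sub>M A \<Otimes>\<^sub>M A"
          using x j by (intro measurable_compose[OF measurable_Pair1' \<rho>]) auto
        from measurable_compose[OF this borel_measurable_indicator[OF E[OF j]]]
        show "(\<lambda>y. indicator (E j) (\<rho> (x j, y)) :: ennreal) \<in> borel_measurable A" .
      qed simp
    qed
    also have "\<dots> = (\<Prod>j<N. \<integral>\<^sup>+x. \<integral>\<^sup>+y. indicator (E j) (\<rho> (x, y)) \<partial>A \<partial>A)"
      unfolding P_def
      by (rule PA.product_nn_integral_prod[where f = "\<lambda>j x. \<integral>\<^sup>+y. indicator (E j) (\<rho> (x, y)) \<partial>A"]) auto
    also have "\<dots> = (\<Prod>j<N. emeasure (A \<Otimes>\<^sub>M A) (E j))"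
    proof (rule prod.cong[OF refl])
      fix j assume [measurable]: "j \<in> {..<N}"
      have "(\<integral>\<^sup>+x. \<integral>\<^sup>+y. indicator (E j) (\<rho> (x, y)) \<partial>A \<partial>A) = (\<integral>\<^sup>+z. indicator (E j) (\<rho> z) \<partial>(A \<Otimes>\<^sub>M A))"
        using A.nn_integral_fst[of "\<lambda>z. indicator (E j) (\<rho> z)" A, symmetric] by simp
      also have "\<dots> = (\<integral>\<^sup>+z. indicator (E j) z \<partial>(A \<Otimes>\<^sub>M A))" by (rule inv) measurable
      finally show "(\<integral>\<^sup>+x. \<integral>\<^sup>+y. indicator (E j) (\<rho> (x, y)) \<partial>A \<partial>A) = emeasure (A \<Otimes>\<^sub>M A) (E j)"
        using E by simp
    qed
    finally show "emeasure (distr (P \<Otimes>\<^sub>M P) (PiM {..<N} (\<lambda>_. A \<Otimes>\<^sub>M A)) (zip \<rho>)) (Pi\<^sub>E {..<N} E) = (\<Prod>j<N. emeasure (A \<Otimes>\<^sub>M A) (E j))"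
      unfolding Q_def .
  qed simp_all
  define H where "H = (\<lambda>w. F (\<lambda>j\<in>{..<N}. fst (w j)) (\<lambda>j\<in>{..<N}. snd (w j)))"
  have zip_fst: "(\<lambda>j\<in>{..<N}. fst (zip \<rho> z j)) = (\<lambda>j\<in>{..<N}. fst (\<rho> (fst z j, snd z j)))"
    and zip_snd: "(\<lambda>j\<in>{..<N}. snd (zip \<rho> z j)) = (\<lambda>j\<in>{..<N}. snd (\<rho> (fst z j, snd z j)))" for \<rho> z
    unfolding zip_def by (auto intro!: restrict_ext)
  have compQ[measurable]: "(\<lambda>x. x j) \<in> Q \<rightarrow>\<^sub>M A \<Otimes>\<^sub>M A" if "j \<in> {..<N}" for j
    unfolding Q_def using that by (rule measurable_component_singleton)
  have "(\<lambda>w. (\<lambda>j\<in>{..<N}. fst (w j), \<lambda>j\<in>{..<N}. snd (w j))) \<in> Q \<rightarrow>\<^sub>M P \<Otimes>\<^sub>M P"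
    unfolding P_def by measurable
  from measurable_compose[OF this F] have H[measurable]: "H \<in> borel_measurable Q" by (simp add: H_def)
  have zipH: "(\<integral>\<^sup>+z. H (zip \<rho> z) \<partial>(P \<Otimes>\<^sub>M P)) = integral\<^sup>N Q H"
    if "\<rho> \<in> A \<Otimes>\<^sub>M A \<rightarrow>\<^sub>M A \<Otimes>\<^sub>M A"
      and "\<And>f. f \<in> borel_measurable (A \<Otimes>\<^sub>M A) \<Longrightarrow> (\<integral>\<^sup>+z. f (\<rho> z) \<partial>(A \<Otimes>\<^sub>M A)) = (\<integral>\<^sup>+z. f z \<partial>(A \<Otimes>\<^sub>M A))" for \<rho>
    using nn_integral_distr[OF zip_meas[OF that(1)], of H] zip_distr[OF that] H by simp
  have "(\<integral>\<^sup>+z. F (\<lambda>j\<in>{..<N}. fst (\<rho> (fst z j, snd z j))) (\<lambda>j\<in>{..<N}. snd (\<rho> (fst z j, snd z j))) \<partial>(P \<Otimes>\<^sub>M P))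
    = (\<integral>\<^sup>+z. H (zip \<rho> z) \<partial>(P \<Otimes>\<^sub>M P))"
    unfolding H_def zip_fst zip_snd ..
  also have "\<dots> = (\<integral>\<^sup>+z. H (zip (\<lambda>z. z) z) \<partial>(P \<Otimes>\<^sub>M P))"
    using zipH[OF \<rho>] zipH[of "\<lambda>z. z"] by simp
  also have "\<dots> = (\<integral>\<^sup>+z. F (fst z) (snd z) \<partial>(P \<Otimes>\<^sub>M P))"
  proof (rule nn_integral_cong)
    fix z assume "z \<in> space (P \<Otimes>\<^sub>M P)"
    then have "fst z \<in> extensional {..<N}" "snd z \<in> extensional {..<N}"
      by (auto simp: space_pair_measure P_def space_PiM PiE_def)
    then have "(\<lambda>j\<in>{..<N}. fst z j) = fst z" "(\<lambda>j\<in>{..<N}. snd z j) = snd z"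
      by (auto simp: extensional_restrict)
    then show "H (zip (\<lambda>z. z) z) = F (fst z) (snd z)"
      unfolding H_def zip_fst zip_snd prod.collapse by simp
  qed
  finally show ?thesis .
qed

section \<open>Unfolding a walk at alternating level crossings\<close>

definition psum :: "(nat \<Rightarrow> real) \<Rightarrow> nat \<Rightarrow> real" where
  "psum z j = (\<Sum>i<j. z i)"

definition walk_max :: "nat \<Rightarrow> (nat \<Rightarrow> real) \<Rightarrow> real" where
  "walk_max N z = Max (psum z ` {..N})"

text \<open>The l^4 norm of the steps stands in for the largest step: it dominates every step,
  ignores signs, and the mean of its fourth power is a plain sum of moments. For steps of variance
  1/N the l^2 norm would not become small.\<close>

definition step_bound :: "nat \<Rightarrow> (nat \<Rightarrow> real) \<Rightarrow> real" where
  "step_bound N z = sqrt (sqrt (\<Sum>j<N. z j ^ 4))"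

text \<open>The rule \<open>c\<close> consults the original walk, not the flipped one.\<close>

definition flip :: "(nat \<Rightarrow> (nat \<Rightarrow> real) \<Rightarrow> bool) \<Rightarrow> (nat \<Rightarrow> real) \<Rightarrow> nat \<Rightarrow> real" where
  "flip c z j = (if c j z then - z j else z j)"

text \<open>
  Flipping the steps taken while the number of alternating visits of \<open>[x, \<infinity>)\<close> and \<open>(-\<infinity>, x - L]\<close>
  is odd unfolds the walk.
\<close>

fun crossings :: "real \<Rightarrow> real \<Rightarrow> (nat \<Rightarrow> real) \<Rightarrow> nat \<Rightarrow> nat" where
  "crossings x L z 0 = 0"
| "crossings x L z (Suc j) =
    (if (if even (crossings x L z j) then x \<le> psum z (Suc j) else psum z (Suc j) \<le> x - L)
     then Suc (crossings x L z j) else crossings x L z j)"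

lemma psum_0 [simp]: "psum z 0 = 0"
  and psum_Suc: "psum z (Suc j) = psum z j + z j"
  by (simp_all add: psum_def)

lemma psum_uminus: "psum (\<lambda>i. - z i) j = - psum z j"
  by (simp add: psum_def sum_negf)

lemma psum_cong: "(\<And>i. i < j \<Longrightarrow> z i = \<eta> i) \<Longrightarrow> psum z j = psum \<eta> j"
  by (simp add: psum_def)

lemma walk_max_cong: "(\<And>i. i < N \<Longrightarrow> z i = \<eta> i) \<Longrightarrow> walk_max N z = walk_max N \<eta>"
  unfolding walk_max_def by (intro arg_cong[where f=Max] image_cong psum_cong) auto

lemma step_bound_cong: "(\<And>i. i < N \<Longrightarrow> \<bar>z i\<bar> = \<bar>\<eta> i\<bar>) \<Longrightarrow> step_bound N z = step_bound N \<eta>"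
  unfolding step_bound_def
  by (intro arg_cong[where f=sqrt] sum.cong refl) (metis lessThan_iff power_even_abs_numeral even_numeral)

lemma crossings_cong:
  "(\<And>i. i < j \<Longrightarrow> z i = \<eta> i) \<Longrightarrow> crossings x L z j = crossings x L \<eta> j"
proof (induction j)
  case (Suc j)
  then have "crossings x L z j = crossings x L \<eta> j" "psum z (Suc j) = psum \<eta> (Suc j)"
    by (auto intro: psum_cong)
  then show ?case by (simp only: crossings.simps)
qed simp

lemma walk_max_ge: "j \<le> N \<Longrightarrow> psum z j \<le> walk_max N z"
  by (auto simp: walk_max_def)

lemma walk_max_nonneg: "0 \<le> walk_max N z"
  using walk_max_ge[of 0 N z] by simp

lemma le_walk_max_iff: "x \<le> walk_max N z \<longleftrightarrow> (\<exists>j\<le>N. x \<le> psum z j)"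
  by (auto simp: walk_max_def Max_ge_iff)

lemma step_bound_nonneg: "0 \<le> step_bound N z"
  by (simp add: step_bound_def sum_nonneg)

lemma step_bound_ge:
  assumes "j < N" shows "\<bar>z j\<bar> \<le> step_bound N z"
proof -
  have "z j ^ 4 \<le> (\<Sum>j<N. z j ^ 4)"
    using assms by (intro member_le_sum) auto
  then have "sqrt (sqrt (\<bar>z j\<bar> ^ 4)) \<le> step_bound N z"
    unfolding step_bound_def by (simp add: sum_nonneg)
  moreover have "\<bar>z j\<bar> ^ 4 = ((\<bar>z j\<bar>)\<^sup>2)\<^sup>2" by simp
  ultimately show ?thesis by (simp only: real_sqrt_abs abs_power2)
qed

lemma step_bound_flip: "step_bound N (flip c z) = step_bound N z"
  by (rule step_bound_cong) (simp add: flip_def)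

text \<open>
  Without overshoot the unfolded walk would be \<open>f k\<close> of the walk after \<open>k\<close> crossings. Each crossing
  adds an error of at most twice the overshoot, hence of at most two steps.
\<close>

lemma crossings_flip:
  fixes x L :: real and z :: "nat \<Rightarrow> real"
  defines "\<eta> \<equiv> flip (\<lambda>j z. odd (crossings x L z j)) z"
    and "k \<equiv> crossings x L z"
    and "f \<equiv> \<lambda>k s. if even k then s + real k * L else x + (real k - 1) * L + (x - s)"
  assumes "0 < x" "0 < L" "j \<le> N"
  shows "f (k j) (psum z j) \<le> psum \<eta> j"
    and "psum \<eta> j \<le> f (k j) (psum z j) + 2 * real (k j) * step_bound N z"
    and "f (k j) (psum z j) < x + real (k j) * L"
    and "0 < k j \<Longrightarrow> \<exists>i\<le>j. x + (real (k j) - 1) * L \<le> psum \<eta> i"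
proof -
  define d where "d = step_bound N z"
  have d0: "0 \<le> d" by (simp add: d_def step_bound_nonneg)
  have "f (k j) (psum z j) \<le> psum \<eta> j \<and> psum \<eta> j \<le> f (k j) (psum z j) + 2 * real (k j) * d \<and>
     f (k j) (psum z j) < x + real (k j) * L \<and>
     (0 < k j \<longrightarrow> (\<exists>i\<le>j. x + (real (k j) - 1) * L \<le> psum \<eta> i))"
    using \<open>j \<le> N\<close>
  proof (induction j)
    case 0
    then show ?case using \<open>0 < x\<close> by (simp add: f_def k_def)
  next
    case (Suc j)
    let ?s = "psum z j" and ?s' = "psum z (Suc j)"
    have IH: "f (k j) ?s \<le> psum \<eta> j" "psum \<eta> j \<le> f (k j) ?s + 2 * real (k j) * d"
      "f (k j) ?s < x + real (k j) * L"
      "0 < k j \<longrightarrow> (\<exists>i\<le>j. x + (real (k j) - 1) * L \<le> psum \<eta> i)"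
      using Suc by auto
    have dj: "\<bar>z j\<bar> \<le> d" unfolding d_def by (rule step_bound_ge) (use Suc in auto)
    \<comment> \<open>The parity of \<open>k j\<close> decides both the slope of \<open>f\<close>
      and the sign of the flipped step, so between crossings the two sides move in parallel and the
      error stays constant.\<close>
    have f_step: "f (k j) ?s' - psum \<eta> (Suc j) = f (k j) ?s - psum \<eta> j"
      by (simp add: f_def \<eta>_def flip_def k_def psum_Suc)
    define hit where "hit = (if even (k j) then x \<le> ?s' else ?s' \<le> x - L)"
    have f_bound: "f (k j) ?s' \<le> f (k j) ?s + d"
      using dj by (auto simp: f_def psum_Suc)
    show ?case
    proof (cases hit)
      case False
      then have kS: "k (Suc j) = k j" by (simp add: k_def hit_def)
      have "f (k j) ?s' < x + real (k j) * L"
        using False by (auto simp: hit_def f_def algebra_simps split: if_splits)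
      moreover have "0 < k j \<longrightarrow> (\<exists>i\<le>Suc j. x + (real (k j) - 1) * L \<le> psum \<eta> i)"
        using IH(4) le_Suc_eq by blast
      ultimately show ?thesis unfolding kS using IH f_step by auto
    next
      case True
      then have kS: "k (Suc j) = Suc (k j)" by (simp add: k_def hit_def)
      \<comment> \<open>Passing to the next formula is a reflection at the level x + k L. The value
        was below this level one step ago and is at or above it now, so the reflection lowers it by
        at most two steps.\<close>
      have refl: "f (Suc (k j)) ?s' = 2 * x + 2 * (real (k j) * L) - f (k j) ?s'"
        by (auto simp: f_def algebra_simps)
      have ge: "x + real (k j) * L \<le> f (k j) ?s'"
        using True by (auto simp: hit_def f_def algebra_simps split: if_splits)
      have "x + real (k j) * L \<le> psum \<eta> (Suc j)" using ge f_step IH(1) by linarith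
      then have "\<exists>i\<le>Suc j. x + (real (k (Suc j)) - 1) * L \<le> psum \<eta> i"
        unfolding kS by auto
      moreover have "f (Suc (k j)) ?s' \<le> psum \<eta> (Suc j)"
        using refl ge f_step IH(1) by linarith
      moreover have "psum \<eta> (Suc j) \<le> f (Suc (k j)) ?s' + 2 * real (Suc (k j)) * d"
      proof -
        have "f (k j) ?s' \<le> f (Suc (k j)) ?s' + 2 * d"
          using refl f_bound IH(3) by linarith
        then show ?thesis using f_step IH(2) by (simp add: algebra_simps)
      qed
      moreover have "f (Suc (k j)) ?s' < x + real (Suc (k j)) * L"
        using refl ge \<open>0 < L\<close> by (simp add: algebra_simps)
      ultimately show ?thesis unfolding kS by blast
    qed
  qed
  then show "f (k j) (psum z j) \<le> psum \<eta> j"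
    and "psum \<eta> j \<le> f (k j) (psum z j) + 2 * real (k j) * step_bound N z"
    and "f (k j) (psum z j) < x + real (k j) * L"
    and "0 < k j \<Longrightarrow> \<exists>i\<le>j. x + (real (k j) - 1) * L \<le> psum \<eta> i"
    by (auto simp: d_def)
qed

lemma crossings_mono: "i \<le> j \<Longrightarrow> crossings x L z i \<le> crossings x L z j"
  by (rule lift_Suc_mono_le[of "crossings x L z"]) auto

lemma crossings_ge_imp_walk_max:
  assumes "0 < x" "0 < L" "n \<ge> 1" "n \<le> crossings x L z N"
  shows "x + (real n - 1) * L \<le> walk_max N (flip (\<lambda>j z. odd (crossings x L z j)) z)"
proof -
  have "0 < crossings x L z N" using assms by simp
  from crossings_flip(4)[OF assms(1,2) order_refl this]
  obtain i where "i \<le> N" "x + (real (crossings x L z N) - 1) * L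
      \<le> psum (flip (\<lambda>j z. odd (crossings x L z j)) z) i" by blast
  moreover have "(real n - 1) * L \<le> (real (crossings x L z N) - 1) * L"
    using assms by (intro mult_right_mono) auto
  ultimately show ?thesis unfolding le_walk_max_iff by (intro exI[of _ i]) linarith
qed

text \<open>With at most n - 1 crossings the unfolded walk stays below x + (n-1) L up to the
  accumulated overshoot.\<close>

lemma walk_max_imp_crossings_ge:
  assumes "0 < x" "0 < L" "n \<ge> 1"
    "x + (real n - 1) * L + 2 * real n * step_bound N z
      \<le> walk_max N (flip (\<lambda>j z. odd (crossings x L z j)) z)"
  shows "n \<le> crossings x L z N"
proof (rule ccontr)
  assume neg: "\<not> n \<le> crossings x L z N"
  define d where "d = step_bound N z"
  obtain i where i: "i \<le> N" "x + (real n - 1) * L + 2 * real n * d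
      \<le> psum (flip (\<lambda>j z. odd (crossings x L z j)) z) i"
    using assms(4) unfolding le_walk_max_iff d_def by blast
  have k: "real (crossings x L z i) \<le> real n - 1"
    using crossings_mono[OF i(1), of x L z] neg by linarith
  have "psum (flip (\<lambda>j z. odd (crossings x L z j)) z) i
      < x + real (crossings x L z i) * L + 2 * real (crossings x L z i) * d"
    using crossings_flip(2,3)[OF assms(1,2) i(1), of z] unfolding d_def by linarith
  also have "\<dots> \<le> x + (real n - 1) * L + 2 * real n * d"
  proof -
    have "real (crossings x L z i) * L \<le> (real n - 1) * L"
      using k \<open>0 < L\<close> by (intro mult_right_mono) auto
    moreover have "real (crossings x L z i) * d \<le> real n * d"
      using k step_bound_nonneg[of N z] unfolding d_def by (intro mult_right_mono) auto
    ultimately show ?thesis by simp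
  qed
  finally show False using i(2) by linarith
qed

text \<open>With L = a + b the second level is a - L = -b, so \<open>A\<close> counts alternating
  visits that begin at a, and \<open>B\<close> those that begin at -b. After the first visit to
  either level both counters wait for the same level, hence advance together with a lag of
  one.\<close>

lemma crossings_two_sided:
  fixes a b :: real and z :: "nat \<Rightarrow> real"
  assumes "0 < a" "0 < b"
  defines "A \<equiv> crossings a (a + b) z" and "B \<equiv> crossings b (a + b) (\<lambda>i. - z i)"
  shows "(A j = 0 \<and> B j = 0) \<or> A j = Suc (B j) \<or> B j = Suc (A j)"
proof (induction j)
  case (Suc j)
  then show ?case
    using assms(1,2) by (auto simp: A_def B_def psum_uminus)
qed (simp add: A_def B_def)

lemma crossings_pos: 
  assumes "j \<le> N" "x \<le> psum z j" "0 < x"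
  shows "0 < crossings x L z N"
proof -
  obtain i where i: "j = Suc i" using assms by (cases j) auto
  have "0 < crossings x L z (Suc i)" using assms(2) i by (auto simp: odd_pos)
  with crossings_mono[OF assms(1)] i show ?thesis by (metis gr0I leD)
qed

lemma crossings_uminus_pos:
  assumes "0 < a" "0 < b" "a \<le> walk_max N z" "b \<le> walk_max N (\<lambda>i. - z i)"
  shows "0 < crossings a (a + b) z N" "0 < crossings b (a + b) (\<lambda>i. - z i) N"
  using assms by (auto simp: le_walk_max_iff intro: crossings_pos)

text \<open>Pairing the condition 2k+2 <= c with 2k+3 <= c leaves exactly c = 2k+2. The sum stops
  after a positive term, and this unpaired term accounts for all c >= 2K+2; this makes the cut
  series an upper bound.\<close>

lemma alternating_indicator_sum:
  "(\<Sum>k<Suc K. of_bool (2 * k + 2 \<le> c)) - (\<Sum>k<K. of_bool (2 * k + 3 \<le> c)) =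
    (of_bool (2 * K + 2 \<le> c \<or> (even c \<and> 2 \<le> c)) :: real)"
proof (induction K)
  case (Suc K)
  have "(\<Sum>k<Suc (Suc K). of_bool (2 * k + 2 \<le> c)) - (\<Sum>k<Suc K. of_bool (2 * k + 3 \<le> c))
    = (of_bool (2 * K + 2 \<le> c \<or> (even c \<and> 2 \<le> c)) :: real)
       + of_bool (2 * Suc K + 2 \<le> c) - of_bool (2 * K + 3 \<le> c)"
    unfolding Suc.IH[symmetric] by simp
  also have "\<dots> = of_bool (2 * Suc K + 2 \<le> c \<or> (even c \<and> 2 \<le> c))"
  proof -
    have "c = 2 * K + 2 \<or> c = 2 * K + 3 \<or> 2 * Suc K + 2 \<le> c \<or> c < 2 * K + 2" by arith
    then show ?thesis by auto
  qed
  finally show ?case .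
qed auto

text \<open>Bonferroni-type inequality: if both levels are hit, the two crossing numbers are positive
  and differ by one, so that one of them is even.\<close>

lemma both_hit_le_alternating_sum:
  fixes a b :: real and z :: "nat \<Rightarrow> real" and N :: nat
  assumes "0 < a" "0 < b"
  defines "A \<equiv> crossings a (a + b) z N" and "B \<equiv> crossings b (a + b) (\<lambda>i. - z i) N"
  shows "(of_bool (a \<le> walk_max N z \<and> b \<le> walk_max N (\<lambda>i. - z i)) :: real)
      + (\<Sum>k<K. of_bool (2 * k + 3 \<le> A) + of_bool (2 * k + 3 \<le> B))
    \<le> (\<Sum>k<Suc K. of_bool (2 * k + 2 \<le> A) + of_bool (2 * k + 2 \<le> B))"
proof -
  have "(of_bool (a \<le> walk_max N z \<and> b \<le> walk_max N (\<lambda>i. - z i)) :: real)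
    \<le> of_bool (2 * K + 2 \<le> A \<or> (even A \<and> 2 \<le> A)) + of_bool (2 * K + 2 \<le> B \<or> (even B \<and> 2 \<le> B))"
  proof (cases "a \<le> walk_max N z \<and> b \<le> walk_max N (\<lambda>i. - z i)")
    case True
    then have "0 < A" "0 < B" using crossings_uminus_pos[OF assms(1,2)] by (auto simp: A_def B_def)
    moreover have "A = Suc B \<or> B = Suc A"
      using crossings_two_sided[OF assms(1,2), of z N] calculation by (auto simp: A_def B_def)
    ultimately have "(even A \<and> 2 \<le> A) \<or> (even B \<and> 2 \<le> B)"
      by presburger
    then show ?thesis by auto
  qed auto
  then show ?thesis
    unfolding alternating_indicator_sum[symmetric] sum.distrib by linarith
qed

section \<open>Symmetric walks\<close>

lemma borel_measurable_pred_le [measurable (raw)]: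
  fixes f g :: "'a \<Rightarrow> real"
  shows "f \<in> borel_measurable M \<Longrightarrow> g \<in> borel_measurable M \<Longrightarrow> Measurable.pred M (\<lambda>w. f w \<le> g w)"
  unfolding Measurable.pred_def by (rule borel_measurable_le)

lemma borel_measurable_psum:
  assumes "sets A = sets borel" "j \<le> N"
  shows "(\<lambda>z. psum z j) \<in> borel_measurable (PiM {..<N} (\<lambda>_. A))"
  unfolding psum_def
proof (rule borel_measurable_sum)
  fix i assume "i \<in> {..<j}"
  then have "(\<lambda>z. z i) \<in> PiM {..<N} (\<lambda>_. A) \<rightarrow>\<^sub>M A"
    using assms(2) by (intro measurable_component_singleton) auto
  then show "(\<lambda>z. z i) \<in> borel_measurable (PiM {..<N} (\<lambda>_. A))"
    by (simp cong: measurable_cong_sets add: assms(1))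
qed

lemma borel_measurable_walk_max:
  assumes "sets A = sets borel"
  shows "walk_max N \<in> borel_measurable (PiM {..<N} (\<lambda>_. A))"
proof -
  have [measurable]: "(\<lambda>z. psum z j) \<in> borel_measurable (PiM {..<N} (\<lambda>_. A))" if "j \<in> {..N}" for j
    using borel_measurable_psum[OF assms] that by auto
  have "{z \<in> space (PiM {..<N} (\<lambda>_. A)). \<exists>j\<in>{..N}. x \<le> psum z j} \<in> sets (PiM {..<N} (\<lambda>_. A))" for x
    by measurable
  then show ?thesis
    by (simp add: borel_measurable_iff_ge le_walk_max_iff Bex_def)
qed

lemma borel_measurable_step_bound:
  assumes "sets A = sets borel"
  shows "step_bound N \<in> borel_measurable (PiM {..<N} (\<lambda>_. A))"
proof -
  have [measurable]: "(\<lambda>z. z i) \<in> borel_measurable (PiM {..<N} (\<lambda>_. A))" if "i \<in> {..<N}" for i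
    using measurable_component_singleton[OF that, of "\<lambda>_. A"]
    by (simp cong: measurable_cong_sets add: assms(1))
  show ?thesis unfolding step_bound_def by measurable
qed

lemma measurable_crossings:
  assumes "sets A = sets borel" "j \<le> N"
  shows "(\<lambda>z. crossings x L z j) \<in> PiM {..<N} (\<lambda>_. A) \<rightarrow>\<^sub>M count_space UNIV"
  using assms(2)
proof (induction j)
  case (Suc j)
  then have [measurable]: "(\<lambda>z. crossings x L z j) \<in> PiM {..<N} (\<lambda>_. A) \<rightarrow>\<^sub>M count_space UNIV"
    by simp
  have [measurable]: "(\<lambda>z. psum z (Suc j)) \<in> borel_measurable (PiM {..<N} (\<lambda>_. A))"
    using Suc.prems by (rule borel_measurable_psum[OF assms(1)])
  show ?case by simp
qed simp

text \<open>The sign given to a step is determined by the steps before it. Integrating the last step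
  first, for fixed earlier ones, either keeps or negates a symmetric variable, so the last flip
  disappears; induction removes the others.\<close>

lemma nn_integral_flip_restrict:
  fixes A :: "real measure"
  assumes "prob_space A" and sets_A: "sets A = sets borel" and sym: "distr A borel uminus = A"
    and local: "\<And>j z \<eta>. (\<And>i. i < j \<Longrightarrow> z i = \<eta> i) \<Longrightarrow> c j z = c j \<eta>"
    and c: "\<And>j N. j < N \<Longrightarrow> Measurable.pred (PiM {..<N} (\<lambda>_. A)) (c j)"
    and f: "f \<in> borel_measurable (PiM {..<N} (\<lambda>_. A))"
  shows "(\<integral>\<^sup>+z. f (restrict (flip c z) {..<N}) \<partial>PiM {..<N} (\<lambda>_. A)) = integral\<^sup>N (PiM {..<N} (\<lambda>_. A)) f"
  using f
proof (induction N arbitrary: f)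
  case 0
  show ?case by (intro nn_integral_cong) (auto simp: space_PiM PiE_def extensional_def restrict_def)
next
  case (Suc N)
  interpret A: prob_space A by fact
  interpret product_sigma_finite "\<lambda>_::nat. A" ..
  have lt: "{..<Suc N} = insert N {..<N}" by auto
  have [measurable]: "Measurable.pred (PiM {..<Suc N} (\<lambda>_. A)) (c j)" if "j \<in> {..<Suc N}" for j
    using c that by auto
  have [measurable]: "(\<lambda>z. z i) \<in> PiM {..<Suc N} (\<lambda>_. A) \<rightarrow>\<^sub>M A" if "i \<in> {..<Suc N}" for i
    using measurable_component_singleton[OF that, of "\<lambda>_. A"] .
  have um[measurable]: "uminus \<in> A \<rightarrow>\<^sub>M A"
    by (simp cong: measurable_cong_sets add: sets_A)
  note Suc.prems[measurable]
  have "(\<lambda>z. restrict (flip c z) {..<Suc N}) \<in> PiM {..<Suc N} (\<lambda>_. A) \<rightarrow>\<^sub>M PiM {..<Suc N} (\<lambda>_. A)"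
    unfolding flip_def by measurable
  note f_flip = measurable_compose[OF this Suc.prems]
  have "(\<integral>\<^sup>+z. f (restrict (flip c z) {..<Suc N}) \<partial>PiM {..<Suc N} (\<lambda>_. A)) =
      (\<integral>\<^sup>+z. \<integral>\<^sup>+y. f (restrict (flip c (z(N := y))) {..<Suc N}) \<partial>A \<partial>PiM {..<N} (\<lambda>_. A))"
    unfolding lt by (rule product_nn_integral_insert[OF _ _ f_flip[unfolded lt]]) auto
  also have "\<dots> = (\<integral>\<^sup>+z. \<integral>\<^sup>+y. f ((restrict (flip c z) {..<N})(N := y)) \<partial>A \<partial>PiM {..<N} (\<lambda>_. A))"
  proof (rule nn_integral_cong)
    fix z assume z: "z \<in> space (PiM {..<N} (\<lambda>_. A))"
    define \<zeta> where "\<zeta> = restrict (flip c z) {..<N}"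
    have c_eq: "c j (z(N := y)) = c j z" if "j \<le> N" for j y
      using that by (intro local) auto
    have eq: "restrict (flip c (z(N := y))) {..<Suc N} = \<zeta>(N := (if c N z then - y else y))" for y
      by (rule ext) (auto simp: restrict_def flip_def \<zeta>_def c_eq)
    have "\<zeta> \<in> space (PiM {..<N} (\<lambda>_. A))"
      using sets_eq_imp_space_eq[OF sets_A] by (auto simp: space_PiM \<zeta>_def PiE_def)
    then have "(\<lambda>y. \<zeta>(N := y)) \<in> A \<rightarrow>\<^sub>M PiM (insert N {..<N}) (\<lambda>_. A)"
      by (intro measurable_component_update) auto
    then have [measurable]: "(\<lambda>y. f (\<zeta>(N := y))) \<in> borel_measurable A"
      unfolding lt[symmetric] by measurable
    then have [measurable]: "(\<lambda>y. f (\<zeta>(N := y))) \<in> borel_measurable borel"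
      by (simp cong: measurable_cong_sets add: sets_A)
    have "(\<integral>\<^sup>+y. f (\<zeta>(N := - y)) \<partial>A) = (\<integral>\<^sup>+y. f (\<zeta>(N := y)) \<partial>distr A borel uminus)"
      using um by (subst nn_integral_distr) (auto simp: sets_A cong: measurable_cong_sets)
    also have "\<dots> = (\<integral>\<^sup>+y. f (\<zeta>(N := y)) \<partial>A)" by (simp only: sym)
    finally show "(\<integral>\<^sup>+y. f (restrict (flip c (z(N := y))) {..<Suc N}) \<partial>A) = (\<integral>\<^sup>+y. f ((restrict (flip c z) {..<N})(N := y)) \<partial>A)"
      unfolding eq \<zeta>_def[symmetric] by (cases "c N z") simp_all
  qed
  also have "\<dots> = (\<integral>\<^sup>+z. \<integral>\<^sup>+y. f (z(N := y)) \<partial>A \<partial>PiM {..<N} (\<lambda>_. A))"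
  proof (rule Suc.IH)
    note Suc.prems[unfolded lt, measurable]
    show "(\<lambda>z. \<integral>\<^sup>+ y. f (z(N := y)) \<partial>A) \<in> borel_measurable (PiM {..<N} (\<lambda>_. A))" by measurable
  qed
  also have "\<dots> = integral\<^sup>N (PiM {..<Suc N} (\<lambda>_. A)) f"
    using Suc.prems unfolding lt by (intro product_nn_integral_insert[symmetric]) auto
  finally show ?case .
qed

section \<open>Invariance under sign flips and the probabilities of alternating crossings\<close>

locale symmetric_walk =
  fixes A :: "real measure" and N :: nat
  assumes prob_A: "prob_space A" and sets_A: "sets A = sets borel"
    and sym: "distr A borel uminus = A"
begin

abbreviation P :: "(nat \<Rightarrow> real) measure" where "P \<equiv> PiM {..<N} (\<lambda>_. A)"

lemma prob_P: "prob_space P"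
  by (intro prob_space_PiM prob_A)

lemma measurable_P [measurable]:
  "walk_max N \<in> borel_measurable P" "step_bound N \<in> borel_measurable P"
  "(\<lambda>z. psum z N) \<in> borel_measurable P"
  by (simp_all add: borel_measurable_walk_max borel_measurable_step_bound borel_measurable_psum sets_A)

text \<open>\<open>flip c z\<close> may leave the space of \<open>P\<close>, because it also acts on
  the values outside {..<N}, where points of a product space are \<open>undefined\<close>. The
  second condition on \<open>f\<close> makes these values irrelevant.\<close>

lemma nn_integral_flip:
  assumes "\<And>j z \<eta>. (\<And>i. i < j \<Longrightarrow> z i = \<eta> i) \<Longrightarrow> c j z = c j \<eta>"
    and "\<And>j N. j < N \<Longrightarrow> Measurable.pred (PiM {..<N} (\<lambda>_. A)) (c j)"
    and f: "f \<in> borel_measurable P" "\<And>z \<eta>. (\<And>i. i < N \<Longrightarrow> z i = \<eta> i) \<Longrightarrow> f z = f \<eta>"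
  shows "(\<integral>\<^sup>+z. f (flip c z) \<partial>P) = integral\<^sup>N P f"
proof -
  have "f (flip c z) = f (restrict (flip c z) {..<N})" for z by (rule f(2)) auto
  then show ?thesis
    using nn_integral_flip_restrict[OF prob_A sets_A sym assms(1,2) f(1)] by simp
qed

lemma nn_integral_uminus:
  assumes "f \<in> borel_measurable P" "\<And>z \<eta>. (\<And>i. i < N \<Longrightarrow> z i = \<eta> i) \<Longrightarrow> f z = f \<eta>"
  shows "(\<integral>\<^sup>+z. f (\<lambda>i. - z i) \<partial>P) = integral\<^sup>N P f"
  using nn_integral_flip[of "\<lambda>_ _. True", OF _ _ assms] by (simp add: flip_def[abs_def])

lemma measurable_uminus:
  assumes "f \<in> P \<rightarrow>\<^sub>M X" "\<And>z \<eta>. (\<And>i. i < N \<Longrightarrow> z i = \<eta> i) \<Longrightarrow> f z = f \<eta>"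
  shows "(\<lambda>z. f (\<lambda>i. - z i)) \<in> P \<rightarrow>\<^sub>M X"
proof -
  have [measurable]: "uminus \<in> A \<rightarrow>\<^sub>M A" by (simp cong: measurable_cong_sets add: sets_A)
  have [measurable]: "(\<lambda>z. z i) \<in> P \<rightarrow>\<^sub>M A" if "i \<in> {..<N}" for i
    using that by (rule measurable_component_singleton)
  have "(\<lambda>z. \<lambda>i\<in>{..<N}. - z i) \<in> P \<rightarrow>\<^sub>M P" by measurable
  from measurable_compose[OF this assms(1)] show ?thesis
    using assms(2)[of "\<lambda>i. - z i" "\<lambda>i\<in>{..<N}. - z i" for z] by simp
qed

lemma measurable_walk_max_uminus [measurable]: "(\<lambda>z. walk_max N (\<lambda>i. - z i)) \<in> borel_measurable P"
  by (rule measurable_uminus) (auto intro: walk_max_cong)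

lemma nn_integral_flip_crossings:
  assumes "f \<in> borel_measurable P" "\<And>z \<eta>. (\<And>i. i < N \<Longrightarrow> z i = \<eta> i) \<Longrightarrow> f z = f \<eta>"
  shows "(\<integral>\<^sup>+z. f (flip (\<lambda>j z. odd (crossings x L z j)) z) \<partial>P) = integral\<^sup>N P f"
proof (rule nn_integral_flip[OF _ _ assms])
  fix j and z \<eta> :: "nat \<Rightarrow> real" assume "\<And>i. i < j \<Longrightarrow> z i = \<eta> i"
  then show "odd (crossings x L z j) = odd (crossings x L \<eta> j)" by (metis crossings_cong)
next
  fix j N :: nat assume "j < N"
  then have [measurable]: "(\<lambda>z. crossings x L z j) \<in> PiM {..<N} (\<lambda>_. A) \<rightarrow>\<^sub>M count_space UNIV"
    by (intro measurable_crossings sets_A) auto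
  show "Measurable.pred (PiM {..<N} (\<lambda>_. A)) (\<lambda>z. odd (crossings x L z j))" by measurable
qed

text \<open>Overshoot only carries the unfolded walk higher, so this direction has no error
  term.\<close>

lemma nn_integral_crossings_le:
  assumes "0 < x" "0 < L" "1 \<le> n"
  shows "(\<integral>\<^sup>+z. of_bool (n \<le> crossings x L z N) \<partial>P)
    \<le> (\<integral>\<^sup>+z. of_bool (x + (real n - 1) * L \<le> walk_max N z) \<partial>P)"
proof -
  let ?f = "\<lambda>z. of_bool (x + (real n - 1) * L \<le> walk_max N z) :: ennreal"
  have "(\<integral>\<^sup>+z. of_bool (n \<le> crossings x L z N) \<partial>P)
     \<le> (\<integral>\<^sup>+z. ?f (flip (\<lambda>j z. odd (crossings x L z j)) z) \<partial>P)"
    using crossings_ge_imp_walk_max[OF assms] by (intro nn_integral_mono) auto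
  also have "\<dots> = integral\<^sup>N P ?f"
  proof (rule nn_integral_flip_crossings)
    show "?f z = ?f \<eta>" if "\<And>i. i < N \<Longrightarrow> z i = \<eta> i" for z \<eta>
      using walk_max_cong[OF that] by simp
  qed measurable
  finally show ?thesis .
qed

lemma nn_integral_crossings_ge:
  assumes "0 < x" "0 < L" "1 \<le> n"
  shows "(\<integral>\<^sup>+z. of_bool (x + (real n - 1) * L + 2 * real n * step_bound N z \<le> walk_max N z) \<partial>P)
     \<le> (\<integral>\<^sup>+z. of_bool (n \<le> crossings x L z N) \<partial>P)"
proof -
  let ?f = "\<lambda>z. of_bool (x + (real n - 1) * L + 2 * real n * step_bound N z \<le> walk_max N z) :: ennreal"
  have "integral\<^sup>N P ?f = (\<integral>\<^sup>+z. ?f (flip (\<lambda>j z. odd (crossings x L z j)) z) \<partial>P)"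
  proof (rule nn_integral_flip_crossings[symmetric])
    show "?f z = ?f \<eta>" if "\<And>i. i < N \<Longrightarrow> z i = \<eta> i" for z \<eta>
      using walk_max_cong[OF that] step_bound_cong[of N z \<eta>] that by simp
  qed measurable
  also have "\<dots> \<le> (\<integral>\<^sup>+z. of_bool (n \<le> crossings x L z N) \<partial>P)"
    using walk_max_imp_crossings_ge[OF assms] by (intro nn_integral_mono) (auto simp: step_bound_flip)
  finally show ?thesis .
qed

text \<open>The expectation of \<open>both_hit_le_alternating_sum\<close>: even crossing numbers are
  bounded from above, odd ones from below, so only the odd terms carry overshoot. Counts on the
  negated walk have the same law as counts on the walk.\<close>

lemma both_levels_alternating:
  assumes "0 < a" "0 < b"
  shows "(\<integral>\<^sup>+z. of_bool (a \<le> walk_max N z \<and> b \<le> walk_max N (\<lambda>i. - z i)) \<partial>P)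
     + (\<Sum>k<K. (\<integral>\<^sup>+z. of_bool (a + (real (2*k+3) - 1) * (a + b) + 2 * real (2*k+3) * step_bound N z \<le> walk_max N z) \<partial>P)
            + (\<integral>\<^sup>+z. of_bool (b + (real (2*k+3) - 1) * (a + b) + 2 * real (2*k+3) * step_bound N z \<le> walk_max N z) \<partial>P))
   \<le> (\<Sum>k<Suc K. (\<integral>\<^sup>+z. of_bool (a + (real (2*k+2) - 1) * (a + b) \<le> walk_max N z) \<partial>P)
            + (\<integral>\<^sup>+z. of_bool (b + (real (2*k+2) - 1) * (a + b) \<le> walk_max N z) \<partial>P))"
proof -
  define cA where "cA = (\<lambda>z. crossings a (a + b) z N)"
  define cB where "cB = (\<lambda>z. crossings b (a + b) z N)"
  have [measurable]: "cA \<in> P \<rightarrow>\<^sub>M count_space UNIV" "cB \<in> P \<rightarrow>\<^sub>M count_space UNIV"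
    unfolding cA_def cB_def by (intro measurable_crossings sets_A order_refl)+
  have cB_minus: "(\<lambda>z. cB (\<lambda>i. - z i)) \<in> P \<rightarrow>\<^sub>M count_space UNIV"
    by (rule measurable_uminus, measurable) (auto simp: cB_def intro: crossings_cong)
  note [measurable] = cB_minus
  have B: "(\<integral>\<^sup>+z. of_bool (n \<le> cB (\<lambda>i. - z i)) \<partial>P) = (\<integral>\<^sup>+z. of_bool (n \<le> cB z) \<partial>P)" for n
  proof (rule nn_integral_uminus)
    show "of_bool (n \<le> cB z) = (of_bool (n \<le> cB \<eta>) :: ennreal)"
      if "\<And>i. i < N \<Longrightarrow> z i = \<eta> i" for z \<eta>
      using crossings_cong[OF that] unfolding cB_def by simp
  qed measurable
  have pw: "(of_bool (a \<le> walk_max N z \<and> b \<le> walk_max N (\<lambda>i. - z i)) :: ennreal)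
      + (\<Sum>k<K. of_bool (2 * k + 3 \<le> cA z) + of_bool (2 * k + 3 \<le> cB (\<lambda>i. - z i)))
    \<le> (\<Sum>k<Suc K. of_bool (2 * k + 2 \<le> cA z) + of_bool (2 * k + 2 \<le> cB (\<lambda>i. - z i)))" for z
  proof -
    \<comment> \<open>The combinatorial inequality was proved over the reals, by subtraction; it is
      transported to \<open>ennreal\<close> term by term.\<close>
    have ob: "(of_bool p :: ennreal) = ennreal (of_bool p)" for p by simp
    show ?thesis
      unfolding ob using both_hit_le_alternating_sum[OF assms, of N z K]
      by (subst ennreal_plus[symmetric], simp, simp)+
        (simp add: cA_def cB_def add_nonneg_nonneg sum_nonneg ennreal_leI del: of_bool_eq ennreal_plus sum.lessThan_Suc
            flip: ennreal_plus)
  qed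
  have "(\<integral>\<^sup>+z. of_bool (a \<le> walk_max N z \<and> b \<le> walk_max N (\<lambda>i. - z i)) \<partial>P)
      + (\<Sum>k<K. (\<integral>\<^sup>+z. of_bool (2 * k + 3 \<le> cA z) \<partial>P) + (\<integral>\<^sup>+z. of_bool (2 * k + 3 \<le> cB z) \<partial>P))
    = (\<integral>\<^sup>+z. of_bool (a \<le> walk_max N z \<and> b \<le> walk_max N (\<lambda>i. - z i))
       + (\<Sum>k<K. of_bool (2 * k + 3 \<le> cA z) + of_bool (2 * k + 3 \<le> cB (\<lambda>i. - z i))) \<partial>P)"
    by (simp add: nn_integral_add nn_integral_sum B)
  also have "\<dots> \<le> (\<integral>\<^sup>+z. (\<Sum>k<Suc K. of_bool (2 * k + 2 \<le> cA z) + of_bool (2 * k + 2 \<le> cB (\<lambda>i. - z i))) \<partial>P)"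
    by (intro nn_integral_mono pw)
  also have "\<dots> = (\<Sum>k<Suc K. (\<integral>\<^sup>+z. of_bool (2 * k + 2 \<le> cA z) \<partial>P) + (\<integral>\<^sup>+z. of_bool (2 * k + 2 \<le> cB z) \<partial>P))"
    by (simp add: nn_integral_add nn_integral_sum B del: sum.lessThan_Suc)
  also have "\<dots> \<le> (\<Sum>k<Suc K. (\<integral>\<^sup>+z. of_bool (a + (real (2*k+2) - 1) * (a + b) \<le> walk_max N z) \<partial>P)
            + (\<integral>\<^sup>+z. of_bool (b + (real (2*k+2) - 1) * (a + b) \<le> walk_max N z) \<partial>P))"
    using assms unfolding cA_def cB_def
    by (intro sum_mono add_mono nn_integral_crossings_le) auto
  finally show ?thesis
    by (rule order_trans[rotated], unfold cA_def cB_def,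
        intro add_left_mono sum_mono add_mono nn_integral_crossings_ge) (use assms in auto)
qed

end

section \<open>Integrals over one or two levels\<close>

lemma nn_integral_interval:
  "(\<integral>\<^sup>+b. of_bool (0 < b \<and> b \<le> y) \<partial>lborel) = ennreal (max 0 y)"
proof -
  have "(\<integral>\<^sup>+b. of_bool (0 < b \<and> b \<le> y) \<partial>lborel) = (\<integral>\<^sup>+b. indicator {0<..y} b \<partial>lborel)"
    by (intro nn_integral_cong) (auto simp: indicator_def)
  also have "\<dots> = ennreal (max 0 y)"
    by (cases "0 \<le> y") (auto simp: max_def)
  finally show ?thesis .
qed

text \<open>Layer-cake form of a product: with x and y the maxima of the walk and of its negative,
  it turns the probabilities of reaching both a and -b into the mean of the product.\<close>

lemma nn_integral_rectangle:
  assumes "0 \<le> x" "0 \<le> y"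
  shows "(\<integral>\<^sup>+a. \<integral>\<^sup>+b. of_bool (0 < a \<and> 0 < b) * of_bool (a \<le> x \<and> b \<le> y) \<partial>lborel \<partial>lborel) = ennreal (x * y)"
proof -
  have "(\<integral>\<^sup>+a. \<integral>\<^sup>+b. of_bool (0 < a \<and> 0 < b) * of_bool (a \<le> x \<and> b \<le> y) \<partial>lborel \<partial>lborel)
    = (\<integral>\<^sup>+a. of_bool (0 < a \<and> a \<le> x) * (\<integral>\<^sup>+b. of_bool (0 < b \<and> b \<le> y) \<partial>lborel) \<partial>lborel)"
    by (subst nn_integral_cmult[symmetric]) (auto intro!: nn_integral_cong)
  then show ?thesis using assms
    by (simp add: nn_integral_multc nn_integral_interval ennreal_mult)
qed

text \<open>The region is a right triangle with legs y / p and y / q. For p = n and q = n - 1 it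
  produces the denominators n (n-1) of the series.\<close>

lemma nn_integral_triangle:
  fixes p q y :: real
  assumes "0 < p" "0 < q"
  shows "(\<integral>\<^sup>+a. \<integral>\<^sup>+b. of_bool (0 < a \<and> 0 < b) * of_bool (p * a + q * b \<le> y) \<partial>lborel \<partial>lborel)
    = ennreal ((max 0 y)\<^sup>2 / (2 * p * q))"
proof -
  have "(\<integral>\<^sup>+b. of_bool (0 < a \<and> 0 < b) * of_bool (p * a + q * b \<le> y) \<partial>lborel)
      = ennreal (max 0 ((y - p * a) / q)) * of_bool (0 < a)" for a
  proof -
    have "(\<integral>\<^sup>+b. of_bool (0 < a \<and> 0 < b) * of_bool (p * a + q * b \<le> y) \<partial>lborel)
       = (\<integral>\<^sup>+b. of_bool (0 < a) * of_bool (0 < b \<and> b \<le> (y - p * a) / q) \<partial>lborel)"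
      using \<open>0 < q\<close> by (intro nn_integral_cong) (auto simp: field_simps)
    then show ?thesis
      by (simp add: nn_integral_cmult nn_integral_interval mult.commute)
  qed
  then have "(\<integral>\<^sup>+a. \<integral>\<^sup>+b. of_bool (0 < a \<and> 0 < b) * of_bool (p * a + q * b \<le> y) \<partial>lborel \<partial>lborel)
     = (\<integral>\<^sup>+a. ennreal (max 0 ((y - p * a) / q)) * of_bool (0 < a) \<partial>lborel)" by simp
  also have "\<dots> = ennreal ((max 0 y)\<^sup>2 / (2 * p * q))"
  proof (cases "0 < y")
    case False
    then have "max 0 ((y - p * a) / q) = 0" if "0 < a" for a
    proof -
      have "0 < p * a" using assms that by simp
      then have "(y - p * a) / q \<le> 0" using False assms by (intro divide_nonpos_pos) auto
      then show ?thesis by simp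
    qed
    then have "ennreal (max 0 ((y - p * a) / q)) * of_bool (0 < a) = 0" for a
      by (cases "0 < a") auto
    then have eq: "(\<lambda>a. ennreal (max 0 ((y - p * a) / q)) * of_bool (0 < a)) = (\<lambda>_. 0)"
      by (rule ext)
    show ?thesis unfolding eq using False by simp
  next
    case True
    define F where "F = (\<lambda>a. (y * a - p * a\<^sup>2 / 2) / q)"
    have "(\<integral>\<^sup>+a. ennreal (max 0 ((y - p * a) / q)) * of_bool (0 < a) \<partial>lborel)
      = (\<integral>\<^sup>+a. ennreal ((y - p * a) / q) * indicator {0..y / p} a \<partial>lborel)"
    proof (rule nn_integral_cong_AE)
      have "AE a in lborel. a \<noteq> (0::real)" by (rule AE_lborel_singleton)
      then show "AE a in lborel. ennreal (max 0 ((y - p * a) / q)) * of_bool (0 < a)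
           = ennreal ((y - p * a) / q) * indicator {0..y / p} a"
      proof eventually_elim
        case (elim a)
        have "a \<le> y / p \<longleftrightarrow> 0 \<le> (y - p * a) / q" using assms by (simp add: field_simps)
        then show ?case using elim by (auto simp: indicator_def max_def)
      qed
    qed
    also have "\<dots> = F (y / p) - F 0"
      using assms True
      by (intro nn_integral_FTC_Icc)
        (auto simp: F_def field_simps power2_eq_square intro!: derivative_eq_intros)
    also have "F (y / p) - F 0 = (max 0 y)\<^sup>2 / (2 * p * q)"
      using assms True by (simp add: F_def field_simps power2_eq_square)
    finally show ?thesis .
  qed
  finally show ?thesis .
qed

lemma nn_integral_rotate3:
  fixes f :: "real \<Rightarrow> real \<Rightarrow> 'a \<Rightarrow> ennreal"
  assumes "sigma_finite_measure P"
    and m: "\<And>a. (\<lambda>x. f a (snd x) (fst x)) \<in> borel_measurable (P \<Otimes>\<^sub>M lborel)"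
    and m': "(\<lambda>x. f (snd (fst x)) (snd x) (fst (fst x))) \<in> borel_measurable ((P \<Otimes>\<^sub>M lborel) \<Otimes>\<^sub>M lborel)"
  shows "(\<integral>\<^sup>+a. \<integral>\<^sup>+b. \<integral>\<^sup>+z. f a b z \<partial>P \<partial>lborel \<partial>lborel) = (\<integral>\<^sup>+z. \<integral>\<^sup>+a. \<integral>\<^sup>+b. f a b z \<partial>lborel \<partial>lborel \<partial>P)"
proof -
  interpret P: sigma_finite_measure P by fact
  interpret pair_sigma_finite P lborel ..
  have "(\<integral>\<^sup>+b. \<integral>\<^sup>+z. f a b z \<partial>P \<partial>lborel) = (\<integral>\<^sup>+z. \<integral>\<^sup>+b. f a b z \<partial>lborel \<partial>P)" for a
    using m[of a] by (intro Fubini') (simp add: case_prod_unfold)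
  moreover have "(\<integral>\<^sup>+a. \<integral>\<^sup>+z. \<integral>\<^sup>+b. f a b z \<partial>lborel \<partial>P \<partial>lborel) = (\<integral>\<^sup>+z. \<integral>\<^sup>+a. \<integral>\<^sup>+b. f a b z \<partial>lborel \<partial>lborel \<partial>P)"
    using lborel.borel_measurable_nn_integral_fst[OF m']
    by (intro Fubini') (simp add: case_prod_unfold)
  ultimately show ?thesis by simp
qed

text \<open>Reflection at the first hit of a. Up to that time both walks agree, so both hit a;
  afterwards their sum is frozen at twice the value at the hit, which exceeds a by at most one
  step.\<close>

lemma flip_hit:
  fixes a :: real and z :: "nat \<Rightarrow> real"
  defines "hit \<equiv> \<lambda>j z. \<exists>i\<le>j. a \<le> psum z i"
  defines "\<eta> \<equiv> flip hit z"
  assumes "0 < a" "j \<le> N"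
  shows "hit j z \<Longrightarrow> 2 * a \<le> psum \<eta> j + psum z j"
    and "hit j z \<Longrightarrow> psum \<eta> j + psum z j \<le> 2 * a + 2 * step_bound N z"
    and "\<not> hit j z \<Longrightarrow> psum \<eta> j = psum z j"
    and "hit j z \<Longrightarrow> \<exists>i\<le>j. a \<le> psum \<eta> i"
proof -
  have "(if hit j z then 2 * a \<le> psum \<eta> j + psum z j \<and> psum \<eta> j + psum z j \<le> 2 * a + 2 * step_bound N z
          \<and> (\<exists>i\<le>j. a \<le> psum \<eta> i)
      else psum \<eta> j = psum z j)"
    using \<open>j \<le> N\<close>
  proof (induction j)
    case 0
    then show ?case using \<open>0 < a\<close> by (simp add: hit_def)
  next
    case (Suc j)
    have d: "\<bar>z j\<bar> \<le> step_bound N z" using Suc.prems by (intro step_bound_ge) auto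
    have hS: "hit (Suc j) z \<longleftrightarrow> hit j z \<or> a \<le> psum z (Suc j)"
      by (auto simp: hit_def le_Suc_eq)
    show ?case
    proof (cases "hit j z")
      case True
      then show ?thesis using Suc hS
        by (auto simp: psum_Suc \<eta>_def flip_def le_Suc_eq)
    next
      case False
      then have lt: "psum z j < a" by (auto simp: hit_def not_le)
      have eq: "psum \<eta> j = psum z j" using Suc False by simp
      then have eqS: "psum \<eta> (Suc j) = psum z (Suc j)"
        using False by (simp add: psum_Suc \<eta>_def flip_def)
      show ?thesis
        using eqS lt hS False d by (auto simp: psum_Suc)
    qed
  qed
  then show "hit j z \<Longrightarrow> 2 * a \<le> psum \<eta> j + psum z j"
    and "hit j z \<Longrightarrow> psum \<eta> j + psum z j \<le> 2 * a + 2 * step_bound N z"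
    and "\<not> hit j z \<Longrightarrow> psum \<eta> j = psum z j"
    and "hit j z \<Longrightarrow> \<exists>i\<le>j. a \<le> psum \<eta> i"
    by auto
qed

section \<open>Second moment of the maximum, and the mean of maximum times minus minimum\<close>

context symmetric_walk
begin

lemma sigma_finite_P: "sigma_finite_measure P"
  using prob_P prob_space_imp_sigma_finite by blast

lemma nn_integral_flip_hit:
  assumes "f \<in> borel_measurable P" "\<And>z \<eta>. (\<And>i. i < N \<Longrightarrow> z i = \<eta> i) \<Longrightarrow> f z = f \<eta>"
  shows "(\<integral>\<^sup>+z. f (flip (\<lambda>j z. \<exists>i\<le>j. a \<le> psum z i) z) \<partial>P) = integral\<^sup>N P f"
proof (rule nn_integral_flip[OF _ _ assms])
  fix j and z \<eta> :: "nat \<Rightarrow> real" assume "\<And>i. i < j \<Longrightarrow> z i = \<eta> i"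
  then have "psum z i = psum \<eta> i" if "i \<le> j" for i using that by (intro psum_cong) auto
  then show "(\<exists>i\<le>j. a \<le> psum z i) = (\<exists>i\<le>j. a \<le> psum \<eta> i)" by auto
next
  fix j N :: nat assume "j < N"
  then have [measurable]: "(\<lambda>z. psum z i) \<in> borel_measurable (PiM {..<N} (\<lambda>_. A))" if "i \<in> {..j}" for i
    using that by (intro borel_measurable_psum sets_A) auto
  have "Measurable.pred (PiM {..<N} (\<lambda>_. A)) (\<lambda>z. \<exists>i\<in>{..j}. a \<le> psum z i)" by measurable
  then show "Measurable.pred (PiM {..<N} (\<lambda>_. A)) (\<lambda>z. \<exists>i\<le>j. a \<le> psum z i)"
    by (simp add: Bex_def)
qed

text \<open>A path that hits a but ends below it is reflected to one ending above a. Overshoot moves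
  the reflected endpoint further up, so there is no error.\<close>

lemma walk_max_tail_le:
  assumes "0 < a"
  shows "(\<integral>\<^sup>+z. of_bool (a \<le> walk_max N z) \<partial>P) \<le> 2 * (\<integral>\<^sup>+z. of_bool (a \<le> psum z N) \<partial>P)"
proof -
  define T where "T = flip (\<lambda>j z. \<exists>i\<le>j. a \<le> psum z i)"
  have T: "(\<integral>\<^sup>+z. of_bool (a \<le> psum (T z) N) \<partial>P) = (\<integral>\<^sup>+z. of_bool (a \<le> psum z N) \<partial>P)"
    unfolding T_def
  proof (rule nn_integral_flip_hit)
    show "of_bool (a \<le> psum z N) = (of_bool (a \<le> psum \<eta> N) :: ennreal)"
      if "\<And>i. i < N \<Longrightarrow> z i = \<eta> i" for z \<eta>
      using psum_cong[OF that] by simp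
  qed measurable
  have "of_bool (a \<le> walk_max N z \<and> psum z N < a) \<le> (of_bool (a \<le> psum (T z) N) :: ennreal)" for z
  proof (cases "a \<le> walk_max N z \<and> psum z N < a")
    case True
    then have "2 * a \<le> psum (T z) N + psum z N"
      unfolding T_def le_walk_max_iff by (intro flip_hit(1)[OF \<open>0 < a\<close> order_refl]) auto
    then show ?thesis using True by auto
  qed auto
  then have "(\<integral>\<^sup>+z. of_bool (a \<le> walk_max N z \<and> psum z N < a) \<partial>P) \<le> (\<integral>\<^sup>+z. of_bool (a \<le> psum z N) \<partial>P)"
    unfolding T[symmetric] by (intro nn_integral_mono)
  moreover have "(\<integral>\<^sup>+z. of_bool (a \<le> walk_max N z) \<partial>P)
     \<le> (\<integral>\<^sup>+z. of_bool (a \<le> psum z N) + of_bool (a \<le> walk_max N z \<and> psum z N < a) \<partial>P)"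
    by (intro nn_integral_mono) auto
  ultimately show ?thesis
    by (subst (asm) nn_integral_add) (auto simp: mult_2 intro: order_trans add_left_mono)
qed

lemma nn_integral_triangle_walk:
  assumes [measurable]: "f \<in> borel_measurable P" and "0 < p" "0 < q"
  shows "(\<integral>\<^sup>+a. \<integral>\<^sup>+b. of_bool (0 < a \<and> 0 < b) * (\<integral>\<^sup>+z. of_bool (p * a + q * b \<le> f z) \<partial>P) \<partial>lborel \<partial>lborel)
     = (\<integral>\<^sup>+z. ennreal ((max 0 (f z))\<^sup>2 / (2 * p * q)) \<partial>P)"
proof -
  have "(\<integral>\<^sup>+a. \<integral>\<^sup>+b. of_bool (0 < a \<and> 0 < b) * (\<integral>\<^sup>+z. of_bool (p * a + q * b \<le> f z) \<partial>P) \<partial>lborel \<partial>lborel)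
    = (\<integral>\<^sup>+a. \<integral>\<^sup>+b. \<integral>\<^sup>+z. of_bool (0 < a \<and> 0 < b) * of_bool (p * a + q * b \<le> f z) \<partial>P \<partial>lborel \<partial>lborel)"
    by (subst nn_integral_cmult) auto
  also have "\<dots> = (\<integral>\<^sup>+z. \<integral>\<^sup>+a. \<integral>\<^sup>+b. of_bool (0 < a \<and> 0 < b) * of_bool (p * a + q * b \<le> f z) \<partial>lborel \<partial>lborel \<partial>P)"
    by (intro nn_integral_rotate3 sigma_finite_P) measurable
  also have "\<dots> = (\<integral>\<^sup>+z. ennreal ((max 0 (f z))\<^sup>2 / (2 * p * q)) \<partial>P)"
    using assms by (subst nn_integral_triangle) auto
  finally show ?thesis .
qed

text \<open>The tail bound costs a factor 2, and symmetry of the endpoint returns it: twice the mean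
  square of the positive part is the full mean square. Squares are written through the triangle of
  levels 2 a + b <= f; the coefficients 2 and 1 only fix the factor 4.\<close>

lemma walk_max_sq_le:
  "(\<integral>\<^sup>+z. ennreal ((walk_max N z)\<^sup>2) \<partial>P) \<le> (\<integral>\<^sup>+z. ennreal ((psum z N)\<^sup>2) \<partial>P)"
proof -
  have quarter: "(\<integral>\<^sup>+z. ennreal ((max 0 (f z))\<^sup>2) \<partial>P)
     = 4 * (\<integral>\<^sup>+a. \<integral>\<^sup>+b. of_bool (0 < a \<and> 0 < b) * (\<integral>\<^sup>+z. of_bool (2 * a + 1 * b \<le> f z) \<partial>P) \<partial>lborel \<partial>lborel)"
    if [measurable]: "f \<in> borel_measurable P" for f
  proof -
    have "(\<integral>\<^sup>+z. ennreal ((max 0 (f z))\<^sup>2) \<partial>P) = (\<integral>\<^sup>+z. ennreal 4 * ennreal ((max 0 (f z))\<^sup>2 / (2 * 2 * 1)) \<partial>P)"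
      by (intro nn_integral_cong) (subst ennreal_mult[symmetric], auto)
    also have "\<dots> = ennreal 4 * (\<integral>\<^sup>+z. ennreal ((max 0 (f z))\<^sup>2 / (2 * 2 * 1)) \<partial>P)"
      by (intro nn_integral_cmult) measurable
    finally show ?thesis
      by (subst nn_integral_triangle_walk) auto
  qed
  have "(\<integral>\<^sup>+z. ennreal ((walk_max N z)\<^sup>2) \<partial>P) = (\<integral>\<^sup>+z. ennreal ((max 0 (walk_max N z))\<^sup>2) \<partial>P)"
    by (simp add: max_absorb2 walk_max_nonneg)
  also have "\<dots> = 4 * (\<integral>\<^sup>+a. \<integral>\<^sup>+b. of_bool (0 < a \<and> 0 < b) * (\<integral>\<^sup>+z. of_bool (2 * a + 1 * b \<le> walk_max N z) \<partial>P) \<partial>lborel \<partial>lborel)"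
    by (rule quarter) measurable
  also have "\<dots> \<le> 4 * (\<integral>\<^sup>+a. \<integral>\<^sup>+b. of_bool (0 < a \<and> 0 < b) * (2 * (\<integral>\<^sup>+z. of_bool (2 * a + 1 * b \<le> psum z N) \<partial>P)) \<partial>lborel \<partial>lborel)"
  proof (rule mult_left_mono, rule nn_integral_mono, rule nn_integral_mono)
    fix a b :: real
    show "of_bool (0 < a \<and> 0 < b) * (\<integral>\<^sup>+z. of_bool (2 * a + 1 * b \<le> walk_max N z) \<partial>P)
      \<le> of_bool (0 < a \<and> 0 < b) * (2 * (\<integral>\<^sup>+z. of_bool (2 * a + 1 * b \<le> psum z N) \<partial>P))"
      using walk_max_tail_le[of "2 * a + 1 * b"] by (cases "0 < a \<and> 0 < b") auto
  qed simp
  also have "\<dots> = 2 * (4 * (\<integral>\<^sup>+a. \<integral>\<^sup>+b. of_bool (0 < a \<and> 0 < b) * (\<integral>\<^sup>+z. of_bool (2 * a + 1 * b \<le> psum z N) \<partial>P) \<partial>lborel \<partial>lborel))"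
  proof -
    interpret P: sigma_finite_measure P by (rule sigma_finite_P)
    define g where "g = (\<lambda>a b. of_bool (0 < a \<and> 0 < b) * (\<integral>\<^sup>+z. of_bool (2 * a + 1 * b \<le> psum z N) \<partial>P))"
    have [measurable]: "(\<lambda>(a, b). g a b) \<in> borel_measurable (lborel \<Otimes>\<^sub>M lborel)"
      unfolding g_def by measurable
    have "(\<integral>\<^sup>+a. \<integral>\<^sup>+b. 2 * g a b \<partial>lborel \<partial>lborel) = (\<integral>\<^sup>+a. 2 * \<integral>\<^sup>+b. g a b \<partial>lborel \<partial>lborel)"
      by (subst nn_integral_cmult) auto
    also have "\<dots> = 2 * (\<integral>\<^sup>+a. \<integral>\<^sup>+b. g a b \<partial>lborel \<partial>lborel)"
      by (rule nn_integral_cmult) measurable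
    finally show ?thesis unfolding g_def by (simp only: mult.left_commute)
  qed
  also have "\<dots> = 2 * (\<integral>\<^sup>+z. ennreal ((max 0 (psum z N))\<^sup>2) \<partial>P)"
    by (subst quarter) auto
  also have "\<dots> = (\<integral>\<^sup>+z. ennreal ((max 0 (psum z N))\<^sup>2) \<partial>P) + (\<integral>\<^sup>+z. ennreal ((max 0 (- psum z N))\<^sup>2) \<partial>P)"
  proof -
    have "(\<integral>\<^sup>+z. ennreal ((max 0 (psum (\<lambda>i. - z i) N))\<^sup>2) \<partial>P) = (\<integral>\<^sup>+z. ennreal ((max 0 (psum z N))\<^sup>2) \<partial>P)"
    proof (rule nn_integral_uminus)
      show "ennreal ((max 0 (psum z N))\<^sup>2) = ennreal ((max 0 (psum \<eta> N))\<^sup>2)"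
        if "\<And>i. i < N \<Longrightarrow> z i = \<eta> i" for z \<eta>
        using psum_cong[OF that] by simp
    qed measurable
    then show ?thesis by (simp add: psum_uminus mult_2)
  qed
  also have "\<dots> = (\<integral>\<^sup>+z. ennreal ((max 0 (psum z N))\<^sup>2) + ennreal ((max 0 (- psum z N))\<^sup>2) \<partial>P)"
    by (intro nn_integral_add[symmetric]) measurable
  also have "\<dots> = (\<integral>\<^sup>+z. ennreal ((psum z N)\<^sup>2) \<partial>P)"
    by (intro nn_integral_cong) (auto simp: max_def)
  finally show ?thesis .
qed

text \<open>\<open>both_levels_alternating\<close> integrated over all a, b > 0. The n-th level is a
  + (n-1) (a+b) = n a + (n-1) b, whose triangle contributes the square over 2 n (n-1); exchanging a
  and b gives the factor 2. Even n stand on the right, odd n with their overshoot on the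
  left.\<close>

lemma walk_max_product_le:
  "(\<integral>\<^sup>+z. ennreal (walk_max N z * walk_max N (\<lambda>i. - z i)) \<partial>P)
   + (\<Sum>k<K. 2 * (\<integral>\<^sup>+z. ennreal ((max 0 (walk_max N z - 2 * real (2*k+3) * step_bound N z))\<^sup>2 / (2 * real (2*k+3) * real (2*k+2))) \<partial>P))
  \<le> (\<Sum>k<Suc K. 2 * (\<integral>\<^sup>+z. ennreal ((walk_max N z)\<^sup>2 / (2 * real (2*k+2) * real (2*k+1))) \<partial>P))"
proof -
  interpret P: sigma_finite_measure P by (rule sigma_finite_P)
  define I where "I = (\<lambda>f :: real \<Rightarrow> real \<Rightarrow> ennreal. (\<integral>\<^sup>+a. \<integral>\<^sup>+b. of_bool (0 < a \<and> 0 < b) * f a b \<partial>lborel \<partial>lborel) :: ennreal)"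
  define Q where "Q = (\<lambda>n d a b. (\<integral>\<^sup>+z. of_bool (real n * a + (real n - 1) * b \<le> walk_max N z - d * step_bound N z) \<partial>P))"
  have tri: "I (\<lambda>a b. Q n d a b) = (\<integral>\<^sup>+z. ennreal ((max 0 (walk_max N z - d * step_bound N z))\<^sup>2 / (2 * real n * (real n - 1))) \<partial>P)"
    and tri': "I (\<lambda>a b. Q n d b a) = (\<integral>\<^sup>+z. ennreal ((max 0 (walk_max N z - d * step_bound N z))\<^sup>2 / (2 * real n * (real n - 1))) \<partial>P)"
    if "2 \<le> n" for n d
    using nn_integral_triangle_walk[of "\<lambda>z. walk_max N z - d * step_bound N z" "real n" "real n - 1"]
      nn_integral_triangle_walk[of "\<lambda>z. walk_max N z - d * step_bound N z" "real n - 1" "real n"] that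
    by (simp_all add: I_def Q_def ac_simps)
  have [measurable]: "(\<lambda>(a, b). Q n d a b) \<in> borel_measurable (lborel \<Otimes>\<^sub>M lborel)" for n d
    unfolding Q_def by measurable
  have I_add: "I (\<lambda>a b. f a b + g a b) = I f + I g"
    if [measurable]: "(\<lambda>(a, b). f a b) \<in> borel_measurable (lborel \<Otimes>\<^sub>M lborel)" "(\<lambda>(a, b). g a b) \<in> borel_measurable (lborel \<Otimes>\<^sub>M lborel)" for f g
    unfolding I_def by (simp add: distrib_left nn_integral_add)
  have I_sum: "I (\<lambda>a b. \<Sum>k<(m::nat). f k a b) = (\<Sum>k<m. I (f k))"
    if [measurable]: "\<And>k. (\<lambda>(a, b). f k a b) \<in> borel_measurable (lborel \<Otimes>\<^sub>M lborel)" for f m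
    unfolding I_def by (simp add: sum_distrib_left nn_integral_sum del: sum_of_bool_mult_eq)
  have I_mono: "I f \<le> I g" if "\<And>a b. 0 < a \<Longrightarrow> 0 < b \<Longrightarrow> f a b \<le> g a b" for f g
    unfolding I_def by (intro nn_integral_mono) (use that in auto)
  define R where "R = (\<lambda>a b. (\<integral>\<^sup>+z. of_bool (a \<le> walk_max N z \<and> b \<le> walk_max N (\<lambda>i. - z i)) \<partial>P))"
  have [measurable]: "(\<lambda>(a, b). R a b) \<in> borel_measurable (lborel \<Otimes>\<^sub>M lborel)"
    unfolding R_def by measurable
  have IR: "I R = (\<integral>\<^sup>+z. ennreal (walk_max N z * walk_max N (\<lambda>i. - z i)) \<partial>P)"
  proof -
    have "I R = (\<integral>\<^sup>+a. \<integral>\<^sup>+b. \<integral>\<^sup>+z. of_bool (0 < a \<and> 0 < b) * of_bool (a \<le> walk_max N z \<and> b \<le> walk_max N (\<lambda>i. - z i)) \<partial>P \<partial>lborel \<partial>lborel)"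
      unfolding I_def R_def by (subst nn_integral_cmult) auto
    also have "\<dots> = (\<integral>\<^sup>+z. \<integral>\<^sup>+a. \<integral>\<^sup>+b. of_bool (0 < a \<and> 0 < b) * of_bool (a \<le> walk_max N z \<and> b \<le> walk_max N (\<lambda>i. - z i)) \<partial>lborel \<partial>lborel \<partial>P)"
      by (intro nn_integral_rotate3 sigma_finite_P) measurable
    finally show ?thesis by (simp add: nn_integral_rectangle walk_max_nonneg)
  qed
  have Qa: "Q n d a b = (\<integral>\<^sup>+z. of_bool (a + (real n - 1) * (a + b) + d * step_bound N z \<le> walk_max N z) \<partial>P)" for n d a b
    unfolding Q_def by (intro nn_integral_cong arg_cong[where f=of_bool]) (auto simp: algebra_simps)
  have Qb: "Q n d b a = (\<integral>\<^sup>+z. of_bool (b + (real n - 1) * (a + b) + d * step_bound N z \<le> walk_max N z) \<partial>P)" for n d a b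
    unfolding Qa by (simp only: add.commute[of a b])
  define U where "U = (\<lambda>a b. \<Sum>k<K. Q (2*k+3) (2 * real (2*k+3)) a b + Q (2*k+3) (2 * real (2*k+3)) b a)"
  define V where "V = (\<lambda>a b. \<Sum>k<Suc K. Q (2*k+2) 0 a b + Q (2*k+2) 0 b a)"
  have [measurable]: "(\<lambda>(a, b). Q n d b a) \<in> borel_measurable (lborel \<Otimes>\<^sub>M lborel)" for n d
    unfolding Q_def by measurable
  have [measurable]: "(\<lambda>(a, b). U a b) \<in> borel_measurable (lborel \<Otimes>\<^sub>M lborel)"
    unfolding U_def by measurable
  have "I R + I U = I (\<lambda>a b. R a b + U a b)"
    by (rule I_add[symmetric]) measurable
  also have "\<dots> \<le> I V"
  proof (rule I_mono)
    fix a b :: real assume "0 < a" "0 < b"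
    from both_levels_alternating[OF this, of K]
    show "R a b + U a b \<le> V a b"
      unfolding R_def U_def V_def Qa[of _ _ a b] Qb[of _ _ b a] mult_zero_left add_0_right .
  qed
  finally have "I R + I U \<le> I V" .
  moreover have "I U = (\<Sum>k<K. 2 * (\<integral>\<^sup>+z. ennreal ((max 0 (walk_max N z - 2 * real (2*k+3) * step_bound N z))\<^sup>2 / (2 * real (2*k+3) * real (2*k+2))) \<partial>P))"
  proof -
    have t: "I (\<lambda>a b. Q (2*k+3) d a b) = (\<integral>\<^sup>+z. ennreal ((max 0 (walk_max N z - d * step_bound N z))\<^sup>2 / (2 * real (2*k+3) * real (2*k+2))) \<partial>P)"
      "I (\<lambda>a b. Q (2*k+3) d b a) = (\<integral>\<^sup>+z. ennreal ((max 0 (walk_max N z - d * step_bound N z))\<^sup>2 / (2 * real (2*k+3) * real (2*k+2))) \<partial>P)" for k d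
    proof -
      have "real (2*k+3) - 1 = real (2*k+2)" by simp
      then show "I (\<lambda>a b. Q (2*k+3) d a b) = (\<integral>\<^sup>+z. ennreal ((max 0 (walk_max N z - d * step_bound N z))\<^sup>2 / (2 * real (2*k+3) * real (2*k+2))) \<partial>P)"
      "I (\<lambda>a b. Q (2*k+3) d b a) = (\<integral>\<^sup>+z. ennreal ((max 0 (walk_max N z - d * step_bound N z))\<^sup>2 / (2 * real (2*k+3) * real (2*k+2))) \<partial>P)"
        using tri[of "2*k+3" d] tri'[of "2*k+3" d] by simp_all
    qed
    have "I U = (\<Sum>k<K. I (\<lambda>a b. Q (2*k+3) (2 * real (2*k+3)) a b + Q (2*k+3) (2 * real (2*k+3)) b a))"
      unfolding U_def by (intro I_sum) measurable
    also have "\<dots> = (\<Sum>k<K. I (\<lambda>a b. Q (2*k+3) (2 * real (2*k+3)) a b) + I (\<lambda>a b. Q (2*k+3) (2 * real (2*k+3)) b a))"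
      by (intro sum.cong refl I_add) measurable
    finally show ?thesis by (simp only: t mult_2[where 'a=ennreal])
  qed
  moreover have "I V = (\<Sum>k<Suc K. 2 * (\<integral>\<^sup>+z. ennreal ((walk_max N z)\<^sup>2 / (2 * real (2*k+2) * real (2*k+1))) \<partial>P))"
  proof -
    have t: "I (\<lambda>a b. Q (2*k+2) 0 a b) = (\<integral>\<^sup>+z. ennreal ((walk_max N z)\<^sup>2 / (2 * real (2*k+2) * real (2*k+1))) \<partial>P)"
      "I (\<lambda>a b. Q (2*k+2) 0 b a) = (\<integral>\<^sup>+z. ennreal ((walk_max N z)\<^sup>2 / (2 * real (2*k+2) * real (2*k+1))) \<partial>P)" for k
      using tri[of "2*k+2" 0] tri'[of "2*k+2" 0] by (simp_all add: max_absorb2 walk_max_nonneg)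
    have "I V = (\<Sum>k<Suc K. I (\<lambda>a b. Q (2*k+2) 0 a b + Q (2*k+2) 0 b a))"
      unfolding V_def by (intro I_sum) measurable
    also have "\<dots> = (\<Sum>k<Suc K. I (\<lambda>a b. Q (2*k+2) 0 a b) + I (\<lambda>a b. Q (2*k+2) 0 b a))"
      by (intro sum.cong refl I_add) measurable
    finally show ?thesis by (simp only: t mult_2[where 'a=ennreal])
  qed
  ultimately show ?thesis unfolding IR by simp
qed

end

text \<open>For d = 0 the admissible levels form the intervals (0, (u-w)/2) and ((u+w)/2, u), of
  total length u - w. The overshoot margins remove d from the first and d + 2 d from the second,
  hence the 4 d.\<close>

lemma nn_integral_reflected_levels:
  fixes u w d :: real
  assumes "0 \<le> w" "0 \<le> d"
  shows "ennreal (max 0 (u - w))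
    \<le> (\<integral>\<^sup>+a. of_bool (0 < a) * of_bool (a + 2 * d < u \<and> w + 2 * d < \<bar>2 * a - u\<bar>) \<partial>lborel) + 4 * ennreal d"
proof (cases "u - w \<le> 4 * d")
  case True
  then have "ennreal (max 0 (u - w)) \<le> ennreal (4 * d)"
    using assms by (intro ennreal_leI) auto
  also have "\<dots> = 4 * ennreal d" using assms by (simp add: ennreal_mult)
  finally show ?thesis by (rule add_increasing[OF zero_le])
next
  case False
  define A where "A = {0<..<u/2 - w/2 - d}"
  define B where "B = {u/2 + w/2 + d<..<u - 2*d}"
  define x where "x = u/2 - w/2 - d"
  \<comment> \<open>The length of the second interval; it can be negative although u - w > 4 d,
    hence max 0 y below.\<close>
  define y where "y = u/2 - w/2 - 3 * d"
  have x: "0 \<le> x" using assms False unfolding x_def by linarith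
  have "u - w - 4 * d \<le> x + max 0 y" unfolding x_def y_def by linarith
  then have "ennreal (u - w - 4 * d) \<le> ennreal (x + max 0 y)" by (rule ennreal_leI)
  also have "\<dots> = ennreal x + ennreal (max 0 y)" using x by (intro ennreal_plus) auto
  also have "\<dots> \<le> emeasure lborel A + emeasure lborel B"
  proof (rule add_mono)
    show "ennreal x \<le> emeasure lborel A" using x unfolding A_def x_def[symmetric] by simp
    show "ennreal (max 0 y) \<le> emeasure lborel B"
    proof (cases "0 \<le> y")
      case True
      then have "emeasure lborel B = ennreal (u - 2 * d - (u/2 + w/2 + d))"
        unfolding B_def y_def by (intro emeasure_lborel_Ioo) linarith
      also have "u - 2 * d - (u/2 + w/2 + d) = y" by (simp add: y_def field_simps)
      finally show ?thesis using True by simp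
    qed simp
  qed
  also have "\<dots> = emeasure lborel (A \<union> B)"
    using assms by (intro plus_emeasure) (auto simp: A_def B_def)
  also have "\<dots> = (\<integral>\<^sup>+a. indicator (A \<union> B) a \<partial>lborel)"
    by (simp add: A_def B_def)
  also have "\<dots> \<le> (\<integral>\<^sup>+a. of_bool (0 < a) * of_bool (a + 2 * d < u \<and> w + 2 * d < \<bar>2 * a - u\<bar>) \<partial>lborel)"
  proof (rule nn_integral_mono)
    fix a
    show "indicator (A \<union> B) a \<le> (of_bool (0 < a) * of_bool (a + 2 * d < u \<and> w + 2 * d < \<bar>2 * a - u\<bar>) :: ennreal)"
    proof (cases "a \<in> A \<union> B")
      case True
      then have "0 < a \<and> a + 2 * d < u \<and> w + 2 * d < \<bar>2 * a - u\<bar>"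
        using assms False unfolding A_def B_def by (auto simp: abs_if)
      then show ?thesis by (simp add: indicator_def)
    qed simp
  qed
  finally have *: "ennreal (u - w - 4 * d) \<le> \<dots>" .
  have "ennreal (max 0 (u - w)) = ennreal (u - w - 4 * d) + 4 * ennreal d"
  proof -
    have "4 * ennreal d = ennreal (4 * d)" using assms by (simp add: ennreal_mult)
    moreover have "ennreal (u - w) = ennreal (u - w - 4 * d) + ennreal (4 * d)"
      using assms False by (subst ennreal_plus[symmetric]) simp_all
    moreover have "max 0 (u - w) = u - w" using assms False by simp
    ultimately show ?thesis by simp
  qed
  then show ?thesis using add_right_mono[OF *] by simp
qed

section \<open>Lower bounds for the range through the endpoint\<close>

context symmetric_walk
begin

text \<open>The paths hitting a split by their endpoint. Those ending below a include the
  reflections of paths ending well above a; their endpoint is 2 a minus the old one, up to two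
  steps. The margins 2 d in the second event ensure that the reflected endpoint is below a and still
  exceeds w in absolute value.\<close>

lemma walk_max_reflection_ge:
  assumes "0 < a" "0 \<le> w"
  shows "(\<integral>\<^sup>+z. of_bool (a \<le> psum z N \<and> w < \<bar>psum z N\<bar>) \<partial>P)
      + (\<integral>\<^sup>+z. of_bool (a + 2 * step_bound N z < psum z N \<and> w + 2 * step_bound N z < \<bar>2 * a - psum z N\<bar>) \<partial>P)
    \<le> (\<integral>\<^sup>+z. of_bool (a \<le> walk_max N z \<and> w < \<bar>psum z N\<bar>) \<partial>P)"
proof -
  define T where "T = flip (\<lambda>j z. \<exists>i\<le>j. a \<le> psum z i)"
  define g where "g = (\<lambda>z. of_bool (a \<le> walk_max N z \<and> psum z N < a \<and> w < \<bar>psum z N\<bar>) :: ennreal)"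
  have g[measurable]: "g \<in> borel_measurable P" unfolding g_def by measurable
  have le: "of_bool (a + 2 * step_bound N z < psum z N \<and> w + 2 * step_bound N z < \<bar>2 * a - psum z N\<bar>) \<le> g (T z)" for z
  proof (cases "a + 2 * step_bound N z < psum z N \<and> w + 2 * step_bound N z < \<bar>2 * a - psum z N\<bar>")
    case True
    have "a \<le> psum z N" using True step_bound_nonneg[of N z] by linarith
    then have hit: "\<exists>i\<le>N. a \<le> psum z i" by blast
    note f = flip_hit(1,2,4)[OF \<open>0 < a\<close> order_refl hit, folded T_def]
    have "a \<le> walk_max N (T z)" using f(3) unfolding le_walk_max_iff .
    moreover have "psum (T z) N < a" using f(2) True by linarith
    moreover have "w < \<bar>psum (T z) N\<bar>" using f(1,2) True by linarith
    ultimately show ?thesis by (simp add: g_def)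
  next
    case False
    then have "of_bool (a + 2 * step_bound N z < psum z N \<and> w + 2 * step_bound N z < \<bar>2 * a - psum z N\<bar>) = (0::ennreal)"
      by (simp only: of_bool_def if_False)
    then show ?thesis by (simp only: zero_le)
  qed
  have "integral\<^sup>N P g = (\<integral>\<^sup>+z. g (T z) \<partial>P)" unfolding T_def
  proof (rule nn_integral_flip_hit[symmetric, OF g])
    show "g z = g \<eta>" if "\<And>i. i < N \<Longrightarrow> z i = \<eta> i" for z \<eta>
      using psum_cong[OF that] walk_max_cong[OF that] by (simp add: g_def)
  qed
  then have "(\<integral>\<^sup>+z. of_bool (a + 2 * step_bound N z < psum z N \<and> w + 2 * step_bound N z < \<bar>2 * a - psum z N\<bar>) \<partial>P)
     \<le> integral\<^sup>N P g"
    using le by (auto intro: nn_integral_mono)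
  then have "(\<integral>\<^sup>+z. of_bool (a \<le> psum z N \<and> w < \<bar>psum z N\<bar>) \<partial>P)
      + (\<integral>\<^sup>+z. of_bool (a + 2 * step_bound N z < psum z N \<and> w + 2 * step_bound N z < \<bar>2 * a - psum z N\<bar>) \<partial>P)
    \<le> (\<integral>\<^sup>+z. of_bool (a \<le> psum z N \<and> w < \<bar>psum z N\<bar>) \<partial>P) + integral\<^sup>N P g"
    by (rule add_left_mono)
  also have "\<dots> = (\<integral>\<^sup>+z. of_bool (a \<le> psum z N \<and> w < \<bar>psum z N\<bar>) + g z \<partial>P)"
    by (intro nn_integral_add[symmetric]) measurable
  also have "\<dots> \<le> (\<integral>\<^sup>+z. of_bool (a \<le> walk_max N z \<and> w < \<bar>psum z N\<bar>) \<partial>P)"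
  proof (rule nn_integral_mono)
    fix z
    have "psum z N \<le> walk_max N z" by (rule walk_max_ge) simp
    then show "of_bool (a \<le> psum z N \<and> w < \<bar>psum z N\<bar>) + g z \<le> of_bool (a \<le> walk_max N z \<and> w < \<bar>psum z N\<bar>)"
      by (auto simp: g_def)
  qed
  finally show ?thesis .
qed

lemma nn_integral_levels:
  assumes [measurable]: "f \<in> borel_measurable P" "Measurable.pred P Q"
  shows "(\<integral>\<^sup>+a. of_bool (0 < a) * (\<integral>\<^sup>+z. of_bool (a \<le> f z \<and> Q z) \<partial>P) \<partial>lborel)
     = (\<integral>\<^sup>+z. ennreal (max 0 (f z) * of_bool (Q z)) \<partial>P)"
proof -
  interpret P: sigma_finite_measure P by (rule sigma_finite_P)
  interpret pair_sigma_finite P lborel ..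
  have "(\<integral>\<^sup>+a. of_bool (0 < a) * (\<integral>\<^sup>+z. of_bool (a \<le> f z \<and> Q z) \<partial>P) \<partial>lborel)
    = (\<integral>\<^sup>+a. \<integral>\<^sup>+z. of_bool (0 < a) * of_bool (a \<le> f z \<and> Q z) \<partial>P \<partial>lborel)"
    by (subst nn_integral_cmult) auto
  also have "\<dots> = (\<integral>\<^sup>+z. \<integral>\<^sup>+a. of_bool (0 < a) * of_bool (a \<le> f z \<and> Q z) \<partial>lborel \<partial>P)"
    by (intro Fubini') measurable
  also have "\<dots> = (\<integral>\<^sup>+z. of_bool (Q z) * (\<integral>\<^sup>+a. of_bool (0 < a \<and> a \<le> f z) \<partial>lborel) \<partial>P)"
    by (subst nn_integral_cmult[symmetric]) (auto intro!: nn_integral_cong)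
  also have "\<dots> = (\<integral>\<^sup>+z. ennreal (max 0 (f z) * of_bool (Q z)) \<partial>P)"
    unfolding nn_integral_interval by (intro nn_integral_cong) auto
  finally show ?thesis .
qed

text \<open>Integration over the levels a: the unreflected part returns the positive part of the
  endpoint on the event, and the reflected levels have length (S - w)^+ up to 4 steps, S being the
  endpoint.\<close>

lemma walk_max_ge_endpoint:
  assumes "0 \<le> w"
  shows "(\<integral>\<^sup>+z. ennreal (max 0 (psum z N) * of_bool (w < \<bar>psum z N\<bar>)) \<partial>P) + (\<integral>\<^sup>+z. ennreal (max 0 (psum z N - w)) \<partial>P)
    \<le> (\<integral>\<^sup>+z. ennreal (walk_max N z * of_bool (w < \<bar>psum z N\<bar>)) \<partial>P) + 4 * (\<integral>\<^sup>+z. ennreal (step_bound N z) \<partial>P)"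
proof -
  interpret P: sigma_finite_measure P by (rule sigma_finite_P)
  interpret pair_sigma_finite P lborel ..
  let ?r = "\<lambda>a z. a + 2 * step_bound N z < psum z N \<and> w + 2 * step_bound N z < \<bar>2 * a - psum z N\<bar>"
  have "(\<integral>\<^sup>+z. ennreal (max 0 (psum z N - w)) \<partial>P)
     \<le> (\<integral>\<^sup>+z. (\<integral>\<^sup>+a. of_bool (0 < a) * of_bool (?r a z) \<partial>lborel) + 4 * ennreal (step_bound N z) \<partial>P)"
    by (intro nn_integral_mono nn_integral_reflected_levels assms step_bound_nonneg)
  also have "\<dots> = (\<integral>\<^sup>+z. \<integral>\<^sup>+a. of_bool (0 < a) * of_bool (?r a z) \<partial>lborel \<partial>P) + 4 * (\<integral>\<^sup>+z. ennreal (step_bound N z) \<partial>P)"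
    by (subst nn_integral_add) (auto simp: nn_integral_cmult)
  also have "(\<integral>\<^sup>+z. \<integral>\<^sup>+a. of_bool (0 < a) * of_bool (?r a z) \<partial>lborel \<partial>P)
      = (\<integral>\<^sup>+a. \<integral>\<^sup>+z. of_bool (0 < a) * of_bool (?r a z) \<partial>P \<partial>lborel)"
    by (intro Fubini'[symmetric]) measurable
  also have "\<dots> = (\<integral>\<^sup>+a. of_bool (0 < a) * (\<integral>\<^sup>+z. of_bool (?r a z) \<partial>P) \<partial>lborel)"
    by (subst nn_integral_cmult) auto
  finally have 1: "(\<integral>\<^sup>+z. ennreal (max 0 (psum z N - w)) \<partial>P)
     \<le> (\<integral>\<^sup>+a. of_bool (0 < a) * (\<integral>\<^sup>+z. of_bool (?r a z) \<partial>P) \<partial>lborel) + 4 * (\<integral>\<^sup>+z. ennreal (step_bound N z) \<partial>P)" .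
  have "(\<integral>\<^sup>+z. ennreal (max 0 (psum z N) * of_bool (w < \<bar>psum z N\<bar>)) \<partial>P)
      + (\<integral>\<^sup>+a. of_bool (0 < a) * (\<integral>\<^sup>+z. of_bool (?r a z) \<partial>P) \<partial>lborel)
     = (\<integral>\<^sup>+a. of_bool (0 < a) * (\<integral>\<^sup>+z. of_bool (a \<le> psum z N \<and> w < \<bar>psum z N\<bar>) \<partial>P)
        + of_bool (0 < a) * (\<integral>\<^sup>+z. of_bool (?r a z) \<partial>P) \<partial>lborel)"
    by (subst nn_integral_levels[symmetric], measurable, intro nn_integral_add[symmetric]) measurable
  also have "\<dots> \<le> (\<integral>\<^sup>+a. of_bool (0 < a) * (\<integral>\<^sup>+z. of_bool (a \<le> walk_max N z \<and> w < \<bar>psum z N\<bar>) \<partial>P) \<partial>lborel)"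
  proof (rule nn_integral_mono)
    fix a :: real
    show "of_bool (0 < a) * (\<integral>\<^sup>+z. of_bool (a \<le> psum z N \<and> w < \<bar>psum z N\<bar>) \<partial>P)
        + of_bool (0 < a) * (\<integral>\<^sup>+z. of_bool (?r a z) \<partial>P)
        \<le> of_bool (0 < a) * (\<integral>\<^sup>+z. of_bool (a \<le> walk_max N z \<and> w < \<bar>psum z N\<bar>) \<partial>P)"
      using walk_max_reflection_ge[of a w] assms by (cases "0 < a") auto
  qed
  also have "\<dots> = (\<integral>\<^sup>+z. ennreal (walk_max N z * of_bool (w < \<bar>psum z N\<bar>)) \<partial>P)"
    by (subst nn_integral_levels) (auto simp: max_absorb2 walk_max_nonneg)
  finally have 2: "(\<integral>\<^sup>+z. ennreal (max 0 (psum z N) * of_bool (w < \<bar>psum z N\<bar>)) \<partial>P)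
      + (\<integral>\<^sup>+a. of_bool (0 < a) * (\<integral>\<^sup>+z. of_bool (?r a z) \<partial>P) \<partial>lborel)
    \<le> (\<integral>\<^sup>+z. ennreal (walk_max N z * of_bool (w < \<bar>psum z N\<bar>)) \<partial>P)" .
  show ?thesis
    by (rule order_trans[OF add_left_mono[OF 1] order_trans[OF eq_refl[OF add.assoc[symmetric]] add_right_mono[OF 2]]])
qed

lemma walk_range_ge_endpoint:
  assumes "0 \<le> w"
  shows "(\<integral>\<^sup>+z. ennreal (\<bar>psum z N\<bar> * of_bool (w < \<bar>psum z N\<bar>) + max 0 (\<bar>psum z N\<bar> - w)) \<partial>P)
    \<le> (\<integral>\<^sup>+z. ennreal ((walk_max N z + walk_max N (\<lambda>i. - z i)) * of_bool (w < \<bar>psum z N\<bar>)) \<partial>P)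
      + 8 * (\<integral>\<^sup>+z. ennreal (step_bound N z) \<partial>P)"
proof -
  let ?q = "\<lambda>z. of_bool (w < \<bar>psum z N\<bar>) :: real"
  define L where "L = (\<integral>\<^sup>+z. ennreal (max 0 (psum z N) * ?q z) \<partial>P) + (\<integral>\<^sup>+z. ennreal (max 0 (psum z N - w)) \<partial>P)"
  define X where "X = (\<integral>\<^sup>+z. ennreal (walk_max N z * ?q z) \<partial>P)"
  define D where "D = (\<integral>\<^sup>+z. ennreal (step_bound N z) \<partial>P)"
  have LX: "L \<le> X + 4 * D"
    unfolding L_def X_def D_def by (rule walk_max_ge_endpoint[OF assms])
  have m1: "(\<integral>\<^sup>+z. ennreal (max 0 (psum (\<lambda>i. - z i) N) * ?q (\<lambda>i. - z i)) \<partial>P) = (\<integral>\<^sup>+z. ennreal (max 0 (psum z N) * ?q z) \<partial>P)"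
  proof (rule nn_integral_uminus)
    show "ennreal (max 0 (psum z N) * ?q z) = ennreal (max 0 (psum \<eta> N) * ?q \<eta>)"
      if "\<And>i. i < N \<Longrightarrow> z i = \<eta> i" for z \<eta>
      using psum_cong[OF that] by simp
  qed measurable
  have m2: "(\<integral>\<^sup>+z. ennreal (max 0 (psum (\<lambda>i. - z i) N - w)) \<partial>P) = (\<integral>\<^sup>+z. ennreal (max 0 (psum z N - w)) \<partial>P)"
  proof (rule nn_integral_uminus)
    show "ennreal (max 0 (psum z N - w)) = ennreal (max 0 (psum \<eta> N - w))"
      if "\<And>i. i < N \<Longrightarrow> z i = \<eta> i" for z \<eta>
      using psum_cong[OF that] by simp
  qed measurable
  have m3: "(\<integral>\<^sup>+z. ennreal (walk_max N (\<lambda>i. - z i) * ?q (\<lambda>i. - z i)) \<partial>P) = X"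
    unfolding X_def
  proof (rule nn_integral_uminus)
    show "ennreal (walk_max N z * ?q z) = ennreal (walk_max N \<eta> * ?q \<eta>)"
      if "\<And>i. i < N \<Longrightarrow> z i = \<eta> i" for z \<eta>
      using psum_cong[OF that] walk_max_cong[OF that] by simp
  qed measurable
  \<comment> \<open>As w >= 0, at most one of S - w and -S - w is positive, so both summands split
    into a part for the walk and the same part for its negative.\<close>
  have "(\<integral>\<^sup>+z. ennreal (\<bar>psum z N\<bar> * ?q z + max 0 (\<bar>psum z N\<bar> - w)) \<partial>P)
    = (\<integral>\<^sup>+z. (ennreal (max 0 (psum z N) * ?q z) + ennreal (max 0 (psum z N - w)))
       + (ennreal (max 0 (- psum z N) * ?q z) + ennreal (max 0 (- psum z N - w))) \<partial>P)"
    using assms by (intro nn_integral_cong) (auto simp: max_def abs_if simp flip: ennreal_plus)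
  also have "\<dots> = L + L"
    using m1 m2 unfolding L_def by (simp add: nn_integral_add psum_uminus)
  also have "\<dots> \<le> (X + 4 * D) + (X + 4 * D)" by (intro add_mono LX)
  also have "\<dots> = (X + X) + 8 * D"
  proof -
    have "8 * D = 4 * D + 4 * D" using distrib_right[of 4 4 D] by simp
    then show ?thesis by (simp only: ac_simps)
  qed
  also have "X + X = (\<integral>\<^sup>+z. ennreal ((walk_max N z + walk_max N (\<lambda>i. - z i)) * ?q z) \<partial>P)"
  proof -
    have "X + X = (\<integral>\<^sup>+z. ennreal (walk_max N z * ?q z) + ennreal (walk_max N (\<lambda>i. - z i) * ?q z) \<partial>P)"
      using m3 by (subst nn_integral_add) (auto simp: X_def psum_uminus)
    then show ?thesis
      by (simp add: distrib_right walk_max_nonneg flip: ennreal_plus)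
  qed
  finally show ?thesis unfolding D_def .
qed

end

section \<open>Walks with normal steps\<close>

definition step_normal :: "nat \<Rightarrow> real measure" where
  "step_normal N = density lborel (\<lambda>x. ennreal (normal_density 0 (sqrt (1 / real N)) x))"

abbreviation normal_steps :: "nat \<Rightarrow> (nat \<Rightarrow> real) measure" where
  "normal_steps N \<equiv> PiM {..<N} (\<lambda>_. step_normal N)"

lemma symmetric_walk_step_normal:
  assumes "0 < N" shows "symmetric_walk (step_normal N)"
proof (rule symmetric_walk.intro)
  show "prob_space (step_normal N)"
    unfolding step_normal_def using assms by (intro prob_space_normal_density) simp
  show sets: "sets (step_normal N) = sets borel" by (simp add: step_normal_def)
  have um[measurable]: "uminus \<in> step_normal N \<rightarrow>\<^sub>M borel"
    by (simp add: step_normal_def)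
  show "distr (step_normal N) borel uminus = step_normal N"
  proof (rule measure_eqI)
    fix X assume "X \<in> sets (distr (step_normal N) borel uminus)"
    then have X[measurable]: "X \<in> sets borel" by simp
    have "emeasure (distr (step_normal N) borel uminus) X = (\<integral>\<^sup>+x. indicator X (- x) \<partial>step_normal N)"
      using nn_integral_distr[OF um, of "indicator X"] by simp
    also have "\<dots> = (\<integral>\<^sup>+x. ennreal (normal_density 0 (sqrt (1 / real N)) x) * indicator X (- x) \<partial>lborel)"
      unfolding step_normal_def by (subst nn_integral_density) auto
    also have "\<dots> = (\<integral>\<^sup>+x. ennreal (normal_density 0 (sqrt (1 / real N)) x) * indicator X x \<partial>lborel)"
      by (subst nn_integral_real_affine[where c = "-1" and t = 0]) (auto simp: normal_density_def)
    also have "\<dots> = emeasure (step_normal N) X"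
      unfolding step_normal_def by (subst emeasure_density) auto
    finally show "emeasure (distr (step_normal N) borel uminus) X = emeasure (step_normal N) X" .
  qed (simp add: sets)
qed

lemma nn_integral_normal_fourth_moment:
  assumes "0 < \<sigma>"
  shows "(\<integral>\<^sup>+x. ennreal (x ^ 4) \<partial>density lborel (\<lambda>x. ennreal (normal_density 0 \<sigma> x))) = ennreal (3 * \<sigma> ^ 4)"
proof -
  have "has_bochner_integral lborel (\<lambda>x. normal_density 0 \<sigma> x * x ^ 4) (3 * \<sigma> ^ 4)"
    using normal_moment_even[OF assms, of 0 2] by (simp add: fact_numeral power_divide field_simps)
  then have "(\<integral>\<^sup>+x. ennreal (normal_density 0 \<sigma> x * x ^ 4) \<partial>lborel) = ennreal (3 * \<sigma> ^ 4)"
    by (subst nn_integral_eq_integral) (auto simp: has_bochner_integral_iff)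
  moreover have "(\<integral>\<^sup>+x. ennreal (x ^ 4) \<partial>density lborel (\<lambda>x. ennreal (normal_density 0 \<sigma> x)))
     = (\<integral>\<^sup>+x. ennreal (normal_density 0 \<sigma> x * x ^ 4) \<partial>lborel)"
    by (subst nn_integral_density) (auto simp: ennreal_mult)
  ultimately show ?thesis by simp
qed

lemma nn_integral_std_normal_sq:
  "(\<integral>\<^sup>+x. ennreal (x\<^sup>2) \<partial>density lborel std_normal_density) = 1"
proof -
  have "has_bochner_integral lborel (\<lambda>x. std_normal_density x * x\<^sup>2) 1"
    using normal_moment_even[of 1 0 1] by simp
  then have "(\<integral>\<^sup>+x. ennreal (std_normal_density x * x\<^sup>2) \<partial>lborel) = ennreal 1"
    by (subst nn_integral_eq_integral) (auto simp: has_bochner_integral_iff)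
  then show ?thesis
    by (subst nn_integral_density) (auto simp: ennreal_mult)
qed

text \<open>Replaces Cauchy-Schwarz: if the mean of x^2 is at most \<open>\<eta>\<close>^2,
  integrating yields mean at most \<open>\<eta>\<close> for x.\<close>

lemma le_weighted_sq:
  fixes x \<eta> :: real
  assumes "0 < \<eta>" shows "x \<le> x\<^sup>2 / (2 * \<eta>) + \<eta> / 2"
proof -
  have "0 \<le> (x - \<eta>)\<^sup>2 / (2 * \<eta>)" using assms by simp
  also have "\<dots> = x\<^sup>2 / (2 * \<eta>) + \<eta> / 2 - x" using assms by (simp add: power2_diff field_simps power2_eq_square)
  finally show ?thesis by simp
qed

text \<open>Since \<open>\<Sum>\<^sub>j z\<^sub>j\<^sup>4\<close> has mean \<open>3 / N\<close>, this bounds the mean of the largest step.\<close>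

definition step_error :: "nat \<Rightarrow> real" where
  "step_error N = sqrt (sqrt (3 / real N))"

lemma step_error_tendsto: "step_error \<longlonglongrightarrow> 0"
proof -
  have "(\<lambda>N. 3 / real N) \<longlonglongrightarrow> 0" by (rule lim_const_over_n)
  then have "(\<lambda>N. sqrt (sqrt (3 / real N))) \<longlonglongrightarrow> sqrt (sqrt 0)" by (intro tendsto_intros)
  then show ?thesis by (simp add: step_error_def[abs_def])
qed

lemma integrable_mult_of_squares:
  fixes f g :: "'a \<Rightarrow> real"
  assumes [measurable]: "f \<in> borel_measurable M" "g \<in> borel_measurable M"
    and "integrable M (\<lambda>x. (f x)\<^sup>2)" "integrable M (\<lambda>x. (g x)\<^sup>2)"
  shows "integrable M (\<lambda>x. f x * g x)"
proof (rule Bochner_Integration.integrable_bound)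
  show "integrable M (\<lambda>x. (f x)\<^sup>2 + (g x)\<^sup>2)" using assms by simp
  have "\<bar>a * b\<bar> \<le> a\<^sup>2 + b\<^sup>2" for a b :: real
  proof -
    have "2 * (\<bar>a\<bar> * \<bar>b\<bar>) \<le> a\<^sup>2 + b\<^sup>2" using sum_squares_bound[of "\<bar>a\<bar>" "\<bar>b\<bar>"] by simp
    moreover have "0 \<le> \<bar>a\<bar> * \<bar>b\<bar>" by simp
    ultimately show ?thesis unfolding abs_mult by linarith
  qed
  then show "AE x in M. norm (f x * g x) \<le> norm ((f x)\<^sup>2 + (g x)\<^sup>2)" by (intro AE_I2) simp
qed measurable

text \<open>The partial sum of (-1)^n / (n (n-1)) over n = 2, ..., 2K+2, with even and odd n kept
  apart; the last term is positive.\<close>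

definition alternating_coeff :: "nat \<Rightarrow> real" where
  "alternating_coeff K = (\<Sum>k<Suc K. 1 / (real (2*k+2) * real (2*k+1))) - (\<Sum>k<K. 1 / (real (2*k+3) * real (2*k+2)))"

lemma alternating_coeff_nonneg: "0 \<le> alternating_coeff K"
proof -
  have "(\<Sum>k<K. 1 / (real (2*k+3) * real (2*k+2))) \<le> (\<Sum>k<K. 1 / (real (2*k+2) * real (2*k+1)))"
    by (intro sum_mono divide_left_mono mult_mono) auto
  then show ?thesis by (simp add: alternating_coeff_def add_nonneg_nonneg add_increasing2)
qed

text \<open>Since 1 / (n (n-1)) = 1 / (n-1) - 1 / n, the even terms sum to the alternating harmonic
  series ln 2, and the odd terms to what remains of it after its first term with sign reversed, 1 -
  ln 2.\<close>

lemma alternating_coeff_tendsto: "alternating_coeff \<longlonglongrightarrow> 2 * ln 2 - 1"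
proof -
  have s1: "(\<lambda>k. 1 / real (2*k+1) - 1 / real (2*k+2)) sums ln 2"
    using alternating_harmonic_series_sums' by (simp add: inverse_eq_divide)
  have "(\<lambda>K. \<Sum>k<Suc K. 1 / real (2*k+1) - 1 / real (2*k+2)) \<longlonglongrightarrow> ln 2"
    using s1 unfolding sums_def by (rule LIMSEQ_Suc)
  then have t1: "(\<lambda>K. \<Sum>k<Suc K. 1 / (real (2*k+2) * real (2*k+1))) \<longlonglongrightarrow> ln 2"
    by (rule Lim_transform_eventually) (intro always_eventually allI sum.cong refl, simp add: divide_simps)
  have "(\<Sum>k<K. 1 / (real (2*k+3) * real (2*k+2))) = 1 - (\<Sum>k<K. 1 / real (2*k+1) - 1 / real (2*k+2)) - 1 / real (2*K+1)" for K
  proof (induction K)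
    case (Suc K)
    have "1 / (real (2*K+3) * real (2*K+2)) = 1 / real (2*K+2) - 1 / real (2*K+3)" by (simp add: divide_simps)
    then show ?case using Suc by (simp add: eval_nat_numeral)
  qed simp
  moreover have "(\<lambda>K. 1 - (\<Sum>k<K. 1 / real (2*k+1) - 1 / real (2*k+2)) - 1 / real (2*K+1)) \<longlonglongrightarrow> 1 - ln 2 - 0"
  proof (intro tendsto_diff tendsto_const)
    show "(\<lambda>K. \<Sum>k<K. 1 / real (2*k+1) - 1 / real (2*k+2)) \<longlonglongrightarrow> ln 2"
      using s1 unfolding sums_def .
    have "(\<lambda>K. inverse (real (Suc (2 * K)))) \<longlonglongrightarrow> 0"
      by (rule LIMSEQ_subseq_LIMSEQ[OF LIMSEQ_inverse_real_of_nat, unfolded o_def]) (simp add: strict_mono_def)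
    then show "(\<lambda>K. 1 / real (2*K+1)) \<longlonglongrightarrow> 0" by (simp add: inverse_eq_divide)
  qed
  ultimately have "(\<lambda>K. \<Sum>k<K. 1 / (real (2*k+3) * real (2*k+2))) \<longlonglongrightarrow> 1 - ln 2" by simp
  from tendsto_diff[OF t1 this] show ?thesis by (simp add: alternating_coeff_def[abs_def])
qed

locale normal_walk =
  fixes N :: nat
  assumes N_pos: "0 < N"
begin

sublocale symmetric_walk "step_normal N" N
  by (rule symmetric_walk_step_normal[OF N_pos])

lemma error_pos: "0 < step_error N"
  using N_pos by (simp add: step_error_def)

lemma nn_integral_sum4: "(\<integral>\<^sup>+z. ennreal (\<Sum>j<N. z j ^ 4) \<partial>P) = ennreal (3 / N)"
proof -
  interpret A: prob_space "step_normal N" by (rule prob_A)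
  interpret product_prob_space "\<lambda>_. step_normal N" "{..<N}" ..
  have [measurable]: "(\<lambda>z. z i) \<in> borel_measurable P" if "i \<in> {..<N}" for i
    using measurable_component_singleton[OF that, of "\<lambda>_. step_normal N"]
    by (simp cong: measurable_cong_sets add: sets_A)
  have "(\<integral>\<^sup>+z. ennreal (z j ^ 4) \<partial>P) = ennreal (3 / (real N)\<^sup>2)" if "j < N" for j
  proof -
    have "(\<integral>\<^sup>+z. ennreal (z j ^ 4) \<partial>P) = (\<integral>\<^sup>+x. ennreal (x ^ 4) \<partial>distr P (step_normal N) (\<lambda>z. z j))"
    proof (rule nn_integral_distr[symmetric])
      show "(\<lambda>z. z j) \<in> P \<rightarrow>\<^sub>M step_normal N"
        using that by (intro measurable_component_singleton) simp
      show "(\<lambda>x. ennreal (x ^ 4)) \<in> borel_measurable (distr P (step_normal N) (\<lambda>z. z j))"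
        by (simp add: step_normal_def)
    qed
    also have "distr P (step_normal N) (\<lambda>z. z j) = step_normal N"
      using that by (intro PiM_component) auto
    also have "(\<integral>\<^sup>+x. ennreal (x ^ 4) \<partial>step_normal N) = ennreal (3 * sqrt (1 / real N) ^ 4)"
      unfolding step_normal_def using N_pos by (intro nn_integral_normal_fourth_moment) simp
    also have "sqrt (1 / real N) ^ 4 = 1 / (real N)\<^sup>2"
    proof -
      have "sqrt (1 / real N) ^ 4 = ((sqrt (1 / real N))\<^sup>2)\<^sup>2" by (simp only: power_mult[symmetric]) simp
      also have "(sqrt (1 / real N))\<^sup>2 = 1 / real N" by simp
      finally show ?thesis by (simp add: power_divide)
    qed
    finally show ?thesis by simp
  qed
  then have "(\<Sum>j<N. \<integral>\<^sup>+z. ennreal (z j ^ 4) \<partial>P) = (\<Sum>j<N. ennreal (3 / (real N)\<^sup>2))"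
    by (intro sum.cong) auto
  also have "\<dots> = ennreal (\<Sum>j<N. 3 / (real N)\<^sup>2)"
    by (rule sum_ennreal) simp
  also have "(\<Sum>j<N. 3 / (real N)\<^sup>2) = 3 / N" using N_pos by (simp add: power2_eq_square)
  also have "(\<Sum>j<N. \<integral>\<^sup>+z. ennreal (z j ^ 4) \<partial>P) = (\<integral>\<^sup>+z. (\<Sum>j<N. ennreal (z j ^ 4)) \<partial>P)"
    by (intro nn_integral_sum[symmetric]) measurable
  also have "\<dots> = (\<integral>\<^sup>+z. ennreal (\<Sum>j<N. z j ^ 4) \<partial>P)"
    by (intro nn_integral_cong sum_ennreal) simp
  finally show ?thesis .
qed

text \<open>The fourth moment 3 / N is brought down to the second by \<open>le_weighted_sq\<close>
  with weight sqrt (3 / N); the next lemma repeats this to reach the first moment.\<close>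

lemma nn_integral_step_bound_sq: "(\<integral>\<^sup>+z. ennreal ((step_bound N z)\<^sup>2) \<partial>P) \<le> ennreal ((step_error N)\<^sup>2)"
proof -
  interpret P: prob_space P by (rule prob_P)
  define \<eta> where "\<eta> = (step_error N)\<^sup>2"
  have \<eta>: "0 < \<eta>" "\<eta>\<^sup>2 = 3 / N" using N_pos by (auto simp: \<eta>_def step_error_def)
  have [measurable]: "(\<lambda>z. z i) \<in> borel_measurable P" if "i \<in> {..<N}" for i
    using measurable_component_singleton[OF that, of "\<lambda>_. step_normal N"]
    by (simp cong: measurable_cong_sets add: sets_A)
  have "(\<integral>\<^sup>+z. ennreal ((step_bound N z)\<^sup>2) \<partial>P) \<le> (\<integral>\<^sup>+z. ennreal (1 / (2 * \<eta>)) * ennreal (\<Sum>j<N. z j ^ 4) + ennreal (\<eta> / 2) \<partial>P)"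
  proof (rule nn_integral_mono)
    fix z :: "nat \<Rightarrow> real"
    define S where "S = (\<Sum>j<N. z j ^ 4)"
    have S: "0 \<le> S" by (simp add: S_def sum_nonneg)
    have "(step_bound N z)\<^sup>2 \<le> S / (2 * \<eta>) + \<eta> / 2"
      using le_weighted_sq[OF \<eta>(1), of "sqrt S"] S by (simp add: step_bound_def flip: S_def)
    then have "ennreal ((step_bound N z)\<^sup>2) \<le> ennreal (1 / (2 * \<eta>) * S + \<eta> / 2)" by (intro ennreal_leI) simp
    also have "\<dots> = ennreal (1 / (2 * \<eta>)) * ennreal S + ennreal (\<eta> / 2)"
      using S \<eta>(1) by (subst ennreal_plus, simp, simp, subst ennreal_mult) simp_all
    finally show "ennreal ((step_bound N z)\<^sup>2) \<le> ennreal (1 / (2 * \<eta>)) * ennreal (\<Sum>j<N. z j ^ 4) + ennreal (\<eta> / 2)"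
      unfolding S_def .
  qed
  also have "\<dots> = ennreal (1 / (2 * \<eta>)) * (\<integral>\<^sup>+z. ennreal (\<Sum>j<N. z j ^ 4) \<partial>P) + ennreal (\<eta> / 2)"
    by (simp add: nn_integral_add nn_integral_cmult P.emeasure_space_1)
  also have "\<dots> = ennreal (1 / (2 * \<eta>) * \<eta>\<^sup>2 + \<eta> / 2)"
    unfolding nn_integral_sum4 \<eta>(2)[symmetric] using \<eta>(1) by (subst ennreal_mult[symmetric]) (auto simp flip: ennreal_plus)
  also have "1 / (2 * \<eta>) * \<eta>\<^sup>2 + \<eta> / 2 = \<eta>" using \<eta>(1) by (simp add: power2_eq_square)
  finally show ?thesis unfolding \<eta>_def .
qed

lemma nn_integral_step_bound: "(\<integral>\<^sup>+z. ennreal (step_bound N z) \<partial>P) \<le> ennreal (step_error N)"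
proof -
  interpret P: prob_space P by (rule prob_P)
  define \<eta> where "\<eta> = step_error N"
  have \<eta>: "0 < \<eta>" using error_pos by (simp add: \<eta>_def)
  have "(\<integral>\<^sup>+z. ennreal (step_bound N z) \<partial>P) \<le> (\<integral>\<^sup>+z. ennreal (1 / (2 * \<eta>)) * ennreal ((step_bound N z)\<^sup>2) + ennreal (\<eta> / 2) \<partial>P)"
  proof (rule nn_integral_mono)
    fix z :: "nat \<Rightarrow> real"
    have "ennreal (step_bound N z) \<le> ennreal (1 / (2 * \<eta>) * (step_bound N z)\<^sup>2 + \<eta> / 2)"
      using le_weighted_sq[OF \<eta>, of "step_bound N z"] by (intro ennreal_leI) simp
    also have "\<dots> = ennreal (1 / (2 * \<eta>)) * ennreal ((step_bound N z)\<^sup>2) + ennreal (\<eta> / 2)"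
      using \<eta> by (subst ennreal_plus, simp, simp, subst ennreal_mult) simp_all
    finally show "ennreal (step_bound N z) \<le> ennreal (1 / (2 * \<eta>)) * ennreal ((step_bound N z)\<^sup>2) + ennreal (\<eta> / 2)" .
  qed
  also have "\<dots> = ennreal (1 / (2 * \<eta>)) * (\<integral>\<^sup>+z. ennreal ((step_bound N z)\<^sup>2) \<partial>P) + ennreal (\<eta> / 2)"
    by (simp add: nn_integral_add nn_integral_cmult P.emeasure_space_1)
  also have "\<dots> \<le> ennreal (1 / (2 * \<eta>)) * ennreal (\<eta>\<^sup>2) + ennreal (\<eta> / 2)"
    unfolding \<eta>_def by (intro add_mono mult_left_mono nn_integral_step_bound_sq) auto
  also have "\<dots> = ennreal (1 / (2 * \<eta>) * \<eta>\<^sup>2 + \<eta> / 2)"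
    using \<eta> by (subst ennreal_mult[symmetric]) (auto simp flip: ennreal_plus)
  also have "1 / (2 * \<eta>) * \<eta>\<^sup>2 + \<eta> / 2 = \<eta>" using \<eta> by (simp add: power2_eq_square)
  finally show ?thesis unfolding \<eta>_def .
qed

text \<open>The square of the range is expanded: each of the two squares has mean at most 1, and the
  cross term is bounded by \<open>walk_max_product_le\<close>. Once integrability is known the
  argument passes to real integrals, where the odd terms can be subtracted.\<close>

lemma walk_range_sq_le:
  assumes endpoint: "(\<integral>\<^sup>+z. ennreal ((psum z N)\<^sup>2) \<partial>P) \<le> 1"
  shows "(\<integral>\<^sup>+z. ennreal ((walk_max N z + walk_max N (\<lambda>i. - z i))\<^sup>2) \<partial>P)
    \<le> ennreal (2 + 2 * alternating_coeff K + 4 * real K * step_error N)"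
proof -
  interpret P: prob_space P by (rule prob_P)
  define M where "M = walk_max N"
  define M' where "M' = (\<lambda>z. walk_max N (\<lambda>i. - z i))"
  define d where "d = step_bound N"
  have [measurable]: "M \<in> borel_measurable P" "M' \<in> borel_measurable P" "d \<in> borel_measurable P"
    unfolding M_def M'_def d_def by measurable
  have nonneg: "0 \<le> M z" "0 \<le> M' z" "0 \<le> d z" for z
    unfolding M_def M'_def d_def by (auto intro: walk_max_nonneg step_bound_nonneg)
  have M2: "(\<integral>\<^sup>+z. ennreal ((M z)\<^sup>2) \<partial>P) \<le> 1"
    unfolding M_def using walk_max_sq_le endpoint by (rule order_trans)
  have "(\<integral>\<^sup>+z. ennreal ((M' z)\<^sup>2) \<partial>P) = (\<integral>\<^sup>+z. ennreal ((M z)\<^sup>2) \<partial>P)"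
    unfolding M_def M'_def
  proof (rule nn_integral_uminus)
    show "ennreal ((walk_max N z)\<^sup>2) = ennreal ((walk_max N \<eta>)\<^sup>2)" if "\<And>i. i < N \<Longrightarrow> z i = \<eta> i" for z \<eta>
      using walk_max_cong[OF that] by simp
  qed measurable
  with M2 have M'2: "(\<integral>\<^sup>+z. ennreal ((M' z)\<^sup>2) \<partial>P) \<le> 1" by simp
  have d2: "(\<integral>\<^sup>+z. ennreal ((d z)\<^sup>2) \<partial>P) \<le> ennreal ((step_error N)\<^sup>2)"
    unfolding d_def by (rule nn_integral_step_bound_sq)
  have int[simp]: "integrable P (\<lambda>z. (M z)\<^sup>2)" "integrable P (\<lambda>z. (M' z)\<^sup>2)" "integrable P (\<lambda>z. (d z)\<^sup>2)"
    by (intro integrableI_nonneg; use M2 M'2 d2 in \<open>auto simp: less_top[symmetric] top_unique\<close>)+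
  have le1: "(\<integral>z. (M z)\<^sup>2 \<partial>P) \<le> 1" "(\<integral>z. (M' z)\<^sup>2 \<partial>P) \<le> 1" "(\<integral>z. (d z)\<^sup>2 \<partial>P) \<le> (step_error N)\<^sup>2"
    using M2 M'2 d2 by (simp_all add: nn_integral_eq_integral)
  have int2[simp]: "integrable P (\<lambda>z. M z * M' z)" "integrable P (\<lambda>z. M z * d z)"
    by (rule integrable_mult_of_squares; simp)+
  define m where "m = (\<integral>z. (M z)\<^sup>2 \<partial>P)"
  define \<delta> where "\<delta> = (\<integral>z. M z * d z \<partial>P)"
  define r where "r = (\<integral>z. M z * M' z \<partial>P)"
  have m: "0 \<le> m" "m \<le> 1" using le1 by (auto simp: m_def)
  have \<delta>0: "0 \<le> \<delta>" unfolding \<delta>_def using nonneg by (intro integral_nonneg_AE) auto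
  \<comment> \<open>Cauchy-Schwarz in weighted form; the weight e = \<open>step_error N\<close>
    balances the mean of M^2, at most 1, against that of d^2, at most e^2.\<close>
  have \<delta>: "\<delta> \<le> step_error N"
  proof -
    let ?e = "step_error N"
    have "\<delta> \<le> (\<integral>z. ?e / 2 * (M z)\<^sup>2 + 1 / (2 * ?e) * (d z)\<^sup>2 \<partial>P)"
      unfolding \<delta>_def
    proof (rule integral_mono)
      fix z
      have "0 \<le> (?e * M z - d z)\<^sup>2 / (2 * ?e)" using error_pos by simp
      also have "\<dots> = ?e / 2 * (M z)\<^sup>2 + 1 / (2 * ?e) * (d z)\<^sup>2 - M z * d z"
        using error_pos by (simp add: power2_diff field_simps power2_eq_square)
      finally show "M z * d z \<le> ?e / 2 * (M z)\<^sup>2 + 1 / (2 * ?e) * (d z)\<^sup>2" by simp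
    qed simp_all
    also have "\<dots> = ?e / 2 * m + 1 / (2 * ?e) * (\<integral>z. (d z)\<^sup>2 \<partial>P)" by (simp add: m_def)
    also have "\<dots> \<le> ?e / 2 * 1 + 1 / (2 * ?e) * ?e\<^sup>2"
      using error_pos m le1 by (intro add_mono mult_left_mono) auto
    also have "\<dots> = ?e" using error_pos by (simp add: power2_eq_square)
    finally show ?thesis .
  qed
  define g where "g = (\<lambda>k. \<integral>z. (max 0 (M z - 2 * real (2*k+3) * d z))\<^sup>2 / (2 * real (2*k+3) * real (2*k+2)) \<partial>P)"
  have int_trunc[simp]: "integrable P (\<lambda>z. (max 0 (M z - c * d z))\<^sup>2)" if "0 \<le> c" for c
  proof (rule Bochner_Integration.integrable_bound[OF int(1)])
    show "AE z in P. norm ((max 0 (M z - c * d z))\<^sup>2) \<le> norm ((M z)\<^sup>2)"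
    proof (rule AE_I2)
      fix z
      have "0 \<le> c * d z" using that nonneg by simp
      then have "(max 0 (M z - c * d z))\<^sup>2 \<le> (M z)\<^sup>2"
        using nonneg(1)[of z] by (intro power_mono) auto
      then show "norm ((max 0 (M z - c * d z))\<^sup>2) \<le> norm ((M z)\<^sup>2)" by simp
    qed
  qed measurable
  have g_nn: "(\<integral>\<^sup>+z. ennreal ((max 0 (M z - 2 * real (2*k+3) * d z))\<^sup>2 / (2 * real (2*k+3) * real (2*k+2))) \<partial>P) = ennreal (g k)" for k
    unfolding g_def by (intro nn_integral_eq_integral integrable_divide_zero int_trunc) auto
  have g_nonneg: "0 \<le> g k" for k unfolding g_def by (intro integral_nonneg_AE) auto
  \<comment> \<open>Price of the overshoot in one odd term n = 2k+3. The truncated square loses at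
    most 2 c M d with c = 2 n; after division by D = n (n-1) this is 4 / (n-1) times M d, at most 2
    M d as n >= 3.\<close>
  have g_ge: "m / (real (2*k+3) * real (2*k+2)) - 2 * \<delta> \<le> 2 * g k" for k
  proof -
    define c where "c = 2 * real (2*k+3)"
    define D where "D = real (2*k+3) * real (2*k+2)"
    have D: "0 < D" by (simp add: D_def)
    have cD: "2 * c \<le> 2 * D" by (simp add: c_def D_def algebra_simps)
    have "m - 2 * c * \<delta> = (\<integral>z. (M z)\<^sup>2 - 2 * c * (M z * d z) \<partial>P)" by (simp add: m_def \<delta>_def)
    also have "\<dots> \<le> (\<integral>z. (max 0 (M z - c * d z))\<^sup>2 \<partial>P)"
    proof (rule integral_mono)
      fix z
      show "(M z)\<^sup>2 - 2 * c * (M z * d z) \<le> (max 0 (M z - c * d z))\<^sup>2"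
      proof (cases "M z \<le> c * d z")
        case True
        have "M z * M z \<le> M z * (c * d z)" using True nonneg by (intro mult_left_mono) auto
        moreover have "0 \<le> M z * (c * d z)" using nonneg by (simp add: c_def)
        ultimately show ?thesis using True by (simp add: power2_eq_square algebra_simps)
      next
        case False
        then have "(max 0 (M z - c * d z))\<^sup>2 = (M z)\<^sup>2 - 2 * c * (M z * d z) + (c * d z)\<^sup>2"
          by (simp add: power2_diff algebra_simps)
        then show ?thesis by simp
      qed
    qed (simp_all add: c_def)
    also have "\<dots> = 2 * D * g k"
    proof -
      have "c * real (2*k+2) = 2 * D" by (simp only: c_def D_def mult.assoc)
      then have "g k = (\<integral>z. (max 0 (M z - c * d z))\<^sup>2 \<partial>P) / (2 * D)"
        unfolding g_def c_def[symmetric] by simp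
      then show ?thesis using D by simp
    qed
    finally have "m - 2 * c * \<delta> \<le> 2 * D * g k" .
    moreover have "2 * c * \<delta> \<le> 2 * D * \<delta>" using cD \<delta>0 by (intro mult_right_mono)
    ultimately have "m - 2 * D * \<delta> \<le> D * (2 * g k)" by (simp add: mult.commute mult.left_commute)
    then have "(m - 2 * D * \<delta>) / D \<le> 2 * g k" using D by (simp add: divide_le_eq mult.commute)
    then show ?thesis using D unfolding D_def[symmetric] by (simp add: diff_divide_distrib)
  qed
  have "ennreal r + (\<Sum>k<K. 2 * ennreal (g k)) \<le> (\<Sum>k<Suc K. 2 * ennreal (m / (2 * real (2*k+2) * real (2*k+1))))"
  proof -
    have "(\<integral>\<^sup>+z. ennreal (M z * M' z) \<partial>P) = ennreal r"
      unfolding r_def using nonneg by (intro nn_integral_eq_integral) auto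
    moreover have "(\<integral>\<^sup>+z. ennreal ((M z)\<^sup>2 / c) \<partial>P) = ennreal (m / c)" if "0 \<le> c" for c
      using that by (subst nn_integral_eq_integral) (auto simp: m_def)
    ultimately show ?thesis
      using walk_max_product_le[of K] g_nn unfolding M_def M'_def d_def
      by (simp del: sum.lessThan_Suc)
  qed
  also have "(\<Sum>k<Suc K. 2 * ennreal (m / (2 * real (2*k+2) * real (2*k+1)))) = (\<Sum>k<Suc K. ennreal (m / (real (2*k+2) * real (2*k+1))))"
  proof (intro sum.cong refl)
    have "2 * ennreal (m / (2 * a * b)) = ennreal (m / (a * b))" if "0 \<le> a" "0 \<le> b" for a b
    proof -
      have "2 * ennreal (m / (2 * a * b)) = ennreal (2 * (m / (2 * a * b)))"
        using m that by (subst ennreal_mult) (auto simp del: ennreal_mult)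
      then show ?thesis by simp
    qed
    then show "2 * ennreal (m / (2 * real (2*k+2) * real (2*k+1))) = ennreal (m / (real (2*k+2) * real (2*k+1)))" for k
      by (simp only: of_nat_0_le_iff)
  qed
  also have "\<dots> = ennreal (\<Sum>k<Suc K. m / (real (2*k+2) * real (2*k+1)))"
    using m by (intro sum_ennreal) auto
  also have "ennreal r + (\<Sum>k<K. 2 * ennreal (g k)) = ennreal (r + (\<Sum>k<K. 2 * g k))"
  proof -
    have "(\<Sum>k<K. 2 * ennreal (g k)) = (\<Sum>k<K. ennreal (2 * g k))"
      using g_nonneg by (intro sum.cong refl) (simp add: ennreal_mult)
    also have "\<dots> = ennreal (\<Sum>k<K. 2 * g k)" using g_nonneg by (intro sum_ennreal) auto
    finally show ?thesis
      using g_nonneg nonneg by (subst ennreal_plus) (auto simp: r_def intro!: sum_nonneg integral_nonneg_AE)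
  qed
  finally have "r + (\<Sum>k<K. 2 * g k) \<le> (\<Sum>k<Suc K. m / (real (2*k+2) * real (2*k+1)))"
    using m by (subst (asm) ennreal_le_iff) (auto intro!: sum_nonneg simp del: sum.lessThan_Suc)
  moreover have "(\<Sum>k<K. m / (real (2*k+3) * real (2*k+2)) - 2 * \<delta>) \<le> (\<Sum>k<K. 2 * g k)"
    by (intro sum_mono g_ge)
  ultimately have "r \<le> (\<Sum>k<Suc K. m / (real (2*k+2) * real (2*k+1))) - (\<Sum>k<K. m / (real (2*k+3) * real (2*k+2)) - 2 * \<delta>)"
    by linarith
  also have "\<dots> = m * alternating_coeff K + 2 * real K * \<delta>"
    unfolding alternating_coeff_def right_diff_distrib sum_distrib_left sum_subtractf by simp
  \<comment> \<open>Only after the subtraction is m replaced by 1: m multiplies the whole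
    alternating sum, which is nonnegative.\<close>
  also have "\<dots> \<le> 1 * alternating_coeff K + 2 * real K * step_error N"
    using m \<delta> alternating_coeff_nonneg[of K] by (intro add_mono mult_right_mono mult_left_mono) auto
  finally have r: "r \<le> alternating_coeff K + 2 * real K * step_error N" by simp
  have sq: "(M z + M' z)\<^sup>2 = (M z)\<^sup>2 + (M' z)\<^sup>2 + 2 * (M z * M' z)" for z
    by (simp add: power2_sum)
  have "(\<integral>\<^sup>+z. ennreal ((M z + M' z)\<^sup>2) \<partial>P) = ennreal (\<integral>z. (M z + M' z)\<^sup>2 \<partial>P)"
    unfolding sq using nonneg by (intro nn_integral_eq_integral) auto
  also have "(\<integral>z. (M z + M' z)\<^sup>2 \<partial>P) = m + (\<integral>z. (M' z)\<^sup>2 \<partial>P) + 2 * r"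
    unfolding sq by (simp add: m_def r_def)
  also have "ennreal \<dots> \<le> ennreal (2 + 2 * alternating_coeff K + 4 * real K * step_error N)"
    using r m le1 by (intro ennreal_leI) linarith
  finally show ?thesis unfolding M_def M'_def .
qed

end

section \<open>Brownian motion on a grid\<close>

context standard_brownian_motion
begin

definition increments :: "nat \<Rightarrow> 'a \<Rightarrow> nat \<Rightarrow> real" where
  "increments N \<omega> = (\<lambda>j\<in>{..<N}. B (real (Suc j) / real N) \<omega> - B (real j / real N) \<omega>)"

lemma psum_increments:
  assumes "\<omega> \<in> space M" "j \<le> N"
  shows "psum (increments N \<omega>) j = B (real j / real N) \<omega>"
  using \<open>j \<le> N\<close>
proof (induction j)
  case 0
  then show ?case using start[OF assms(1)] by simp
next
  case (Suc j)
  then show ?case by (simp add: psum_Suc increments_def)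
qed

lemma measurable_increments:
  "increments N \<in> M \<rightarrow>\<^sub>M PiM {..<N} (\<lambda>_. borel)"
proof -
  have [measurable]: "B (real j / real N) \<in> borel_measurable M" for j
    by (intro measurable_at) simp
  show ?thesis unfolding increments_def[abs_def] by measurable
qed

lemma distr_increments:
  assumes "0 < N"
  shows "distr M (PiM {..<N} (\<lambda>_. borel)) (increments N) = normal_steps N"
proof -
  define X where "X = (\<lambda>j \<omega>. B (real (Suc j) / real N) \<omega> - B (real j / real N) \<omega>)"
  have "indep_vars (\<lambda>_. borel) (\<lambda>j \<omega>. B (real (Suc j) / real N) \<omega> - B (real j / real N) \<omega>) {..<N}"
    using independent_increments[of "\<lambda>j. real j / real N" N] assms
    by (auto simp: mono_on_def divide_right_mono)
  then have indep: "indep_vars (\<lambda>_. borel) X {..<N}" by (simp add: X_def)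
  have [measurable]: "B (real j / real N) \<in> borel_measurable M" for j
    by (intro measurable_at) simp
  have X: "random_variable borel (X j)" for j unfolding X_def by measurable
  have "distr M borel (X j) = step_normal N" for j
  proof -
    have "real j / real N < real (Suc j) / real N" using assms by (intro divide_strict_right_mono) auto
    then have "distributed M lborel (X j) (normal_density 0 (sqrt (real (Suc j) / real N - real j / real N)))"
      unfolding X_def by (intro normal_increments) auto
    moreover have "real (Suc j) / real N - real j / real N = 1 / real N" by (simp add: diff_divide_distrib[symmetric])
    ultimately have "distributed M lborel (X j) (normal_density 0 (sqrt (1 / real N)))" by simp
    then have "distr M lborel (X j) = step_normal N"
      unfolding step_normal_def by (rule distributed_distr_eq_density)
    moreover have "distr M lborel (X j) = distr M borel (X j)" by (intro distr_cong) auto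
    ultimately show ?thesis by simp
  qed
  moreover have "increments N = (\<lambda>\<omega>. \<lambda>j\<in>{..<N}. X j \<omega>)"
    by (simp add: increments_def[abs_def] X_def)
  ultimately show ?thesis
    using indep indep_vars_iff_distr_eq_PiM'[where I = "{..<N}" and M' = "\<lambda>_. borel" and X = X] X assms
    by (simp add: lessThan_empty_iff)
qed

lemma nn_integral_increments:
  assumes "0 < N" "f \<in> borel_measurable (normal_steps N)"
  shows "(\<integral>\<^sup>+\<omega>. f (increments N \<omega>) \<partial>M) = integral\<^sup>N (normal_steps N) f"
proof -
  have "sets (normal_steps N) = sets (PiM {..<N} (\<lambda>_. borel :: real measure))"
    by (intro sets_PiM_cong) (auto simp: step_normal_def)
  then have "f \<in> borel_measurable (PiM {..<N} (\<lambda>_. borel))"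
    using assms(2) by (simp cong: measurable_cong_sets)
  then show ?thesis
    using nn_integral_distr[OF measurable_increments[of N], of f]
    unfolding distr_increments[OF assms(1)] using assms(2) by simp
qed

text \<open>The law of the sum of the N normal steps is read off from the Brownian motion, whose
  value at time 1 it is, instead of being computed by convolution.\<close>

lemma nn_integral_endpoint:
  assumes "0 < N" and [measurable]: "h \<in> borel_measurable borel"
  shows "(\<integral>\<^sup>+z. h (psum z N) \<partial>normal_steps N) = integral\<^sup>N (density lborel std_normal_density) h"
proof -
  interpret normal_walk N by standard fact
  have "(\<integral>\<^sup>+z. h (psum z N) \<partial>P) = (\<integral>\<^sup>+\<omega>. h (psum (increments N \<omega>) N) \<partial>M)"
    by (rule nn_integral_increments[symmetric]) (use assms in measurable)
  also have "\<dots> = (\<integral>\<^sup>+\<omega>. h (B 1 \<omega> - B 0 \<omega>) \<partial>M)"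
    using assms by (intro nn_integral_cong) (simp add: psum_increments start)
  also have "\<dots> = (\<integral>\<^sup>+x. ennreal (std_normal_density x) * h x \<partial>lborel)"
    using normal_increments[of 0 1] by (intro distributed_nn_integral[symmetric]) auto
  also have "\<dots> = integral\<^sup>N (density lborel std_normal_density) h"
    by (subst nn_integral_density) auto
  finally show ?thesis .
qed

definition grid_range :: "nat \<Rightarrow> 'a \<Rightarrow> real" where
  "grid_range N \<omega> = walk_max N (increments N \<omega>) + walk_max N (\<lambda>i. - increments N \<omega> i)"

lemma grid_range_measurable [measurable]: "grid_range N \<in> borel_measurable M"
proof (cases "N = 0")
  case True
  then show ?thesis unfolding grid_range_def[abs_def] by (simp add: walk_max_def)
next
  case False
  then interpret normal_walk N by unfold_locales simp
  have "sets P = sets (PiM {..<N} (\<lambda>_. borel :: real measure))"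
    by (intro sets_PiM_cong) (auto simp: step_normal_def)
  then have [measurable]: "increments N \<in> M \<rightarrow>\<^sub>M P"
    using measurable_increments by (simp cong: measurable_cong_sets)
  have "(\<lambda>\<omega>. walk_max N (increments N \<omega>)) \<in> borel_measurable M"
    by (rule measurable_compose[OF \<open>increments N \<in> M \<rightarrow>\<^sub>M P\<close> measurable_P(1)])
  moreover have "(\<lambda>\<omega>. walk_max N (\<lambda>i. - increments N \<omega> i)) \<in> borel_measurable M"
    by (rule measurable_compose[OF \<open>increments N \<in> M \<rightarrow>\<^sub>M P\<close> measurable_walk_max_uminus])
  ultimately show ?thesis unfolding grid_range_def[abs_def] by measurable
qed

lemma grid_range_sq_le:
  assumes "0 < N"
  shows "(\<integral>\<^sup>+\<omega>. ennreal ((grid_range N \<omega>)\<^sup>2) \<partial>M) \<le> ennreal (2 + 2 * alternating_coeff K + 4 * real K * step_error N)"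
proof -
  interpret normal_walk N by standard fact
  have "(\<integral>\<^sup>+\<omega>. ennreal ((grid_range N \<omega>)\<^sup>2) \<partial>M) = (\<integral>\<^sup>+z. ennreal ((walk_max N z + walk_max N (\<lambda>i. - z i))\<^sup>2) \<partial>P)"
    unfolding grid_range_def by (rule nn_integral_increments) (use assms in measurable)
  also have "\<dots> \<le> ennreal (2 + 2 * alternating_coeff K + 4 * real K * step_error N)"
    using nn_integral_endpoint[OF assms, of "\<lambda>x. ennreal (x\<^sup>2)"]
    by (intro walk_range_sq_le) (simp add: nn_integral_std_normal_sq)
  finally show ?thesis .
qed

lemma grid_range_ge:
  assumes "\<omega> \<in> space M" "i \<le> N" "j \<le> N"
  shows "B (real i / real N) \<omega> - B (real j / real N) \<omega> \<le> grid_range N \<omega>"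
  using walk_max_ge[OF assms(2), of "increments N \<omega>"] walk_max_ge[OF assms(3), of "\<lambda>i. - increments N \<omega> i"] assms
  unfolding grid_range_def psum_uminus by (simp add: psum_increments)

lemma grid_floor_le: "0 \<le> s \<Longrightarrow> s \<le> 1 \<Longrightarrow> nat \<lfloor>s * real N\<rfloor> \<le> N"
proof -
  assume "0 \<le> s" "s \<le> 1"
  then have "s * real N \<le> real N" by (simp add: mult_left_le_one_le)
  then have "\<lfloor>s * real N\<rfloor> \<le> int N" by linarith
  then show ?thesis by linarith
qed

lemma grid_floor_tendsto:
  assumes "\<omega> \<in> space M" "0 \<le> s"
  shows "(\<lambda>N. B (real (nat \<lfloor>s * real N\<rfloor>) / real N) \<omega>) \<longlonglongrightarrow> B s \<omega>"
proof -
  have lim: "(\<lambda>N. real (nat \<lfloor>s * real N\<rfloor>) / real N) \<longlonglongrightarrow> s"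
  proof (rule tendsto_sandwich)
    show "\<forall>\<^sub>F N in sequentially. s - 1 / real N \<le> real (nat \<lfloor>s * real N\<rfloor>) / real N"
      using eventually_gt_at_top[of 0]
    proof eventually_elim
      case (elim N)
      have "s * real N - 1 \<le> real (nat \<lfloor>s * real N\<rfloor>)" using \<open>0 \<le> s\<close> by linarith
      then have "(s * real N - 1) / real N \<le> real (nat \<lfloor>s * real N\<rfloor>) / real N" by (intro divide_right_mono) auto
      then show ?case using elim by (simp add: diff_divide_distrib)
    qed
    show "\<forall>\<^sub>F N in sequentially. real (nat \<lfloor>s * real N\<rfloor>) / real N \<le> s"
      using eventually_gt_at_top[of 0]
    proof eventually_elim
      case (elim N)
      have "0 \<le> s * real N" using \<open>0 \<le> s\<close> by simp
      then have "real (nat \<lfloor>s * real N\<rfloor>) \<le> s * real N" by linarith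
      then show ?case using elim by (simp add: divide_le_eq)
    qed
    have "(\<lambda>N. s - 1 / real N) \<longlonglongrightarrow> s - 0" by (intro tendsto_intros lim_const_over_n)
    then show "(\<lambda>N. s - 1 / real N) \<longlonglongrightarrow> s" by simp
  qed simp
  show ?thesis
    by (rule continuous_on_tendsto_compose[OF continuous_paths[OF assms(1)] lim])
      (use assms(2) in \<open>auto intro!: always_eventually\<close>)
qed

end

section \<open>Expectation bounds for the circumradius\<close>

text \<open>On the sector |v| / t < |u| the integrand equals 2 |u| - |v| / t, and it vanishes
  elsewhere. The first part is 2 J(t); the second needs an upper bound for \<open>K\<close>, the
  mean of |v| on the sector.\<close>

lemma nn_integral_std_normal_sector_excess:
  fixes t :: real
  assumes "0 < t"
  defines "\<gamma> \<equiv> density lborel (\<lambda>x. ennreal (std_normal_density x))"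
    and "J \<equiv> \<lambda>t. sqrt (2 / pi) * (t / sqrt (1 + t\<^sup>2))"
  shows "ennreal (2 * J t - (sqrt (2 / pi) - J (1 / t)) / t)
    \<le> (\<integral>\<^sup>+v. \<integral>\<^sup>+u. ennreal (\<bar>u\<bar> * of_bool (\<bar>v\<bar> / t < \<bar>u\<bar>) + max 0 (\<bar>u\<bar> - \<bar>v\<bar> / t)) \<partial>\<gamma> \<partial>\<gamma>)"
proof -
  let ?q = "\<lambda>u v. of_bool (\<bar>v\<bar> / t < \<bar>u\<bar>) :: real"
  let ?g = "\<lambda>u v. \<bar>u\<bar> * ?q u v + max 0 (\<bar>u\<bar> - \<bar>v\<bar> / t)"
  interpret \<gamma>: prob_space \<gamma> unfolding \<gamma>_def by (rule prob_space_normal_density) simp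
  interpret \<gamma>\<gamma>: pair_sigma_finite \<gamma> \<gamma> ..
  have sets[measurable_cong]: "sets \<gamma> = sets borel" by (simp add: \<gamma>_def)
  define L where "L = (\<integral>\<^sup>+v. \<integral>\<^sup>+u. ennreal (?g u v) \<partial>\<gamma> \<partial>\<gamma>)"
  define K where "K = (\<integral>\<^sup>+v. \<integral>\<^sup>+u. ennreal (\<bar>v\<bar> * ?q u v) \<partial>\<gamma> \<partial>\<gamma>)"
  have J: "(\<integral>\<^sup>+v. \<integral>\<^sup>+u. ennreal (\<bar>u\<bar> * of_bool (\<bar>v\<bar> / s < \<bar>u\<bar>)) \<partial>\<gamma> \<partial>\<gamma>) = ennreal (J s)" if "0 < s" for s
    unfolding \<gamma>_def J_def using that by (rule nn_integral_std_normal_sector)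
  have J_nonneg: "0 \<le> J s" if "0 < s" for s using that by (simp add: J_def)
  have "L + ennreal (1 / t) * K = (\<integral>\<^sup>+v. \<integral>\<^sup>+u. ennreal (?g u v)
      + ennreal (1 / t) * ennreal (\<bar>v\<bar> * ?q u v) \<partial>\<gamma> \<partial>\<gamma>)"
    unfolding L_def K_def by (simp add: nn_integral_add nn_integral_cmult)
  also have "\<dots> = (\<integral>\<^sup>+v. \<integral>\<^sup>+u. 2 * ennreal (\<bar>u\<bar> * ?q u v) \<partial>\<gamma> \<partial>\<gamma>)"
  proof (intro nn_integral_cong)
    fix u v :: real
    have "ennreal (?g u v)
        + ennreal (1 / t) * ennreal (\<bar>v\<bar> * ?q u v)
      = ennreal ((?g u v) + 1 / t * (\<bar>v\<bar> * ?q u v))"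
      using assms by (subst ennreal_mult[symmetric], simp, simp, subst ennreal_plus[symmetric]) auto
    also have "\<dots> = ennreal (2 * (\<bar>u\<bar> * ?q u v))"
      by (intro arg_cong[where f = ennreal]) auto
    also have "\<dots> = 2 * ennreal (\<bar>u\<bar> * ?q u v)"
      by (subst ennreal_mult) auto
    finally show "ennreal (?g u v)
        + ennreal (1 / t) * ennreal (\<bar>v\<bar> * ?q u v) = \<dots>" .
  qed
  also have "\<dots> = 2 * ennreal (J t)"
    using J[OF assms(1)] by (simp add: nn_integral_cmult)
  also have "\<dots> = ennreal (2 * J t)" using J_nonneg[OF assms(1)] by (subst ennreal_mult) auto
  finally have LK: "L + ennreal (1 / t) * K = ennreal (2 * J t)" .
  \<comment> \<open>With u and v exchanged, J(1/t) is the mean of |v| on the opposite sector t |u| <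
    |v|. The sectors are disjoint, and sqrt (2 / pi) is the mean of |v| over the plane.\<close>
  have "K + ennreal (J (1 / t)) \<le> ennreal (sqrt (2 / pi))"
  proof -
    have "ennreal (J (1 / t)) = (\<integral>\<^sup>+u. \<integral>\<^sup>+v. ennreal (\<bar>v\<bar> * of_bool (\<bar>u\<bar> / (1 / t) < \<bar>v\<bar>)) \<partial>\<gamma> \<partial>\<gamma>)"
      using J[of "1 / t"] assms by simp
    also have "\<dots> = (\<integral>\<^sup>+v. \<integral>\<^sup>+u. ennreal (\<bar>v\<bar> * of_bool (\<bar>u\<bar> / (1 / t) < \<bar>v\<bar>)) \<partial>\<gamma> \<partial>\<gamma>)"
      by (intro \<gamma>\<gamma>.Fubini') measurable
    finally have "K + ennreal (J (1 / t)) = (\<integral>\<^sup>+v. \<integral>\<^sup>+u. ennreal (\<bar>v\<bar> * ?q u v)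
        + ennreal (\<bar>v\<bar> * of_bool (\<bar>u\<bar> / (1 / t) < \<bar>v\<bar>)) \<partial>\<gamma> \<partial>\<gamma>)"
      unfolding K_def by (simp add: nn_integral_add)
    also have "\<dots> \<le> (\<integral>\<^sup>+v. \<integral>\<^sup>+u. ennreal (\<bar>v\<bar> * of_bool (0 < \<bar>v\<bar>)) \<partial>\<gamma> \<partial>\<gamma>)"
    proof (intro nn_integral_mono)
      fix u v :: real
      have "\<not> (\<bar>v\<bar> / t < \<bar>u\<bar> \<and> \<bar>u\<bar> / (1 / t) < \<bar>v\<bar>)"
        using assms by (auto simp: field_simps)
      then show "ennreal (\<bar>v\<bar> * ?q u v) + ennreal (\<bar>v\<bar> * of_bool (\<bar>u\<bar> / (1 / t) < \<bar>v\<bar>)) \<le> ennreal (\<bar>v\<bar> * of_bool (0 < \<bar>v\<bar>))"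
        by (cases "\<bar>v\<bar> / t < \<bar>u\<bar>"; cases "\<bar>u\<bar> / (1 / t) < \<bar>v\<bar>"; cases "v = 0") auto
    qed
    also have "\<dots> = (\<integral>\<^sup>+v. ennreal (\<bar>v\<bar> * of_bool (0 < \<bar>v\<bar>)) \<partial>\<gamma>)"
      by (simp add: \<gamma>.emeasure_space_1)
    also have "\<dots> = ennreal (2 * std_normal_density 0)"
      unfolding \<gamma>_def by (rule nn_integral_std_normal_abs_tail) simp
    also have "2 * std_normal_density 0 = sqrt (2 / pi)"
    proof -
      have "2 * (1 / sqrt (2 * pi)) = sqrt 4 / sqrt (2 * pi)" by simp
      also have "\<dots> = sqrt (4 / (2 * pi))" by (rule real_sqrt_divide[symmetric])
      also have "4 / (2 * pi) = 2 / pi" by simp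
      finally show ?thesis by (simp add: std_normal_density_def)
    qed
    finally show ?thesis .
  qed
  moreover obtain k where k: "K = ennreal k" "0 \<le> k"
    by (cases K) (use \<open>K + _ \<le> _\<close> in \<open>auto simp: top_unique\<close>)
  ultimately have kle: "k \<le> sqrt (2 / pi) - J (1 / t)"
    using J_nonneg[of "1 / t"] assms by (simp flip: ennreal_plus)
  obtain l where l: "L = ennreal l" "0 \<le> l"
    by (cases L) (use LK in auto)
  have "ennreal (l + 1 / t * k) = ennreal (2 * J t)"
    using LK k l assms by (simp add: ennreal_plus ennreal_mult[symmetric] flip: ennreal_plus)
  then have "l + k / t = 2 * J t"
    using k l assms J_nonneg[of t] by (subst (asm) ennreal_inj) auto
  moreover have "k / t \<le> (sqrt (2 / pi) - J (1 / t)) / t" using kle assms by (intro divide_right_mono) auto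
  ultimately have "2 * J t - (sqrt (2 / pi) - J (1 / t)) / t \<le> l" by linarith
  then show ?thesis unfolding L_def[symmetric] l(1) by (rule ennreal_leI)
qed

text \<open>\<open>\<surd>2 - 1\<close> is \<open>tan (\<pi>/8)\<close>; \<open>s\<close> and \<open>r\<close> below are \<open>sin (\<pi>/8)\<close> and \<open>cos (\<pi>/8)\<close>.\<close>

lemma sector_excess_numeric:
  fixes t :: real
  defines "t \<equiv> sqrt 2 - 1" and "J \<equiv> \<lambda>t. sqrt (2 / pi) * (t / sqrt (1 + t\<^sup>2))"
  shows "0.928 \<le> 2 * (2 * J t - (sqrt (2 / pi) - J (1 / t)) / t)"
proof -
  define c where "c = sqrt (2 / pi)"
  \<comment> \<open>The quantity to be bounded is 0.92809..., less than 0.0001 above the claim,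
    hence bounds with five decimals throughout.\<close>
  have s2: "1.41421 \<le> sqrt 2" "sqrt 2 \<le> 1.41422"
    by (rule real_le_rsqrt, simp add: power2_eq_square) (rule real_le_lsqrt, simp_all add: power2_eq_square)
  have t: "0 < t" using s2 by (simp add: t_def)
  have inv: "1 / t = sqrt 2 + 1"
  proof -
    have "(sqrt 2 + 1) * t = 1" unfolding t_def by (simp add: algebra_simps)
    then show ?thesis using t by (simp add: field_simps)
  qed
  define s where "s = t / sqrt (1 + t\<^sup>2)"
  define r where "r = (1 / t) / sqrt (1 + (1 / t)\<^sup>2)"
  have ss: "sqrt 2 * sqrt 2 = (2::real)" by simp
  have s_sq: "s\<^sup>2 = (2 - sqrt 2) / 4"
  proof -
    have "s\<^sup>2 = t\<^sup>2 / (1 + t\<^sup>2)" by (simp add: s_def power_divide add_nonneg_nonneg)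
    also have "t\<^sup>2 = 3 - 2 * sqrt 2" by (simp add: t_def power2_diff)
    also have "(3 - 2 * sqrt 2) / (1 + (3 - 2 * sqrt 2)) = (2 - sqrt 2) / 4"
      using s2 ss by (simp add: field_simps)
    finally show ?thesis .
  qed
  have r_sq: "r\<^sup>2 = (2 + sqrt 2) / 4"
  proof -
    have "r\<^sup>2 = (1 / t)\<^sup>2 / (1 + (1 / t)\<^sup>2)"
      unfolding r_def inv by (simp add: power_divide add_nonneg_nonneg)
    also have "(1 / t)\<^sup>2 = 3 + 2 * sqrt 2" unfolding inv by (simp add: power2_sum)
    also have "(3 + 2 * sqrt 2) / (1 + (3 + 2 * sqrt 2)) = (2 + sqrt 2) / 4"
      using s2 ss by (simp add: field_simps)
    finally show ?thesis .
  qed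
  have s: "0.38268 \<le> s"
  proof (rule power2_le_imp_le)
    show "0.38268\<^sup>2 \<le> s\<^sup>2" unfolding s_sq using s2 by (simp add: power2_eq_square)
    show "0 \<le> s" using t by (simp add: s_def)
  qed
  have r: "0.92387 \<le> r"
  proof (rule power2_le_imp_le)
    show "0.92387\<^sup>2 \<le> r\<^sup>2" unfolding r_sq using s2 by (simp add: power2_eq_square)
    show "0 \<le> r" using t by (simp add: r_def)
  qed
  have r1: "r \<le> 1"
  proof (rule power2_le_imp_le)
    show "r\<^sup>2 \<le> 1\<^sup>2" unfolding r_sq using s2 by simp
  qed simp
  have c: "0.79788 \<le> c"
  proof -
    have "(0.79788)\<^sup>2 * pi \<le> (0.79788)\<^sup>2 * 3.1415927"
      using pi_approx by (intro mult_left_mono) auto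
    also have "\<dots> \<le> 2" by (simp add: power2_eq_square)
    finally have "(0.79788)\<^sup>2 \<le> 2 / pi" by (simp add: le_divide_eq)
    then show ?thesis unfolding c_def by (rule real_le_rsqrt)
  qed
  have "(1 - r) * (sqrt 2 + 1) \<le> 0.07613 * 2.41422"
    using r r1 s2 by (intro mult_mono) auto
  then have "0.58156 \<le> 2 * s - (1 - r) * (sqrt 2 + 1)" using s by simp
  then have "0.79788 * 0.58156 \<le> c * (2 * s - (1 - r) * (sqrt 2 + 1))"
    using c by (intro mult_mono) auto
  then have "0.928 \<le> 2 * (c * (2 * s - (1 - r) * (sqrt 2 + 1)))" by simp
  also have "\<dots> = 2 * (2 * J t - (c - J (1 / t)) / t)"
  proof -
    have "J (1 / t) = c * r" by (simp only: J_def r_def c_def)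
    then have "(c - J (1 / t)) / t = (c - c * r) * (1 / t)" by simp
    then have "(c - J (1 / t)) / t = c * ((1 - r) * (sqrt 2 + 1))"
      unfolding inv by (simp only: right_diff_distrib mult_1_right mult.assoc)
        (simp add: algebra_simps)
    moreover have "J t = c * s" by (simp only: J_def s_def c_def)
    ultimately show ?thesis by (simp only:) (simp add: algebra_simps)
  qed
  finally show ?thesis by (simp add: c_def)
qed

text \<open>The four conditions describe open double cones of half-angle pi/8 around axes that are
  45 degrees apart. The arithmetic behind it is t (1 + t) = 1 - t, the double-angle formula for tan
  (pi/4) = 1.\<close>

lemma sectors_disjoint:
  fixes a b :: real
  defines "t \<equiv> sqrt 2 - 1"
  shows "of_bool (\<bar>b\<bar> / t < \<bar>a\<bar>) + of_bool (\<bar>a\<bar> / t < \<bar>b\<bar>)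
    + of_bool (\<bar>(a - b) / sqrt 2\<bar> / t < \<bar>(a + b) / sqrt 2\<bar>) + of_bool (\<bar>(a + b) / sqrt 2\<bar> / t < \<bar>(a - b) / sqrt 2\<bar>) \<le> (1::real)"
proof -
  have t: "0 < t" "t < 1" unfolding t_def using real_sqrt_less_iff[of 1 2] real_sqrt_less_iff[of 2 4] by simp_all
  have tt: "t * (1 + t) = 1 - t" unfolding t_def by (simp add: algebra_simps)
  have tcommon: False if "\<bar>y\<bar> < t * \<bar>x\<bar>" "\<bar>x\<bar> < t * \<bar>y\<bar>" for x y :: real
  proof -
    have "t * \<bar>x\<bar> \<le> \<bar>x\<bar>" and "t * \<bar>y\<bar> \<le> \<bar>y\<bar>"
      using t by (simp_all add: mult_left_le_one_le)
    then show False using that by linarith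
  qed
  \<comment> \<open>A coordinate axis against a diagonal: u and v stand for the sum and difference
    of the coordinates in either order, the common factor 1 / sqrt 2 being dropped.\<close>
  have tdiag: False if "\<bar>y\<bar> < t * \<bar>x\<bar>" "\<bar>u\<bar> < t * \<bar>v\<bar>" "\<bar>x\<bar> - \<bar>y\<bar> \<le> \<bar>u\<bar>" "\<bar>v\<bar> \<le> \<bar>x\<bar> + \<bar>y\<bar>" for x y u v :: real
  proof -
    have "t * \<bar>v\<bar> \<le> t * (\<bar>x\<bar> + t * \<bar>x\<bar>)" using that t by (intro mult_left_mono) auto
    also have "\<dots> = (t * (1 + t)) * \<bar>x\<bar>" by (simp add: algebra_simps)
    also have "\<dots> = \<bar>x\<bar> - t * \<bar>x\<bar>" unfolding tt by (simp add: algebra_simps)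
    finally show False using that by linarith
  qed
  have iff: "\<bar>y\<bar> / t < \<bar>x\<bar> \<longleftrightarrow> \<bar>y\<bar> < t * \<bar>x\<bar>" for x y :: real
    using t by (simp add: field_simps)
  have iff2: "\<bar>y / sqrt 2\<bar> / t < \<bar>x / sqrt 2\<bar> \<longleftrightarrow> \<bar>y\<bar> < t * \<bar>x\<bar>" for x y :: real
    using t by (simp add: field_simps)
  define A where "A \<longleftrightarrow> \<bar>b\<bar> < t * \<bar>a\<bar>"
  define B where "B \<longleftrightarrow> \<bar>a\<bar> < t * \<bar>b\<bar>"
  define C where "C \<longleftrightarrow> \<bar>a - b\<bar> < t * \<bar>a + b\<bar>"
  define D where "D \<longleftrightarrow> \<bar>a + b\<bar> < t * \<bar>a - b\<bar>"
  have "\<not> (A \<and> B)" "\<not> (C \<and> D)" using tcommon by (auto simp: A_def B_def C_def D_def)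
  moreover have tri: "\<bar>a\<bar> - \<bar>b\<bar> \<le> \<bar>a - b\<bar>" "\<bar>a\<bar> - \<bar>b\<bar> \<le> \<bar>a + b\<bar>" "\<bar>b\<bar> - \<bar>a\<bar> \<le> \<bar>a - b\<bar>" "\<bar>b\<bar> - \<bar>a\<bar> \<le> \<bar>a + b\<bar>"
    "\<bar>a + b\<bar> \<le> \<bar>a\<bar> + \<bar>b\<bar>" "\<bar>a - b\<bar> \<le> \<bar>a\<bar> + \<bar>b\<bar>" "\<bar>a + b\<bar> \<le> \<bar>b\<bar> + \<bar>a\<bar>" "\<bar>a - b\<bar> \<le> \<bar>b\<bar> + \<bar>a\<bar>"
    by linarith+
  moreover have "\<not> (A \<and> C)" "\<not> (A \<and> D)"
    using tdiag[of b a "a - b" "a + b"] tdiag[of b a "a + b" "a - b"] tri unfolding A_def C_def D_def by blast+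
  moreover have "\<not> (B \<and> C)" "\<not> (B \<and> D)"
    using tdiag[of a b "a - b" "a + b"] tdiag[of a b "a + b" "a - b"] tri unfolding B_def C_def D_def by blast+
  ultimately have "of_bool A + of_bool B + of_bool C + of_bool D \<le> (1::real)" by auto
  then show ?thesis unfolding iff2 unfolding iff A_def B_def C_def D_def .
qed

section \<open>Ranges along the four axes\<close>

lemma norm_vec2: "norm (v :: real ^ 2) = sqrt ((v $ 1)\<^sup>2 + (v $ 2)\<^sup>2)"
  by (simp add: norm_vec_def L2_set_def sum_2)

lemma circumradius_convex_hull: "circumradius (convex hull S) = circumradius (S :: 'a::euclidean_space set)"
proof -
  have "convex hull S \<subseteq> cball c r \<longleftrightarrow> S \<subseteq> cball c r" for c r
    by (meson convex_cball hull_minimal hull_subset order_trans)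
  then show ?thesis by (simp add: circumradius_def)
qed

lemma walk_range_le:
  assumes "\<And>i j. i \<le> N \<Longrightarrow> j \<le> N \<Longrightarrow> \<bar>psum z i - psum z j\<bar> \<le> c"
  shows "walk_max N z + walk_max N (\<lambda>i. - z i) \<le> c"
proof -
  obtain i where i: "i \<le> N" "walk_max N z \<le> psum z i"
    using le_walk_max_iff[of "walk_max N z" N z] by auto
  obtain j where j: "j \<le> N" "walk_max N (\<lambda>i. - z i) \<le> - psum z j"
    using le_walk_max_iff[of "walk_max N (\<lambda>i. - z i)" N "\<lambda>i. - z i"] by (auto simp: psum_uminus)
  show ?thesis using assms[OF i(1) j(1)] i j by linarith
qed

text \<open>The steps x run along an axis and y across it. For t = tan (pi/8) the range along the
  axis counts only if the endpoint of the planar walk is within pi/8 of that axis.\<close>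

definition sector_range :: "nat \<Rightarrow> real \<Rightarrow> (nat \<Rightarrow> real) \<Rightarrow> (nat \<Rightarrow> real) \<Rightarrow> real" where
  "sector_range N t x y = (walk_max N x + walk_max N (\<lambda>i. - x i)) * of_bool (\<bar>psum y N\<bar> / t < \<bar>psum x N\<bar>)"

lemma sector_range_nonneg: "0 \<le> sector_range N t x y"
  by (simp add: sector_range_def walk_max_nonneg)

lemma sector_range_le:
  assumes "\<And>i j. i \<le> N \<Longrightarrow> j \<le> N \<Longrightarrow> \<bar>psum x i - psum x j\<bar> \<le> c"
  shows "sector_range N t x y \<le> c * of_bool (\<bar>psum y N\<bar> / t < \<bar>psum x N\<bar>)"
  unfolding sector_range_def using walk_range_le[OF assms] by (intro mult_right_mono) auto

context normal_walk
begin

lemma measurable_sector_range [measurable]: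
  "(\<lambda>z. sector_range N t (fst z) (snd z)) \<in> borel_measurable (P \<Otimes>\<^sub>M P)"
  unfolding sector_range_def by measurable

end

context standard_brownian_motion
begin

text \<open>For a fixed walk y, \<open>walk_range_ge_endpoint\<close> applies to x with the
  threshold w = |endpoint of y| / t; independence of the two walks permits integrating over x
  first.\<close>

lemma nn_integral_sector_range:
  assumes "0 < N" "0 < t"
  shows "(\<integral>\<^sup>+v. \<integral>\<^sup>+u. ennreal (\<bar>u\<bar> * of_bool (\<bar>v\<bar> / t < \<bar>u\<bar>) + max 0 (\<bar>u\<bar> - \<bar>v\<bar> / t))
        \<partial>density lborel std_normal_density \<partial>density lborel std_normal_density)
    \<le> (\<integral>\<^sup>+z. ennreal (sector_range N t (fst z) (snd z)) \<partial>(normal_steps N \<Otimes>\<^sub>M normal_steps N))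
      + 8 * ennreal (step_error N)"
proof -
  interpret normal_walk N by standard fact
  interpret P: prob_space P by (rule prob_P)
  interpret PP: pair_sigma_finite P P ..
  interpret \<gamma>: prob_space "density lborel std_normal_density" by (rule prob_space_normal_density) simp
  let ?g = "\<lambda>u v. ennreal (\<bar>u\<bar> * of_bool (\<bar>v\<bar> / t < \<bar>u\<bar>) + max 0 (\<bar>u\<bar> - \<bar>v\<bar> / t))"
  let ?\<gamma> = "density lborel std_normal_density"
  have "(\<integral>\<^sup>+v. \<integral>\<^sup>+u. ?g u v \<partial>?\<gamma> \<partial>?\<gamma>) = (\<integral>\<^sup>+v. \<integral>\<^sup>+x. ?g (psum x N) v \<partial>P \<partial>?\<gamma>)"
    using nn_integral_endpoint[OF assms(1), of "\<lambda>u. ?g u _"] by (intro nn_integral_cong) auto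
  also have "\<dots> = (\<integral>\<^sup>+y. \<integral>\<^sup>+x. ?g (psum x N) (psum y N) \<partial>P \<partial>P)"
    by (rule nn_integral_endpoint[OF assms(1), of "\<lambda>v. \<integral>\<^sup>+x. ?g (psum x N) v \<partial>P", symmetric]) measurable
  also have "\<dots> \<le> (\<integral>\<^sup>+y. (\<integral>\<^sup>+x. ennreal (sector_range N t x y) \<partial>P) + 8 * (\<integral>\<^sup>+x. ennreal (step_bound N x) \<partial>P) \<partial>P)"
    unfolding sector_range_def using assms(2) by (intro nn_integral_mono walk_range_ge_endpoint) auto
  also have "\<dots> = (\<integral>\<^sup>+y. \<integral>\<^sup>+x. ennreal (sector_range N t (fst (x, y)) (snd (x, y))) \<partial>P \<partial>P) + 8 * (\<integral>\<^sup>+x. ennreal (step_bound N x) \<partial>P)"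
    by (subst nn_integral_add) (auto simp: P.emeasure_space_1 sector_range_def)
  also have "(\<integral>\<^sup>+y. \<integral>\<^sup>+x. ennreal (sector_range N t (fst (x, y)) (snd (x, y))) \<partial>P \<partial>P)
      = (\<integral>\<^sup>+z. ennreal (sector_range N t (fst z) (snd z)) \<partial>(P \<Otimes>\<^sub>M P))"
    by (rule PP.nn_integral_snd) measurable
  finally show ?thesis
    by (rule order_trans) (intro add_left_mono mult_left_mono nn_integral_step_bound, simp)
qed

end

context planar_brownian_motion
begin

sublocale X: standard_brownian_motion M "\<lambda>t \<omega>. W t \<omega> $ 1" by (rule coordinates)
sublocale Y: standard_brownian_motion M "\<lambda>t \<omega>. W t \<omega> $ 2" by (rule coordinates)

text \<open>\<open>D\<close> reads the grid increments off a path, so independence of the two whole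
  paths passes to the two step sequences, and their joint law is a product.\<close>

lemma nn_integral_increments_pair:
  assumes "0 < N"
    and F: "(\<lambda>z. F (fst z) (snd z)) \<in> borel_measurable (normal_steps N \<Otimes>\<^sub>M normal_steps N)"
  shows "(\<integral>\<^sup>+\<omega>. F (X.increments N \<omega>) (Y.increments N \<omega>) \<partial>M)
    = (\<integral>\<^sup>+z. F (fst z) (snd z) \<partial>(normal_steps N \<Otimes>\<^sub>M normal_steps N))"
proof -
  define P where "P = normal_steps N"
  define Pb where "Pb = PiM {..<N} (\<lambda>_. borel :: real measure)"
  have sets[measurable_cong]: "sets P = sets Pb"
    unfolding P_def Pb_def by (intro sets_PiM_cong) (auto simp: step_normal_def)
  define D where "D = (\<lambda>p. \<lambda>j\<in>{..<N}. p (real (Suc j) / real N) - p (real j / real N) :: real)"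
  have D: "D \<in> PiM {0..} (\<lambda>_. borel) \<rightarrow>\<^sub>M Pb"
  proof -
    have [measurable]: "(\<lambda>p. p (real j / real N)) \<in> borel_measurable (PiM {0..} (\<lambda>_. borel :: real measure))" for j
      by (intro measurable_component_singleton) simp
    show ?thesis unfolding D_def Pb_def by measurable
  qed
  have "D \<circ> (\<lambda>\<omega>. \<lambda>t\<in>{0..}. W t \<omega> $ 1) = X.increments N" "D \<circ> (\<lambda>\<omega>. \<lambda>t\<in>{0..}. W t \<omega> $ 2) = Y.increments N"
    by (auto simp: D_def X.increments_def Y.increments_def fun_eq_iff restrict_def)
  then have "indep_var Pb (X.increments N) Pb (Y.increments N)"
    using indep_var_compose[OF independent_coordinates D D] by simp
  then have "distr M Pb (X.increments N) \<Otimes>\<^sub>M distr M Pb (Y.increments N) = distr M (Pb \<Otimes>\<^sub>M Pb) (\<lambda>\<omega>. (X.increments N \<omega>, Y.increments N \<omega>))"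
    by (simp add: indep_var_distribution_eq)
  then have joint: "P \<Otimes>\<^sub>M P = distr M (Pb \<Otimes>\<^sub>M Pb) (\<lambda>\<omega>. (X.increments N \<omega>, Y.increments N \<omega>))"
    using X.distr_increments[OF assms(1)] Y.distr_increments[OF assms(1)] by (simp add: P_def Pb_def)
  have [measurable]: "X.increments N \<in> M \<rightarrow>\<^sub>M Pb" "Y.increments N \<in> M \<rightarrow>\<^sub>M Pb"
    unfolding Pb_def by (rule X.measurable_increments Y.measurable_increments)+
  have "(\<lambda>z. F (fst z) (snd z)) \<in> borel_measurable (P \<Otimes>\<^sub>M P)" using F by (simp add: P_def)
  then have [measurable]: "(\<lambda>z. F (fst z) (snd z)) \<in> borel_measurable (Pb \<Otimes>\<^sub>M Pb)"
    by (simp cong: measurable_cong_sets add: sets_pair_measure_cong[OF sets sets])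
  show ?thesis
    unfolding P_def[symmetric] joint by (subst nn_integral_distr) auto
qed

lemma nn_integral_increments_map:
  fixes \<rho> :: "real \<times> real \<Rightarrow> real \<times> real"
  assumes "0 < N"
    and \<rho>[measurable]: "\<rho> \<in> borel \<Otimes>\<^sub>M borel \<rightarrow>\<^sub>M borel \<Otimes>\<^sub>M borel"
    and inv: "\<And>f. f \<in> borel_measurable (borel \<Otimes>\<^sub>M borel) \<Longrightarrow>
        (\<integral>\<^sup>+z. f (\<rho> z) \<partial>(step_normal N \<Otimes>\<^sub>M step_normal N)) = (\<integral>\<^sup>+z. f z \<partial>(step_normal N \<Otimes>\<^sub>M step_normal N))"
    and F: "(\<lambda>z. F (fst z) (snd z)) \<in> borel_measurable (normal_steps N \<Otimes>\<^sub>M normal_steps N)"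
  shows "(\<integral>\<^sup>+\<omega>. F (\<lambda>j\<in>{..<N}. fst (\<rho> (X.increments N \<omega> j, Y.increments N \<omega> j))) (\<lambda>j\<in>{..<N}. snd (\<rho> (X.increments N \<omega> j, Y.increments N \<omega> j))) \<partial>M)
    = (\<integral>\<^sup>+z. F (fst z) (snd z) \<partial>(normal_steps N \<Otimes>\<^sub>M normal_steps N))"
proof -
  interpret normal_walk N by standard fact
  have s: "sets (step_normal N \<Otimes>\<^sub>M step_normal N) = sets (borel \<Otimes>\<^sub>M borel :: (real \<times> real) measure)"
    by (intro sets_pair_measure_cong sets_A)
  have \<rho>'[measurable]: "\<rho> \<in> step_normal N \<Otimes>\<^sub>M step_normal N \<rightarrow>\<^sub>M step_normal N \<Otimes>\<^sub>M step_normal N"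
    using \<rho> by (simp cong: measurable_cong_sets add: s)
  have [measurable]: "(\<lambda>x. x j) \<in> P \<rightarrow>\<^sub>M step_normal N" if "j \<in> {..<N}" for j
    using that by (rule measurable_component_singleton)
  have "(\<lambda>z. (\<lambda>j\<in>{..<N}. fst (\<rho> (fst z j, snd z j)), \<lambda>j\<in>{..<N}. snd (\<rho> (fst z j, snd z j)))) \<in> P \<Otimes>\<^sub>M P \<rightarrow>\<^sub>M P \<Otimes>\<^sub>M P"
    by measurable
  from measurable_compose[OF this F]
  have m: "(\<lambda>z. F (\<lambda>j\<in>{..<N}. fst (\<rho> (fst z j, snd z j))) (\<lambda>j\<in>{..<N}. snd (\<rho> (fst z j, snd z j)))) \<in> borel_measurable (P \<Otimes>\<^sub>M P)"
    by simp
  have "(\<integral>\<^sup>+z. F (\<lambda>j\<in>{..<N}. fst (\<rho> (fst z j, snd z j))) (\<lambda>j\<in>{..<N}. snd (\<rho> (fst z j, snd z j))) \<partial>(P \<Otimes>\<^sub>M P))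
    = (\<integral>\<^sup>+z. F (fst z) (snd z) \<partial>(P \<Otimes>\<^sub>M P))"
    by (rule nn_integral_PiM_pair_map[OF prob_A \<rho>' _ F]) (rule inv, simp cong: measurable_cong_sets add: s)
  with nn_integral_increments_pair[OF assms(1), of "\<lambda>x y. F (\<lambda>j\<in>{..<N}. fst (\<rho> (x j, y j))) (\<lambda>j\<in>{..<N}. snd (\<rho> (x j, y j)))", OF m]
  show ?thesis by simp
qed

text \<open>The expectation \<open>Q\<close> is the same for all four axes, by invariance of the
  planar steps. For each path at most one of the four terms is nonzero, and it is at most
  \<open>c\<close>, since a range along an axis is bounded by the largest distance between grid
  points.\<close>

lemma sector_ranges_le:
  assumes "0 < N"
    and c: "\<And>\<omega> i j. \<omega> \<in> space M \<Longrightarrow> i \<le> N \<Longrightarrow> j \<le> N \<Longrightarrow> norm (W (real i / real N) \<omega> - W (real j / real N) \<omega>) \<le> c \<omega>"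
  defines "t \<equiv> sqrt 2 - 1"
  shows "4 * (\<integral>\<^sup>+z. ennreal (sector_range N t (fst z) (snd z)) \<partial>(normal_steps N \<Otimes>\<^sub>M normal_steps N))
    \<le> (\<integral>\<^sup>+\<omega>. ennreal (c \<omega>) \<partial>M)"
proof -
  interpret normal_walk N by standard fact
  define Q where "Q = (\<integral>\<^sup>+z. ennreal (sector_range N t (fst z) (snd z)) \<partial>(P \<Otimes>\<^sub>M P))"
  define S where "S = (\<lambda>\<rho> \<omega>. sector_range N t (\<lambda>j\<in>{..<N}. fst (\<rho> (X.increments N \<omega> j, Y.increments N \<omega> j)))
      (\<lambda>j\<in>{..<N}. snd (\<rho> (X.increments N \<omega> j, Y.increments N \<omega> j))))"
  interpret A: prob_space "step_normal N" by (rule prob_A)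
  interpret AA: pair_prob_space "step_normal N" "step_normal N" ..
  have s[measurable_cong]: "sets (step_normal N) = sets borel" by (rule sets_A)
  have swap: "(\<integral>\<^sup>+z. f (snd z, fst z) \<partial>(step_normal N \<Otimes>\<^sub>M step_normal N)) = (\<integral>\<^sup>+z. f z \<partial>(step_normal N \<Otimes>\<^sub>M step_normal N))"
    if [measurable]: "f \<in> borel_measurable (borel \<Otimes>\<^sub>M borel)" for f
    by (subst (2) AA.distr_pair_swap, subst nn_integral_distr) (auto simp: case_prod_unfold)
  have rot: "(\<integral>\<^sup>+z. f ((fst z + snd z) / sqrt 2, (fst z - snd z) / sqrt 2) \<partial>(step_normal N \<Otimes>\<^sub>M step_normal N)) = (\<integral>\<^sup>+z. f z \<partial>(step_normal N \<Otimes>\<^sub>M step_normal N))"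
    if "f \<in> borel_measurable (borel \<Otimes>\<^sub>M borel)" for f
    unfolding step_normal_def using N_pos that by (intro nn_integral_normal_rotate45) auto
  \<comment> \<open>Components along and across the axes at 0, 90, 45 and 135 degrees, up to signs.
    The fourth map is the third followed by the exchange of components.\<close>
  let ?\<rho>1 = "\<lambda>z :: real \<times> real. z"
  let ?\<rho>2 = "\<lambda>z :: real \<times> real. (snd z, fst z)"
  let ?\<rho>3 = "\<lambda>z :: real \<times> real. ((fst z + snd z) / sqrt 2, (fst z - snd z) / sqrt 2)"
  let ?\<rho>4 = "\<lambda>z :: real \<times> real. ((fst z - snd z) / sqrt 2, (fst z + snd z) / sqrt 2)"
  have F: "(\<lambda>z. ennreal (sector_range N t (fst z) (snd z))) \<in> borel_measurable (P \<Otimes>\<^sub>M P)" by measurable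
  note map = nn_integral_increments_map[OF assms(1) _ _ F, folded Q_def]
  have 1: "(\<integral>\<^sup>+\<omega>. ennreal (S ?\<rho>1 \<omega>) \<partial>M) = Q" unfolding S_def by (rule map) simp_all
  have 2: "(\<integral>\<^sup>+\<omega>. ennreal (S ?\<rho>2 \<omega>) \<partial>M) = Q" unfolding S_def by (rule map, measurable) (rule swap)
  have 3: "(\<integral>\<^sup>+\<omega>. ennreal (S ?\<rho>3 \<omega>) \<partial>M) = Q" unfolding S_def by (rule map, measurable) (rule rot)
  have 4: "(\<integral>\<^sup>+\<omega>. ennreal (S ?\<rho>4 \<omega>) \<partial>M) = Q" unfolding S_def
  proof (rule map)
    fix f :: "real \<times> real \<Rightarrow> ennreal" assume [measurable]: "f \<in> borel_measurable (borel \<Otimes>\<^sub>M borel)"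
    show "(\<integral>\<^sup>+z. f (?\<rho>4 z) \<partial>(step_normal N \<Otimes>\<^sub>M step_normal N)) = (\<integral>\<^sup>+z. f z \<partial>(step_normal N \<Otimes>\<^sub>M step_normal N))"
      using rot[of "\<lambda>z. f (snd z, fst z)"] swap[of f] by simp
  qed measurable
  have [measurable]: "(\<lambda>\<omega>. X.increments N \<omega> j) \<in> borel_measurable M" "(\<lambda>\<omega>. Y.increments N \<omega> j) \<in> borel_measurable M" if "j \<in> {..<N}" for j
    using measurable_compose[OF X.measurable_increments measurable_component_singleton[OF that]]
      measurable_compose[OF Y.measurable_increments measurable_component_singleton[OF that]] by auto
  have S_meas: "(\<lambda>\<omega>. S \<rho> \<omega>) \<in> borel_measurable M" if [measurable]: "\<rho> \<in> borel \<Otimes>\<^sub>M borel \<rightarrow>\<^sub>M borel \<Otimes>\<^sub>M borel" for \<rho>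
  proof -
    have "(\<lambda>\<omega>. (\<lambda>j\<in>{..<N}. fst (\<rho> (X.increments N \<omega> j, Y.increments N \<omega> j)), \<lambda>j\<in>{..<N}. snd (\<rho> (X.increments N \<omega> j, Y.increments N \<omega> j)))) \<in> M \<rightarrow>\<^sub>M P \<Otimes>\<^sub>M P"
      by measurable
    from measurable_compose[OF this measurable_sector_range[of t]] show ?thesis by (simp add: S_def)
  qed
  have [measurable]: "(\<lambda>\<omega>. S ?\<rho>1 \<omega>) \<in> borel_measurable M" "(\<lambda>\<omega>. S ?\<rho>2 \<omega>) \<in> borel_measurable M"
      "(\<lambda>\<omega>. S ?\<rho>3 \<omega>) \<in> borel_measurable M" "(\<lambda>\<omega>. S ?\<rho>4 \<omega>) \<in> borel_measurable M"
    by (rule S_meas, measurable)+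
  have "(4 :: ennreal) = 1 + 1 + 1 + 1" by simp
  then have "4 * Q = Q + Q + Q + Q" by (simp only: distrib_right mult_1)
  also have "\<dots> = (\<integral>\<^sup>+\<omega>. ennreal (S ?\<rho>1 \<omega>) + ennreal (S ?\<rho>2 \<omega>) + ennreal (S ?\<rho>3 \<omega>) + ennreal (S ?\<rho>4 \<omega>) \<partial>M)"
    using 1 2 3 4 by (simp add: nn_integral_add)
  also have "\<dots> \<le> (\<integral>\<^sup>+\<omega>. ennreal (c \<omega>) \<partial>M)"
  proof (rule nn_integral_mono)
    fix \<omega> assume \<omega>: "\<omega> \<in> space M"
    define a where "a = (\<lambda>j. W (real j / real N) \<omega> $ 1)"
    define b where "b = (\<lambda>j. W (real j / real N) \<omega> $ 2)"
    have pa: "psum (X.increments N \<omega>) j = a j" and pb: "psum (Y.increments N \<omega>) j = b j" if "j \<le> N" for j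
      using X.psum_increments[OF \<omega> that] Y.psum_increments[OF \<omega> that] by (simp_all add: a_def b_def)
    have ps: "psum (\<lambda>j\<in>{..<N}. h j) j = psum h j" if "j \<le> N" for j h
      using that by (intro psum_cong) auto
    have plus: "psum (\<lambda>j. (X.increments N \<omega> j + Y.increments N \<omega> j) / sqrt 2) j = (a j + b j) / sqrt 2"
      and minus: "psum (\<lambda>j. (X.increments N \<omega> j - Y.increments N \<omega> j) / sqrt 2) j = (a j - b j) / sqrt 2" if "j \<le> N" for j
      using pa[OF that] pb[OF that]
      by (simp_all add: psum_def sum.distrib sum_subtractf flip: sum_divide_distrib)
    have nrm: "(a i - a j)\<^sup>2 + (b i - b j)\<^sup>2 \<le> (c \<omega>)\<^sup>2" and c0: "0 \<le> c \<omega>" if "i \<le> N" "j \<le> N" for i j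
    proof -
      have "sqrt ((a i - a j)\<^sup>2 + (b i - b j)\<^sup>2) \<le> c \<omega>"
        using c[OF \<omega> that] by (simp add: norm_vec2 a_def b_def)
      then show "(a i - a j)\<^sup>2 + (b i - b j)\<^sup>2 \<le> (c \<omega>)\<^sup>2" by (rule sqrt_le_D)
      show "0 \<le> c \<omega>" by (rule order_trans[OF norm_ge_zero c[OF \<omega> that]])
    qed
    have c0': "0 \<le> c \<omega>" using c0[of 0 0] by simp
    have b1: "\<bar>a i - a j\<bar> \<le> c \<omega>" "\<bar>b i - b j\<bar> \<le> c \<omega>"
      "\<bar>(a i + b i) / sqrt 2 - (a j + b j) / sqrt 2\<bar> \<le> c \<omega>" "\<bar>(a i - b i) / sqrt 2 - (a j - b j) / sqrt 2\<bar> \<le> c \<omega>"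
      if "i \<le> N" "j \<le> N" for i j
    proof -
      define p where "p = a i - a j"
      define q where "q = b i - b j"
      have pq: "p\<^sup>2 + q\<^sup>2 \<le> (c \<omega>)\<^sup>2" using nrm[OF that] by (simp add: p_def q_def)
      have abs_le: "\<bar>x\<bar> \<le> c \<omega>" if "x\<^sup>2 \<le> (c \<omega>)\<^sup>2" for x
        using abs_le_square_iff[of x "c \<omega>"] that c0' by simp
      have "((p + q) / sqrt 2)\<^sup>2 + ((p - q) / sqrt 2)\<^sup>2 = p\<^sup>2 + q\<^sup>2"
        by (simp add: power_divide power2_sum power2_diff field_simps)
      then have r: "((p + q) / sqrt 2)\<^sup>2 \<le> (c \<omega>)\<^sup>2" "((p - q) / sqrt 2)\<^sup>2 \<le> (c \<omega>)\<^sup>2"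
        using pq zero_le_power2[of "(p + q) / sqrt 2"] zero_le_power2[of "(p - q) / sqrt 2"] by linarith+
      have pq2: "p\<^sup>2 \<le> (c \<omega>)\<^sup>2" "q\<^sup>2 \<le> (c \<omega>)\<^sup>2"
        using pq zero_le_power2[of p] zero_le_power2[of q] by linarith+
      show "\<bar>a i - a j\<bar> \<le> c \<omega>" "\<bar>b i - b j\<bar> \<le> c \<omega>"
        unfolding p_def[symmetric] q_def[symmetric] by (rule abs_le pq2)+
      have e: "(a i + b i) / sqrt 2 - (a j + b j) / sqrt 2 = (p + q) / sqrt 2"
        "(a i - b i) / sqrt 2 - (a j - b j) / sqrt 2 = (p - q) / sqrt 2"
        by (simp_all add: p_def q_def diff_divide_distrib[symmetric] algebra_simps)
      show "\<bar>(a i + b i) / sqrt 2 - (a j + b j) / sqrt 2\<bar> \<le> c \<omega>" "\<bar>(a i - b i) / sqrt 2 - (a j - b j) / sqrt 2\<bar> \<le> c \<omega>"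
        unfolding e by (rule abs_le r)+
    qed
    have "S ?\<rho>1 \<omega> \<le> c \<omega> * of_bool (\<bar>b N\<bar> / t < \<bar>a N\<bar>)"
      unfolding S_def fst_conv snd_conv
      using sector_range_le[of N "\<lambda>j\<in>{..<N}. X.increments N \<omega> j" "c \<omega>" t "\<lambda>j\<in>{..<N}. Y.increments N \<omega> j"] b1(1)
      by (simp add: ps pa pb)
    moreover have "S ?\<rho>2 \<omega> \<le> c \<omega> * of_bool (\<bar>a N\<bar> / t < \<bar>b N\<bar>)"
      unfolding S_def fst_conv snd_conv
      using sector_range_le[of N "\<lambda>j\<in>{..<N}. Y.increments N \<omega> j" "c \<omega>" t "\<lambda>j\<in>{..<N}. X.increments N \<omega> j"] b1(2)
      by (simp add: ps pa pb)
    moreover have "S ?\<rho>3 \<omega> \<le> c \<omega> * of_bool (\<bar>(a N - b N) / sqrt 2\<bar> / t < \<bar>(a N + b N) / sqrt 2\<bar>)"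
      unfolding S_def fst_conv snd_conv
      using sector_range_le[of N "\<lambda>j\<in>{..<N}. (X.increments N \<omega> j + Y.increments N \<omega> j) / sqrt 2" "c \<omega>" t
          "\<lambda>j\<in>{..<N}. (X.increments N \<omega> j - Y.increments N \<omega> j) / sqrt 2"] b1(3)
      by (simp only: ps plus minus order_refl)
    moreover have "S ?\<rho>4 \<omega> \<le> c \<omega> * of_bool (\<bar>(a N + b N) / sqrt 2\<bar> / t < \<bar>(a N - b N) / sqrt 2\<bar>)"
      unfolding S_def fst_conv snd_conv
      using sector_range_le[of N "\<lambda>j\<in>{..<N}. (X.increments N \<omega> j - Y.increments N \<omega> j) / sqrt 2" "c \<omega>" t
          "\<lambda>j\<in>{..<N}. (X.increments N \<omega> j + Y.increments N \<omega> j) / sqrt 2"] b1(4)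
      by (simp only: ps plus minus order_refl)
    moreover have "c \<omega> * (of_bool (\<bar>b N\<bar> / t < \<bar>a N\<bar>) + of_bool (\<bar>a N\<bar> / t < \<bar>b N\<bar>)
        + of_bool (\<bar>(a N - b N) / sqrt 2\<bar> / t < \<bar>(a N + b N) / sqrt 2\<bar>) + of_bool (\<bar>(a N + b N) / sqrt 2\<bar> / t < \<bar>(a N - b N) / sqrt 2\<bar>)) \<le> c \<omega> * 1"
      unfolding t_def using c0' by (intro mult_left_mono sectors_disjoint)
    ultimately have "S ?\<rho>1 \<omega> + S ?\<rho>2 \<omega> + S ?\<rho>3 \<omega> + S ?\<rho>4 \<omega> \<le> c \<omega>"
      unfolding distrib_left by linarith
    then have "ennreal (S ?\<rho>1 \<omega> + S ?\<rho>2 \<omega> + S ?\<rho>3 \<omega> + S ?\<rho>4 \<omega>) \<le> ennreal (c \<omega>)" by (rule ennreal_leI)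
    then show "ennreal (S ?\<rho>1 \<omega>) + ennreal (S ?\<rho>2 \<omega>) + ennreal (S ?\<rho>3 \<omega>) + ennreal (S ?\<rho>4 \<omega>) \<le> ennreal (c \<omega>)"
      by (simp add: S_def sector_range_nonneg)
  qed
  finally show ?thesis unfolding Q_def .
qed

end

section \<open>The circumradius of the Brownian path\<close>

context planar_brownian_motion
begin

definition path_points :: "'a \<Rightarrow> (real ^ 2) set" where
  "path_points \<omega> = (\<lambda>s. W s \<omega>) ` {0..1}"

text \<open>The disk is centred in the bounding box and has half its diagonal as radius. The times
  at which the coordinate extrema are attained are returned as well, so that they can be
  approximated by grid times.\<close>

lemma path_bounding_box:
  assumes "\<omega> \<in> space M"
  obtains s1 s1' s2 s2' c where "s1 \<in> {0..1}" "s1' \<in> {0..1}" "s2 \<in> {0..1}" "s2' \<in> {0..1}"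
    "W s1' \<omega> $ 1 \<le> W s1 \<omega> $ 1" "W s2' \<omega> $ 2 \<le> W s2 \<omega> $ 2"
    "path_points \<omega> \<subseteq> cball c (sqrt ((W s1 \<omega> $ 1 - W s1' \<omega> $ 1)\<^sup>2 + (W s2 \<omega> $ 2 - W s2' \<omega> $ 2)\<^sup>2) / 2)"
proof -
  have c: "continuous_on {0..1} (\<lambda>s. W s \<omega> $ 1)" "continuous_on {0..1} (\<lambda>s. W s \<omega> $ 2)"
    by (rule continuous_on_subset[OF X.continuous_paths[OF assms]], simp,
        rule continuous_on_subset[OF Y.continuous_paths[OF assms]], simp)
  have ne: "compact {0..1::real}" "{0..1::real} \<noteq> {}" by auto
  obtain s1 where 1: "s1 \<in> {0..1}" "\<forall>s\<in>{0..1}. W s \<omega> $ 1 \<le> W s1 \<omega> $ 1"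
    using continuous_attains_sup[OF ne c(1)] by blast
  obtain s1' where 2: "s1' \<in> {0..1}" "\<forall>s\<in>{0..1}. W s1' \<omega> $ 1 \<le> W s \<omega> $ 1"
    using continuous_attains_inf[OF ne c(1)] by blast
  obtain s2 where 3: "s2 \<in> {0..1}" "\<forall>s\<in>{0..1}. W s \<omega> $ 2 \<le> W s2 \<omega> $ 2"
    using continuous_attains_sup[OF ne c(2)] by blast
  obtain s2' where 4: "s2' \<in> {0..1}" "\<forall>s\<in>{0..1}. W s2' \<omega> $ 2 \<le> W s \<omega> $ 2"
    using continuous_attains_inf[OF ne c(2)] by blast
  define p where "p = W s1 \<omega> $ 1 - W s1' \<omega> $ 1"
  define q where "q = W s2 \<omega> $ 2 - W s2' \<omega> $ 2"
  define c :: "real ^ 2" where "c = (\<chi> i. if i = 1 then (W s1 \<omega> $ 1 + W s1' \<omega> $ 1) / 2 else (W s2 \<omega> $ 2 + W s2' \<omega> $ 2) / 2)"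
  have mid: "\<bar>(x + y) / 2 - w\<bar> \<le> (x - y) / 2" if "y \<le> w" "w \<le> x" for x y w :: real
    using that by (simp add: abs_if field_simps)
  have "sqrt (((p / 2)\<^sup>2 + (q / 2)\<^sup>2)) = sqrt ((p\<^sup>2 + q\<^sup>2) / 4)"
    by (simp add: power_divide add_divide_distrib)
  then have half: "sqrt (((p / 2)\<^sup>2 + (q / 2)\<^sup>2)) = sqrt (p\<^sup>2 + q\<^sup>2) / 2" by (simp add: real_sqrt_divide)
  have "dist c (W s \<omega>) \<le> sqrt (p\<^sup>2 + q\<^sup>2) / 2" if "s \<in> {0..1}" for s
  proof -
    have e: "(c - W s \<omega>) $ 1 = (W s1 \<omega> $ 1 + W s1' \<omega> $ 1) / 2 - W s \<omega> $ 1"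
      "(c - W s \<omega>) $ 2 = (W s2 \<omega> $ 2 + W s2' \<omega> $ 2) / 2 - W s \<omega> $ 2"
      by (simp_all add: c_def)
    have "\<bar>(c - W s \<omega>) $ 1\<bar> \<le> p / 2" "\<bar>(c - W s \<omega>) $ 2\<bar> \<le> q / 2"
      unfolding e p_def q_def by (rule mid; use 1 2 3 4 that in blast)+
    then have "((c - W s \<omega>) $ 1)\<^sup>2 + ((c - W s \<omega>) $ 2)\<^sup>2 \<le> (p / 2)\<^sup>2 + (q / 2)\<^sup>2"
      by (intro add_mono) (auto simp: abs_le_square_iff[symmetric])
    then show ?thesis unfolding dist_norm norm_vec2 half[symmetric] by simp
  qed
  then have "path_points \<omega> \<subseteq> cball c (sqrt (p\<^sup>2 + q\<^sup>2) / 2)" by (auto simp: path_points_def)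
  then show ?thesis
    using 1 2 3 4 unfolding p_def q_def by (intro that[of s1 s1' s2 s2' c]) auto
qed

lemma bounded_path_points:
  assumes "\<omega> \<in> space M" shows "bounded (path_points \<omega>)"
  by (rule path_bounding_box[OF assms]) (rule bounded_subset[OF bounded_cball])

lemma circumradius_path_nonneg: "\<omega> \<in> space M \<Longrightarrow> 0 \<le> circumradius (path_points \<omega>)"
  by (intro circumradius_nonneg bounded_path_points)

lemma norm_increment_le:
  assumes "\<omega> \<in> space M" "s \<in> {0..1}" "s' \<in> {0..1}"
  shows "norm (W s \<omega> - W s' \<omega>) \<le> 2 * circumradius (path_points \<omega>)"
proof -
  obtain c where "path_points \<omega> \<subseteq> cball c (circumradius (path_points \<omega>))"
    using circumradius_cball[OF bounded_path_points[OF assms(1)]] by blast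
  moreover have "W s \<omega> \<in> path_points \<omega>" "W s' \<omega> \<in> path_points \<omega>"
    unfolding path_points_def using assms by blast+
  ultimately have "dist c (W s \<omega>) \<le> circumradius (path_points \<omega>)" "dist c (W s' \<omega>) \<le> circumradius (path_points \<omega>)"
    unfolding mem_cball[symmetric] by blast+
  then show ?thesis
    using dist_triangle3[of "W s \<omega>" "W s' \<omega>" c] by (simp add: dist_norm)
qed

text \<open>A grid range may miss the extrema, but it dominates the increment between the grid times
  floor (s N) / N next to the extremal times; by continuity these increments converge to the sides
  of the bounding box.\<close>

lemma circumradius_sq_le_liminf:
  assumes "\<omega> \<in> space M"
  shows "ennreal (4 * (circumradius (path_points \<omega>))\<^sup>2)
    \<le> liminf (\<lambda>N. ennreal ((X.grid_range N \<omega>)\<^sup>2) + ennreal ((Y.grid_range N \<omega>)\<^sup>2))"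
proof -
  obtain s1 s1' s2 s2' c where s: "s1 \<in> {0..1}" "s1' \<in> {0..1}" "s2 \<in> {0..1}" "s2' \<in> {0..1}"
    and order: "W s1' \<omega> $ 1 \<le> W s1 \<omega> $ 1" "W s2' \<omega> $ 2 \<le> W s2 \<omega> $ 2"
    and box: "path_points \<omega> \<subseteq> cball c (sqrt ((W s1 \<omega> $ 1 - W s1' \<omega> $ 1)\<^sup>2 + (W s2 \<omega> $ 2 - W s2' \<omega> $ 2)\<^sup>2) / 2)"
    using path_bounding_box[OF assms] by blast
  define p where "p = W s1 \<omega> $ 1 - W s1' \<omega> $ 1"
  define q where "q = W s2 \<omega> $ 2 - W s2' \<omega> $ 2"
  have pq: "0 \<le> p" "0 \<le> q" using order by (auto simp: p_def q_def)
  have "path_points \<omega> \<subseteq> cball c (sqrt (p\<^sup>2 + q\<^sup>2) / 2)" using box unfolding p_def q_def .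
  then have "circumradius (path_points \<omega>) \<le> sqrt (p\<^sup>2 + q\<^sup>2) / 2"
    by (rule circumradius_le[OF bounded_path_points[OF assms], rotated]) simp
  then have "(circumradius (path_points \<omega>))\<^sup>2 \<le> (sqrt (p\<^sup>2 + q\<^sup>2) / 2)\<^sup>2"
    using circumradius_path_nonneg[OF assms] by (intro power_mono)
  then have R: "4 * (circumradius (path_points \<omega>))\<^sup>2 \<le> p\<^sup>2 + q\<^sup>2" by (simp add: power_divide)
  define g where "g = (\<lambda>s N. real (nat \<lfloor>s * real N\<rfloor>) / real N)"
  define x where "x = (\<lambda>N. W (g s1 N) \<omega> $ 1 - W (g s1' N) \<omega> $ 1)"
  define y where "y = (\<lambda>N. W (g s2 N) \<omega> $ 2 - W (g s2' N) \<omega> $ 2)"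
  have "x \<longlonglongrightarrow> p" "y \<longlonglongrightarrow> q"
    unfolding x_def y_def p_def q_def g_def
    by (intro tendsto_diff X.grid_floor_tendsto Y.grid_floor_tendsto assms; use s in simp)+
  \<comment> \<open>The grid increments can be negative for small N; they are truncated at 0 before
    squaring so that the comparison with the grid ranges survives.\<close>
  then have "(\<lambda>N. ennreal ((max 0 (x N))\<^sup>2 + (max 0 (y N))\<^sup>2)) \<longlonglongrightarrow> ennreal ((max 0 p)\<^sup>2 + (max 0 q)\<^sup>2)"
    by (intro tendsto_intros)
  then have lim: "(\<lambda>N. ennreal ((max 0 (x N))\<^sup>2 + (max 0 (y N))\<^sup>2)) \<longlonglongrightarrow> ennreal (p\<^sup>2 + q\<^sup>2)"
    using pq by (simp add: max_absorb2)
  have "ennreal (4 * (circumradius (path_points \<omega>))\<^sup>2) \<le> ennreal (p\<^sup>2 + q\<^sup>2)" using R by (rule ennreal_leI)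
  also have "\<dots> = liminf (\<lambda>N. ennreal ((max 0 (x N))\<^sup>2 + (max 0 (y N))\<^sup>2))"
    by (rule lim_imp_Liminf[OF _ lim, symmetric]) simp
  also have "\<dots> \<le> liminf (\<lambda>N. ennreal ((X.grid_range N \<omega>)\<^sup>2) + ennreal ((Y.grid_range N \<omega>)\<^sup>2))"
  proof (intro Liminf_mono always_eventually allI)
    fix N
    have "max 0 (x N) \<le> X.grid_range N \<omega>" "max 0 (y N) \<le> Y.grid_range N \<omega>"
      using s assms X.grid_range_ge[OF assms, of "nat \<lfloor>s1 * real N\<rfloor>" N "nat \<lfloor>s1' * real N\<rfloor>"]
        Y.grid_range_ge[OF assms, of "nat \<lfloor>s2 * real N\<rfloor>" N "nat \<lfloor>s2' * real N\<rfloor>"]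
      by (auto simp: x_def y_def g_def X.grid_floor_le X.grid_range_def Y.grid_range_def walk_max_nonneg)
    then have "(max 0 (x N))\<^sup>2 + (max 0 (y N))\<^sup>2 \<le> (X.grid_range N \<omega>)\<^sup>2 + (Y.grid_range N \<omega>)\<^sup>2"
      by (intro add_mono power_mono) auto
    then show "ennreal ((max 0 (x N))\<^sup>2 + (max 0 (y N))\<^sup>2) \<le> ennreal ((X.grid_range N \<omega>)\<^sup>2) + ennreal ((Y.grid_range N \<omega>)\<^sup>2)"
      by (simp add: ennreal_leI flip: ennreal_plus)
  qed
  finally show ?thesis .
qed

text \<open>Fatou's lemma gives the limit in N for fixed K, in which the error 4 K
  \<open>step_error N\<close> disappears. K tends to infinity only afterwards, because this error
  grows with K.\<close>

lemma circumradius_sq_nn_integral_le: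
  "(\<integral>\<^sup>+\<omega>. ennreal (4 * (circumradius (path_points \<omega>))\<^sup>2) \<partial>M) \<le> ennreal (8 * ln 2)"
proof -
  define I where "I = (\<integral>\<^sup>+\<omega>. ennreal (4 * (circumradius (path_points \<omega>))\<^sup>2) \<partial>M)"
  have le: "I \<le> ennreal (2 * (2 + 2 * alternating_coeff K))" for K
  proof -
    define e where "e = (\<lambda>N. 2 + 2 * alternating_coeff K + 4 * real K * step_error N)"
    have e0: "0 \<le> e N" for N by (simp add: e_def alternating_coeff_nonneg step_error_def)
    have "I \<le> (\<integral>\<^sup>+\<omega>. liminf (\<lambda>N. ennreal ((X.grid_range N \<omega>)\<^sup>2) + ennreal ((Y.grid_range N \<omega>)\<^sup>2)) \<partial>M)"
      unfolding I_def by (intro nn_integral_mono circumradius_sq_le_liminf)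
    also have "\<dots> \<le> liminf (\<lambda>N. \<integral>\<^sup>+\<omega>. ennreal ((X.grid_range N \<omega>)\<^sup>2) + ennreal ((Y.grid_range N \<omega>)\<^sup>2) \<partial>M)"
      by (intro nn_integral_liminf) measurable
    also have "\<dots> \<le> liminf (\<lambda>N. ennreal (2 * e N))"
    proof (intro Liminf_mono eventually_sequentiallyI[of 1])
      fix N :: nat assume N: "1 \<le> N"
      have "(\<integral>\<^sup>+\<omega>. ennreal ((X.grid_range N \<omega>)\<^sup>2) + ennreal ((Y.grid_range N \<omega>)\<^sup>2) \<partial>M)
        = (\<integral>\<^sup>+\<omega>. ennreal ((X.grid_range N \<omega>)\<^sup>2) \<partial>M) + (\<integral>\<^sup>+\<omega>. ennreal ((Y.grid_range N \<omega>)\<^sup>2) \<partial>M)"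
        by (intro nn_integral_add) measurable
      also have "\<dots> \<le> ennreal (e N) + ennreal (e N)"
        unfolding e_def using N by (intro add_mono X.grid_range_sq_le Y.grid_range_sq_le) auto
      also have "\<dots> = ennreal (2 * e N)" using e0 by (simp flip: ennreal_plus)
      finally show "(\<integral>\<^sup>+\<omega>. ennreal ((X.grid_range N \<omega>)\<^sup>2) + ennreal ((Y.grid_range N \<omega>)\<^sup>2) \<partial>M) \<le> ennreal (2 * e N)" .
    qed
    also have "\<dots> = ennreal (2 * (2 + 2 * alternating_coeff K))"
    proof (rule lim_imp_Liminf)
      have "(\<lambda>N. ennreal (2 * e N)) \<longlonglongrightarrow> ennreal (2 * (2 + 2 * alternating_coeff K + 4 * real K * 0))"
        unfolding e_def by (intro tendsto_intros step_error_tendsto)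
      then show "(\<lambda>N. ennreal (2 * e N)) \<longlonglongrightarrow> ennreal (2 * (2 + 2 * alternating_coeff K))" by simp
    qed simp
    finally show ?thesis .
  qed
  have "(\<lambda>K. ennreal (2 * (2 + 2 * alternating_coeff K))) \<longlonglongrightarrow> ennreal (2 * (2 + 2 * (2 * ln 2 - 1)))"
    by (intro tendsto_intros alternating_coeff_tendsto)
  then have "I \<le> ennreal (2 * (2 + 2 * (2 * ln 2 - 1)))"
    by (rule LIMSEQ_le_const) (use le in auto)
  then show ?thesis by (simp add: I_def)
qed

text \<open>Reduction to countably many conditions: centres from a dense set, rational radii,
  rational times. Rational times are enough by continuity.\<close>

lemma circumradius_measurable [measurable]: "(\<lambda>\<omega>. circumradius (path_points \<omega>)) \<in> borel_measurable M"
proof -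
  obtain D :: "(real ^ 2) set" where D: "countable D" "\<And>U. open U \<Longrightarrow> U \<noteq> {} \<Longrightarrow> \<exists>d\<in>D. d \<in> U"
    using countable_dense_exists by blast
  define T where "T = {p :: nat \<times> nat. fst p \<le> snd p}"
  \<comment> \<open>The pair (0, 0) belongs to \<open>T\<close>; division by zero gives time 0,
    which lies in the unit interval.\<close>
  define f where "f = (\<lambda>p. real (fst p) / real (snd p))"
  have fT: "f p \<in> {0..1}" if "p \<in> T" for p
    using that by (auto simp: f_def T_def divide_le_eq_1)
  have less_iff: "circumradius (path_points \<omega>) < x \<longleftrightarrow> (\<exists>c\<in>D. \<exists>q\<in>\<rat>. 0 \<le> q \<and> q < x \<and> (\<forall>p\<in>T. dist c (W (f p) \<omega>) \<le> q))"
    if \<omega>: "\<omega> \<in> space M" for x \<omega>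
  proof
    let ?R = "circumradius (path_points \<omega>)"
    assume "?R < x"
    then obtain q where q: "q \<in> \<rat>" "?R < q" "q < x" using Rats_dense_in_real by blast
    obtain c0 where c0: "path_points \<omega> \<subseteq> cball c0 ?R"
      using circumradius_cball[OF bounded_path_points[OF \<omega>]] by blast
    \<comment> \<open>The strict inequality leaves room: moving the centre by less than q - R is
      paid for by enlarging the radius from R to q.\<close>
    obtain c where c: "c \<in> D" "c \<in> ball c0 (q - ?R)" using D(2)[of "ball c0 (q - ?R)"] q by auto
    have "dist c (W (f p) \<omega>) \<le> q" if "p \<in> T" for p
    proof -
      have "W (f p) \<omega> \<in> path_points \<omega>" unfolding path_points_def using fT[OF that] by blast
      then have "dist c0 (W (f p) \<omega>) \<le> ?R" unfolding mem_cball[symmetric] using c0 by blast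
      then show ?thesis using c(2) dist_triangle[of c "W (f p) \<omega>" c0] by (simp add: dist_commute)
    qed
    moreover have "0 \<le> q" using q circumradius_path_nonneg[OF \<omega>] by linarith
    ultimately show "\<exists>c\<in>D. \<exists>q\<in>\<rat>. 0 \<le> q \<and> q < x \<and> (\<forall>p\<in>T. dist c (W (f p) \<omega>) \<le> q)" using c q by blast
  next
    assume "\<exists>c\<in>D. \<exists>q\<in>\<rat>. 0 \<le> q \<and> q < x \<and> (\<forall>p\<in>T. dist c (W (f p) \<omega>) \<le> q)"
    then obtain c q where q: "0 \<le> q" "q < x" and cq: "\<And>p. p \<in> T \<Longrightarrow> dist c (W (f p) \<omega>) \<le> q" by blast
    have "dist c (W s \<omega>) \<le> q" if s: "s \<in> {0..1}" for s
    proof -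
      define g where "g = (\<lambda>N. f (nat \<lfloor>s * real N\<rfloor>, N))"
      have "(nat \<lfloor>s * real N\<rfloor>, N) \<in> T" for N using X.grid_floor_le[of s N] s by (simp add: T_def)
      then have "sqrt ((c $ 1 - W (g N) \<omega> $ 1)\<^sup>2 + (c $ 2 - W (g N) \<omega> $ 2)\<^sup>2) \<le> q" for N
        using cq[of "(nat \<lfloor>s * real N\<rfloor>, N)"] by (simp add: g_def dist_norm norm_vec2)
      moreover have "(\<lambda>N. sqrt ((c $ 1 - W (g N) \<omega> $ 1)\<^sup>2 + (c $ 2 - W (g N) \<omega> $ 2)\<^sup>2))
          \<longlonglongrightarrow> sqrt ((c $ 1 - W s \<omega> $ 1)\<^sup>2 + (c $ 2 - W s \<omega> $ 2)\<^sup>2)"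
        unfolding g_def f_def fst_conv snd_conv
        by (intro tendsto_real_sqrt tendsto_add tendsto_power tendsto_diff tendsto_const
            X.grid_floor_tendsto Y.grid_floor_tendsto \<omega>; use s in simp)
      ultimately have "sqrt ((c $ 1 - W s \<omega> $ 1)\<^sup>2 + (c $ 2 - W s \<omega> $ 2)\<^sup>2) \<le> q"
        by (intro LIMSEQ_le_const2) auto
      then show ?thesis by (simp add: dist_norm norm_vec2)
    qed
    then have "path_points \<omega> \<subseteq> cball c q" by (auto simp: path_points_def)
    then show "circumradius (path_points \<omega>) < x"
      using circumradius_le[OF bounded_path_points[OF \<omega>] q(1)] q(2) by (meson le_less_trans)
  qed
  have [measurable]: "(\<lambda>\<omega>. dist c (W (f p) \<omega>)) \<in> borel_measurable M" for c p
  proof -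
    have [measurable]: "(\<lambda>\<omega>. W (f p) \<omega> $ 1) \<in> borel_measurable M" "(\<lambda>\<omega>. W (f p) \<omega> $ 2) \<in> borel_measurable M"
      by (rule X.measurable_at Y.measurable_at, simp add: f_def)+
    show ?thesis unfolding dist_norm norm_vec2 vector_minus_component by measurable
  qed
  have [simp]: "countable T" by (rule countableI_type)
  show ?thesis
    unfolding borel_measurable_iff_less
  proof
    fix x
    have "{\<omega> \<in> space M. circumradius (path_points \<omega>) < x}
      = {\<omega> \<in> space M. \<exists>c\<in>D. \<exists>q\<in>\<rat>. 0 \<le> q \<and> q < x \<and> (\<forall>p\<in>T. dist c (W (f p) \<omega>) \<le> q)}"
      using less_iff by blast
    also have "\<dots> \<in> sets M"
    proof (intro sets.sets_Collect_countable_Ex' sets.sets_Collect_conj sets.sets_Collect_const D(1) countable_rat)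
      fix c :: "real ^ 2" and q :: real
      show "{\<omega> \<in> space M. \<forall>p\<in>T. dist c (W (f p) \<omega>) \<le> q} \<in> sets M"
        by measurable
    qed
    finally show "{\<omega> \<in> space M. circumradius (path_points \<omega>) < x} \<in> sets M" .
  qed
qed

text \<open>The bound on the mean square gives integrability of R and, by nonnegativity of the
  variance, the upper bound.\<close>

lemma expectation_circumradius_bounds:
  "0.928 \<le> expectation (\<lambda>\<omega>. circumradius (path_points \<omega>))"
  "expectation (\<lambda>\<omega>. circumradius (path_points \<omega>)) \<le> sqrt (2 * ln 2)"
proof -
  define R where "R = (\<lambda>\<omega>. circumradius (path_points \<omega>))"
  have [measurable]: "R \<in> borel_measurable M" unfolding R_def by (rule circumradius_measurable)
  have R_nonneg: "0 \<le> R \<omega>" if "\<omega> \<in> space M" for \<omega>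
    unfolding R_def using that by (rule circumradius_path_nonneg)
  have le4: "(\<integral>\<^sup>+\<omega>. ennreal (4 * (R \<omega>)\<^sup>2) \<partial>M) \<le> ennreal (8 * ln 2)"
    unfolding R_def by (rule circumradius_sq_nn_integral_le)
  have int4: "integrable M (\<lambda>\<omega>. 4 * (R \<omega>)\<^sup>2)"
  proof (rule integrableI_nonneg)
    show "(\<integral>\<^sup>+\<omega>. ennreal (4 * (R \<omega>)\<^sup>2) \<partial>M) < \<infinity>"
      by (rule le_less_trans[OF le4]) simp
  qed simp_all
  then have int2: "integrable M (\<lambda>\<omega>. (R \<omega>)\<^sup>2)" by simp
  then have int: "integrable M R" by (rule square_integrable_imp_integrable[rotated]) measurable
  have "(\<integral>\<^sup>+\<omega>. ennreal (4 * (R \<omega>)\<^sup>2) \<partial>M) = ennreal (expectation (\<lambda>\<omega>. 4 * (R \<omega>)\<^sup>2))"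
    by (rule nn_integral_eq_integral[OF int4]) simp
  moreover have "0 \<le> 8 * ln (2 :: real)" by simp
  ultimately have "expectation (\<lambda>\<omega>. 4 * (R \<omega>)\<^sup>2) \<le> 8 * ln 2"
    using le4 ennreal_le_iff by metis
  then have ER2: "expectation (\<lambda>\<omega>. (R \<omega>)\<^sup>2) \<le> 2 * ln 2"
    unfolding integral_mult_right_zero by linarith
  have "(expectation R)\<^sup>2 \<le> expectation (\<lambda>\<omega>. (R \<omega>)\<^sup>2)"
  proof -
    have "0 \<le> expectation (\<lambda>\<omega>. (R \<omega> - expectation R)\<^sup>2)" by (rule variance_positive)
    then show ?thesis unfolding variance_eq[OF int int2] by linarith
  qed
  then have "(expectation R)\<^sup>2 \<le> 2 * ln 2" using ER2 by linarith
  then show "expectation (\<lambda>\<omega>. circumradius (path_points \<omega>)) \<le> sqrt (2 * ln 2)"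
    unfolding R_def by (rule real_le_rsqrt)
  define t :: real where "t = sqrt 2 - 1"
  define J where "J = (\<lambda>t. sqrt (2 / pi) * (t / sqrt (1 + t\<^sup>2)))"
  define L where "L = 2 * J t - (sqrt (2 / pi) - J (1 / t)) / t"
  have t: "0 < t" unfolding t_def using real_sqrt_less_iff[of 1 2] by simp
  have L_num: "0.928 \<le> 2 * L" unfolding L_def J_def t_def by (rule sector_excess_numeric)
  \<comment> \<open>Each of the four axes contributes at least L - 8 \<open>step_error N\<close>,
    and together they contribute at most the mean of 2 R, which dominates the diameter of the path.
    As N grows this becomes E R >= 2 L.\<close>
  have "4 * L \<le> 2 * expectation R + 32 * step_error N" if N: "0 < N" for N
  proof -
    interpret N: normal_walk N by standard fact
    define Q where "Q = (\<integral>\<^sup>+z. ennreal (sector_range N t (fst z) (snd z)) \<partial>(N.P \<Otimes>\<^sub>M N.P))"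
    have 1: "ennreal L \<le> Q + 8 * ennreal (step_error N)"
      unfolding L_def J_def Q_def
      by (rule order_trans[OF nn_integral_std_normal_sector_excess[OF t] X.nn_integral_sector_range[OF N t]])
    have 2: "4 * Q \<le> (\<integral>\<^sup>+\<omega>. ennreal (2 * R \<omega>) \<partial>M)"
      unfolding Q_def t_def
    proof (rule sector_ranges_le[OF N])
      fix \<omega> i j assume "\<omega> \<in> space M" "i \<le> N" "j \<le> N"
      then show "norm (W (real i / real N) \<omega> - W (real j / real N) \<omega>) \<le> 2 * R \<omega>"
        unfolding R_def using N by (intro norm_increment_le) auto
    qed
    have 3: "(\<integral>\<^sup>+\<omega>. ennreal (2 * R \<omega>) \<partial>M) = ennreal (2 * expectation R)"
      using int R_nonneg by (subst nn_integral_eq_integral) auto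
    have e0: "0 \<le> step_error N" and ER0: "0 \<le> expectation R"
      using N.error_pos R_nonneg by (simp_all add: integral_nonneg_AE)
    have "ennreal (4 * L) = 4 * ennreal L" using L_num by (simp add: ennreal_mult)
    also have "\<dots> \<le> 4 * (Q + 8 * ennreal (step_error N))" by (intro mult_left_mono 1) simp
    also have "\<dots> = 4 * Q + ennreal (32 * step_error N)"
    proof -
      have "4 * (8 * ennreal (step_error N)) = ennreal (32 * step_error N)"
        using e0 by (simp add: ennreal_mult mult.assoc[symmetric])
      then show ?thesis by (simp add: distrib_left)
    qed
    also have "\<dots> \<le> ennreal (2 * expectation R) + ennreal (32 * step_error N)"
      using 2 3 by (intro add_mono) auto
    also have "\<dots> = ennreal (2 * expectation R + 32 * step_error N)"
      using e0 ER0 by (intro ennreal_plus[symmetric]) auto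
    finally show ?thesis using e0 ER0 by (subst (asm) ennreal_le_iff) auto
  qed
  then have ev: "\<exists>N0. \<forall>N\<ge>N0. 4 * L \<le> 2 * expectation R + 32 * step_error N"
    by (intro exI[of _ 1]) simp
  have "(\<lambda>N. 2 * expectation R + 32 * step_error N) \<longlonglongrightarrow> 2 * expectation R + 32 * 0"
    by (intro tendsto_add tendsto_mult tendsto_const step_error_tendsto)
  from LIMSEQ_le_const[OF this ev] have "4 * L \<le> 2 * expectation R + 32 * 0" .
  then show "0.928 \<le> expectation (\<lambda>\<omega>. circumradius (path_points \<omega>))"
    using L_num unfolding R_def by simp
qed

end

theorem proposition1p2:
  fixes M :: "'a measure" and W :: "real \<Rightarrow> 'a \<Rightarrow> real ^ 2"
    and H :: "'a \<Rightarrow> (real ^ 2) set" and R :: "'a \<Rightarrow> real"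
  assumes "planar_brownian_motion M W"
    and "\<And>\<omega>. H \<omega> = convex hull ((\<lambda>s. W s \<omega>) ` {0..1})"
    and "\<And>\<omega>. R \<omega> = circumradius (H \<omega>)"
  shows "0.928 \<le> prob_space.expectation M R \<and> prob_space.expectation M R \<le> sqrt (2 * ln 2)"
proof -
  interpret planar_brownian_motion M W by fact
  have "R = (\<lambda>\<omega>. circumradius (path_points \<omega>))"
    by (auto simp: assms(2,3) circumradius_convex_hull path_points_def)
  then show ?thesis using expectation_circumradius_bounds by simp
qed

end
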